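(* Let $X$ be a simplicial complex, $f:X\to X$ an open (continuous) map and $A\subset X$ a subcomplex such that $f(A)=A$ and $f(X\setminus A)\subset X\setminus A$. Then $$\varLambda(f,X)=\varLambda(f_{|A},A)+\varLambda(\tilde f,X/A)-1,$$ where $\tilde f:X/A\to X/A$ is the map induced by $f$ on the quotient.
   Context: Simplicial complexes are finite and identified with their underlying compact polyhedra. $\varLambda(f,X)=\sum_p(-1)^p\,\mathrm{tr}\bigl(f_*:H_p(X;\mathbb{Q})\to H_p(X;\mathbb{Q})\bigr)$ denotes the usual (unreduced) Lefschetz number. *)

theory Defs
  imports
    "HOL-Analysis.Analysis"
    "HOL-Algebra.Module"
    "HOL-Homology.Homology"
begin

section \<open>Trace of an endomorphism of a finite-dimensional vector space\<close>

definition module_basis ::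
    "('r, 'k) ring_scheme \<Rightarrow> ('r, 'v, 'l) module_scheme \<Rightarrow> nat \<Rightarrow> (nat \<Rightarrow> 'v) \<Rightarrow> bool" where
  "module_basis R M n e \<longleftrightarrow>
     e \<in> {..<n} \<rightarrow> carrier M \<and>
     (\<forall>v\<in>carrier M. \<exists>!a. a \<in> {..<n} \<rightarrow>\<^sub>E carrier R \<and>
        v = (\<Oplus>\<^bsub>M\<^esub>i\<in>{..<n}. a i \<odot>\<^bsub>M\<^esub> e i))"

text \<open>The trace is the sum of the diagonal entries of the matrix representing \<open>\<phi>\<close> in a finite
  basis; it does not depend on the basis. (It is unspecified if there is no finite basis.)\<close>

definition module_trace ::
    "('r, 'k) ring_scheme \<Rightarrow> ('r, 'v, 'l) module_scheme \<Rightarrow> ('v \<Rightarrow> 'v) \<Rightarrow> 'r" where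
  "module_trace R M \<phi> =
     (THE t. \<exists>n e m. module_basis R M n e \<and>
        (\<forall>i<n. \<forall>j<n. m i j \<in> carrier R) \<and>
        (\<forall>j<n. \<phi> (e j) = (\<Oplus>\<^bsub>M\<^esub>i\<in>{..<n}. m i j \<odot>\<^bsub>M\<^esub> e i)) \<and>
        t = (\<Oplus>\<^bsub>R\<^esub>i\<in>{..<n}. m i i))"

definition rat_ring :: "rat ring" where
  "rat_ring = \<lparr>carrier = UNIV, mult = (*), one = 1, zero = 0, add = (+)\<rparr>"

lemma field_rat_ring: "field rat_ring"
proof -
  have "cring rat_ring"
  proof (rule cringI)
    show "abelian_group rat_ring"
    proof (rule abelian_groupI)
      fix a assume "a \<in> carrier rat_ring"
      show "\<exists>b\<in>carrier rat_ring. b \<oplus>\<^bsub>rat_ring\<^esub> a = \<zero>\<^bsub>rat_ring\<^esub>"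
        by (intro bexI[of _ "- a"]) (simp_all add: rat_ring_def)
    qed (simp_all add: rat_ring_def)
    show "comm_monoid rat_ring"
      by (rule comm_monoidI) (simp_all add: rat_ring_def)
  qed (simp add: rat_ring_def distrib_right)
  then show ?thesis
  proof (rule cring.cring_fieldI2)
    fix a assume "a \<in> carrier rat_ring" "a \<noteq> \<zero>\<^bsub>rat_ring\<^esub>"
    then show "\<exists>b\<in>carrier rat_ring. a \<otimes>\<^bsub>rat_ring\<^esub> b = \<one>\<^bsub>rat_ring\<^esub>"
      by (intro bexI[of _ "inverse a"]) (simp_all add: rat_ring_def)
  qed (simp add: rat_ring_def)
qed


section \<open>Singular homology with rational coefficients\<close>

text \<open>The library treats integral singular chains; the definitions below are the same ones with
  coefficients in the rationals.\<close>

type_synonym 'a rchain = "((nat \<Rightarrow> real) \<Rightarrow> 'a) \<Rightarrow>\<^sub>0 rat"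

definition rchains :: "nat \<Rightarrow> 'a topology \<Rightarrow> 'a rchain set" where
  "rchains p X = {c. Poly_Mapping.keys c \<subseteq> singular_simplex_set p X}"

definition rchain_scale :: "rat \<Rightarrow> 'a rchain \<Rightarrow> 'a rchain" where
  "rchain_scale q c = Poly_Mapping.map ((*) q) c"

definition rchain_boundary :: "nat \<Rightarrow> 'a rchain \<Rightarrow> 'a rchain" where
  "rchain_boundary p c =
     (if p = 0 then 0
      else \<Sum>\<sigma>\<in>Poly_Mapping.keys c. \<Sum>k\<le>p.
             Poly_Mapping.single (singular_face p k \<sigma>) ((-1) ^ k * Poly_Mapping.lookup c \<sigma>))"

definition rchain_map :: "nat \<Rightarrow> ('a \<Rightarrow> 'b) \<Rightarrow> 'a rchain \<Rightarrow> 'b rchain" where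
  "rchain_map p f c =
     (\<Sum>\<sigma>\<in>Poly_Mapping.keys c. Poly_Mapping.single (simplex_map p f \<sigma>) (Poly_Mapping.lookup c \<sigma>))"

definition rcycles :: "nat \<Rightarrow> 'a topology \<Rightarrow> 'a rchain set" where
  "rcycles p X = {c \<in> rchains p X. rchain_boundary p c = 0}"

definition rboundaries :: "nat \<Rightarrow> 'a topology \<Rightarrow> 'a rchain set" where
  "rboundaries p X = rchain_boundary (Suc p) ` rchains (Suc p) X"

definition rhom_class :: "nat \<Rightarrow> 'a topology \<Rightarrow> 'a rchain \<Rightarrow> 'a rchain set" where
  "rhom_class p X z = {w. w - z \<in> rboundaries p X}"

text \<open>The quotient vector space of cycles modulo boundaries. The fields \<open>mult\<close> and \<open>one\<close>
  of the record type are not part of the module structure.\<close>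

definition rat_homology :: "nat \<Rightarrow> 'a topology \<Rightarrow> (rat, 'a rchain set) module" where
  "rat_homology p X =
     \<lparr>carrier = rhom_class p X ` rcycles p X,
      mult = undefined, one = undefined,
      zero = rhom_class p X 0,
      add = (\<lambda>C D. \<Union>c\<in>C. \<Union>d\<in>D. rhom_class p X (c + d)),
      smult = (\<lambda>q C. \<Union>c\<in>C. rhom_class p X (rchain_scale q c))\<rparr>"

lemma sum_keys_superset:
  assumes "finite S" "Poly_Mapping.keys c \<subseteq> S" "\<And>\<sigma>. g \<sigma> 0 = 0"
  shows "(\<Sum>\<sigma>\<in>Poly_Mapping.keys c. g \<sigma> (Poly_Mapping.lookup c \<sigma>)) = (\<Sum>\<sigma>\<in>S. g \<sigma> (Poly_Mapping.lookup c \<sigma>))"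
  using assms by (intro sum.mono_neutral_left) (auto simp: in_keys_iff)

lemma lookup_rchain_scale [simp]:
  "Poly_Mapping.lookup (rchain_scale q c) \<sigma> = q * Poly_Mapping.lookup c \<sigma>"
  by (simp add: rchain_scale_def Poly_Mapping.map.rep_eq when_def)

lemma rchain_boundary_add: "rchain_boundary p (c + d) = rchain_boundary p c + rchain_boundary p d"
proof (cases "p = 0")
  case False
  define g where "g = (\<lambda>\<sigma> r. \<Sum>k\<le>p. Poly_Mapping.single (singular_face p k (\<sigma> :: (nat \<Rightarrow> real) \<Rightarrow> 'a)) ((-1) ^ k * r :: rat))"
  have g: "g \<sigma> 0 = 0" "g \<sigma> (r + s) = g \<sigma> r + g \<sigma> s" for \<sigma> r s
    by (simp_all add: g_def distrib_left single_add sum.distrib)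
  have eq: "rchain_boundary p c = (\<Sum>\<sigma>\<in>Poly_Mapping.keys c. g \<sigma> (Poly_Mapping.lookup c \<sigma>))" for c
    using False by (simp add: rchain_boundary_def g_def)
  let ?S = "Poly_Mapping.keys c \<union> Poly_Mapping.keys d"
  show ?thesis
    unfolding eq
    using sum_keys_superset[of ?S c g] sum_keys_superset[of ?S d g] sum_keys_superset[of ?S "c + d" g]
    by (simp add: g keys_add lookup_add sum.distrib)
qed (simp add: rchain_boundary_def)

lemma rchain_boundary_scale: "rchain_boundary p (rchain_scale q c) = rchain_scale q (rchain_boundary p c)"
proof (cases "p = 0")
  case False
  define g where "g = (\<lambda>\<sigma> r. \<Sum>k\<le>p. Poly_Mapping.single (singular_face p k (\<sigma> :: (nat \<Rightarrow> real) \<Rightarrow> 'a)) ((-1) ^ k * r :: rat))"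
  have sc: "rchain_scale q (a + b) = rchain_scale q a + rchain_scale q b" "rchain_scale q 0 = 0"
    for a b :: "'b rchain"
    by (auto intro!: poly_mapping_eqI simp: lookup_add distrib_left)
  have scs: "rchain_scale q (sum h S) = (\<Sum>x\<in>S. rchain_scale q (h x))" for h :: "'c \<Rightarrow> 'b rchain" and S
    by (induction S rule: infinite_finite_induct) (auto simp: sc)
  have s1: "rchain_scale q (Poly_Mapping.single x r) = Poly_Mapping.single x (q * r)"
    for x :: "(nat \<Rightarrow> real) \<Rightarrow> 'b" and r
    by (auto intro!: poly_mapping_eqI simp: lookup_single when_def)
  have g: "g \<sigma> 0 = 0" "g \<sigma> (q * r) = rchain_scale q (g \<sigma> r)" for \<sigma> r
    by (simp_all add: g_def scs s1 mult.left_commute)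
  have eq: "rchain_boundary p c = (\<Sum>\<sigma>\<in>Poly_Mapping.keys c. g \<sigma> (Poly_Mapping.lookup c \<sigma>))" for c
    using False by (simp add: rchain_boundary_def g_def)
  have "Poly_Mapping.keys (rchain_scale q c) \<subseteq> Poly_Mapping.keys c"
    by (auto simp: in_keys_iff)
  then show ?thesis
    unfolding eq scs
    using sum_keys_superset[of "Poly_Mapping.keys c" "rchain_scale q c" g]
    by (simp add: g)
qed (auto intro!: poly_mapping_eqI simp: rchain_boundary_def)

lemma rchain_scale_simps:
  "rchain_scale q (a + b) = rchain_scale q a + rchain_scale q b"
  "rchain_scale q (a - b) = rchain_scale q a - rchain_scale q b"
  "rchain_scale (q + r) a = rchain_scale q a + rchain_scale r a"
  "rchain_scale (q * r) a = rchain_scale q (rchain_scale r a)"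
  "rchain_scale q 0 = 0" "rchain_scale 1 a = a" "rchain_scale (-1) a = - a"
  by (auto intro!: poly_mapping_eqI simp: lookup_add lookup_minus algebra_simps)

lemma rchains_closed:
  "0 \<in> rchains p X"
  "a \<in> rchains p X \<Longrightarrow> b \<in> rchains p X \<Longrightarrow> a + b \<in> rchains p X"
  "a \<in> rchains p X \<Longrightarrow> rchain_scale q a \<in> rchains p X"
proof -
  show "a + b \<in> rchains p X" if "a \<in> rchains p X" "b \<in> rchains p X"
    using that keys_add[of a b] unfolding rchains_def by blast
  have "Poly_Mapping.keys (rchain_scale q a) \<subseteq> Poly_Mapping.keys a"
    by (auto simp: in_keys_iff)
  then show "rchain_scale q a \<in> rchains p X" if "a \<in> rchains p X"
    using that unfolding rchains_def by blast
qed (simp add: rchains_def)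

lemma rchain_boundary_0 [simp]: "rchain_boundary p 0 = 0"
  by (simp add: rchain_boundary_def)

lemma rcycles_closed:
  "0 \<in> rcycles p X"
  "a \<in> rcycles p X \<Longrightarrow> b \<in> rcycles p X \<Longrightarrow> a + b \<in> rcycles p X"
  "a \<in> rcycles p X \<Longrightarrow> rchain_scale q a \<in> rcycles p X"
  by (auto simp: rcycles_def rchains_closed rchain_boundary_add rchain_boundary_scale rchain_scale_simps)

lemma rboundaries_closed:
  "0 \<in> rboundaries p X"
  "a \<in> rboundaries p X \<Longrightarrow> b \<in> rboundaries p X \<Longrightarrow> a + b \<in> rboundaries p X"
  "a \<in> rboundaries p X \<Longrightarrow> rchain_scale q a \<in> rboundaries p X"
proof -
  show "0 \<in> rboundaries p X"
    unfolding rboundaries_def by (rule image_eqI[of _ _ 0]) (simp_all add: rchains_closed)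
next
  assume "a \<in> rboundaries p X" "b \<in> rboundaries p X"
  then obtain c d where "c \<in> rchains (Suc p) X" "a = rchain_boundary (Suc p) c"
    "d \<in> rchains (Suc p) X" "b = rchain_boundary (Suc p) d"
    by (auto simp: rboundaries_def)
  then show "a + b \<in> rboundaries p X"
    unfolding rboundaries_def
    by (intro image_eqI[of _ _ "c + d"]) (simp_all add: rchain_boundary_add rchains_closed)
next
  assume "a \<in> rboundaries p X"
  then obtain c where "c \<in> rchains (Suc p) X" "a = rchain_boundary (Suc p) c"
    by (auto simp: rboundaries_def)
  then show "rchain_scale q a \<in> rboundaries p X"
    unfolding rboundaries_def
    by (intro image_eqI[of _ _ "rchain_scale q c"]) (simp_all add: rchain_boundary_scale rchains_closed)
qed

lemma rboundaries_minus: "a \<in> rboundaries p X \<Longrightarrow> - a \<in> rboundaries p X"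
  using rboundaries_closed(3)[of a p X "-1"] by (simp add: rchain_scale_simps)

lemma rhom_class_eq: "rhom_class p X z = rhom_class p X w \<longleftrightarrow> z - w \<in> rboundaries p X"
proof
  assume "rhom_class p X z = rhom_class p X w"
  moreover have "z \<in> rhom_class p X z"
    by (simp add: rhom_class_def rboundaries_closed)
  ultimately show "z - w \<in> rboundaries p X"
    by (simp add: rhom_class_def)
next
  assume zw: "z - w \<in> rboundaries p X"
  have "u - w \<in> rboundaries p X \<longleftrightarrow> u - z \<in> rboundaries p X" for u
    using rboundaries_closed(2)[OF _ zw, of "u - z"]
      rboundaries_closed(2)[OF _ rboundaries_minus[OF zw], of "u - w"] by auto
  then show "rhom_class p X z = rhom_class p X w"
    by (auto simp: rhom_class_def)
qed

lemma rhom_class_self: "z \<in> rhom_class p X z"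
  by (simp add: rhom_class_def rboundaries_closed)

lemma rat_homology_simps:
  "carrier (rat_homology p X) = rhom_class p X ` rcycles p X"
  "\<zero>\<^bsub>rat_homology p X\<^esub> = rhom_class p X 0"
  "rhom_class p X a \<oplus>\<^bsub>rat_homology p X\<^esub> rhom_class p X b = rhom_class p X (a + b)"
  "q \<odot>\<^bsub>rat_homology p X\<^esub> rhom_class p X a = rhom_class p X (rchain_scale q a)"
proof -
  have ne: "rhom_class p X z \<noteq> {}" for z :: "'a rchain"
    using rhom_class_self by blast
  have "rhom_class p X (c + d) = rhom_class p X (a + b)"
    if "c \<in> rhom_class p X a" "d \<in> rhom_class p X b" for c d
  proof -
    have "(c - a) + (d - b) \<in> rboundaries p X"
      using that by (intro rboundaries_closed) (simp_all add: rhom_class_def)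
    then show ?thesis
      by (simp add: rhom_class_eq algebra_simps)
  qed
  then have "(\<Union>c\<in>rhom_class p X a. \<Union>d\<in>rhom_class p X b. rhom_class p X (c + d)) =
      (\<Union>c\<in>rhom_class p X a. \<Union>d\<in>rhom_class p X b. rhom_class p X (a + b))"
    by (intro SUP_cong refl) blast
  then show "rhom_class p X a \<oplus>\<^bsub>rat_homology p X\<^esub> rhom_class p X b = rhom_class p X (a + b)"
    by (simp add: rat_homology_def ne)
  have "rhom_class p X (rchain_scale q c) = rhom_class p X (rchain_scale q a)"
    if "c \<in> rhom_class p X a" for c
  proof -
    have "rchain_scale q (c - a) \<in> rboundaries p X"
      using that by (intro rboundaries_closed) (simp_all add: rhom_class_def)
    then show ?thesis
      by (simp add: rhom_class_eq rchain_scale_simps)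
  qed
  then have "(\<Union>c\<in>rhom_class p X a. rhom_class p X (rchain_scale q c)) =
      (\<Union>c\<in>rhom_class p X a. rhom_class p X (rchain_scale q a))"
    by (intro SUP_cong refl) blast
  then show "q \<odot>\<^bsub>rat_homology p X\<^esub> rhom_class p X a = rhom_class p X (rchain_scale q a)"
    by (simp add: rat_homology_def ne)
qed (simp_all add: rat_homology_def)

lemma module_rat_homology: "module rat_ring (rat_homology p X)"
proof (rule moduleI)
  show "cring rat_ring"
    using field_rat_ring by (simp add: fieldE(1))
  show "abelian_group (rat_homology p X)"
  proof (rule abelian_groupI)
    fix C assume "C \<in> carrier (rat_homology p X)"
    then obtain a where a: "a \<in> rcycles p X" "C = rhom_class p X a"
      by (auto simp: rat_homology_simps)
    show "\<exists>D\<in>carrier (rat_homology p X). D \<oplus>\<^bsub>rat_homology p X\<^esub> C = \<zero>\<^bsub>rat_homology p X\<^esub>"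
      using a rcycles_closed(3)[of a p X "-1"]
      by (intro bexI[of _ "rhom_class p X (- a)"]) (auto simp: rat_homology_simps rchain_scale_simps)
  qed (auto simp: rat_homology_simps rcycles_closed add_ac)
qed (auto simp: rat_homology_simps rcycles_closed rchain_scale_simps rat_ring_def)

definition rat_hom_induced ::
    "nat \<Rightarrow> 'a topology \<Rightarrow> 'b topology \<Rightarrow> ('a \<Rightarrow> 'b) \<Rightarrow> 'a rchain set \<Rightarrow> 'b rchain set" where
  "rat_hom_induced p X Y f C = (\<Union>c\<in>C. rhom_class p Y (rchain_map p f c))"

text \<open>\<^const>\<open>Sum_any\<close> is the sum of the finitely many nonzero terms.\<close>

definition Lefschetz_number :: "('a \<Rightarrow> 'a) \<Rightarrow> 'a topology \<Rightarrow> rat" where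
  "Lefschetz_number f X =
     Sum_any (\<lambda>p. (-1) ^ p * module_trace rat_ring (rat_homology p X) (rat_hom_induced p X X f))"


section \<open>Collapsing a subset to a point\<close>

text \<open>Points of \<open>X/A\<close> are \<^term>\<open>Some x\<close> for \<open>x\<close> outside \<open>A\<close>, and \<^term>\<open>None\<close> for the point
  to which \<open>A\<close> is collapsed. The point \<^term>\<open>None\<close> is always present, so that \<open>X/A\<close> for empty \<open>A\<close>
  is \<open>X\<close> with a disjoint base point, as usual.\<close>

definition collapse_proj :: "'a set \<Rightarrow> 'a \<Rightarrow> 'a option" where
  "collapse_proj A x = (if x \<in> A then None else Some x)"

definition collapse_topology :: "'a topology \<Rightarrow> 'a set \<Rightarrow> 'a option topology" where
  "collapse_topology X A =
     topology (\<lambda>U. U \<subseteq> insert None (collapse_proj A ` topspace X) \<and>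
                   openin X {x \<in> topspace X. collapse_proj A x \<in> U})"

definition collapse_map :: "'a set \<Rightarrow> ('a \<Rightarrow> 'a) \<Rightarrow> 'a option \<Rightarrow> 'a option" where
  "collapse_map A f y = (case y of None \<Rightarrow> None | Some x \<Rightarrow> collapse_proj A (f x))"

lemma openin_collapse_topology:
  "openin (collapse_topology X A) U \<longleftrightarrow>
     U \<subseteq> insert None (collapse_proj A ` topspace X) \<and>
     openin X {x \<in> topspace X. collapse_proj A x \<in> U}"
proof -
  have "istopology (\<lambda>U. U \<subseteq> insert None (collapse_proj A ` topspace X) \<and>
                   openin X {x \<in> topspace X. collapse_proj A x \<in> U})"
    unfolding istopology_def
  proof (rule conjI; intro allI impI conjI)
    fix S T
    assume "S \<subseteq> insert None (collapse_proj A ` topspace X) \<and>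
              openin X {x \<in> topspace X. collapse_proj A x \<in> S}"
      and "T \<subseteq> insert None (collapse_proj A ` topspace X) \<and>
              openin X {x \<in> topspace X. collapse_proj A x \<in> T}"
    moreover have "{x \<in> topspace X. collapse_proj A x \<in> S \<inter> T} =
        {x \<in> topspace X. collapse_proj A x \<in> S} \<inter> {x \<in> topspace X. collapse_proj A x \<in> T}"
      by auto
    ultimately show "S \<inter> T \<subseteq> insert None (collapse_proj A ` topspace X)"
      "openin X {x \<in> topspace X. collapse_proj A x \<in> S \<inter> T}"
      by (auto simp del: Int_iff)
  next
    fix \<K> :: "'a option set set"
    assume *: "\<forall>K\<in>\<K>. K \<subseteq> insert None (collapse_proj A ` topspace X) \<and>
              openin X {x \<in> topspace X. collapse_proj A x \<in> K}"
    then show "\<Union>\<K> \<subseteq> insert None (collapse_proj A ` topspace X)"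
      by blast
    have "{x \<in> topspace X. collapse_proj A x \<in> \<Union>\<K>} =
        (\<Union>K\<in>\<K>. {x \<in> topspace X. collapse_proj A x \<in> K})"
      by auto
    then show "openin X {x \<in> topspace X. collapse_proj A x \<in> \<Union>\<K>}"
      using * by (auto intro!: openin_Union simp del: UN_iff)
  qed
  then show ?thesis
    by (simp add: collapse_topology_def)
qed

lemma topspace_collapse_topology:
  "topspace (collapse_topology X A) = insert None (collapse_proj A ` topspace X)"
proof -
  have "{x \<in> topspace X. collapse_proj A x \<in> insert None (collapse_proj A ` topspace X)} = topspace X"
    by auto
  then have "openin (collapse_topology X A) (insert None (collapse_proj A ` topspace X))"
    by (simp add: openin_collapse_topology)
  then show ?thesis
    by (metis openin_collapse_topology openin_subset openin_topspace subset_antisym)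
qed

lemma quotient_map_collapse_proj:
  assumes "topspace X \<inter> A \<noteq> {}"
  shows "quotient_map X (collapse_topology X A) (collapse_proj A)"
proof -
  have "None \<in> collapse_proj A ` topspace X"
    using assms by (auto simp: collapse_proj_def image_iff)
  then show ?thesis
    unfolding quotient_map_def
    by (auto simp: topspace_collapse_topology openin_collapse_topology)
qed

lemma collapse_map_proj:
  assumes "f ` A \<subseteq> A"
  shows "collapse_map A f (collapse_proj A x) = collapse_proj A (f x)"
  using assms by (auto simp: collapse_map_def collapse_proj_def)

end

theory Submission
  imports Defs
begin

text \<open>Write \<open>H(X, A)\<close> for rational homology. The long exact sequence of the pair cuts \<open>H(A)\<close>,
  \<open>H(X)\<close> and \<open>H(X, A)\<close> into invariant pieces, each piece occurring in exactly two of them, so the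
  alternating sums of traces satisfy \<open>\<Lambda>(X) = \<Lambda>(A) + \<Lambda>(X, A)\<close>; likewise
  \<open>\<Lambda>(X / A) = \<Lambda>(pt) + \<Lambda>(X / A, pt) = 1 + \<Lambda>(X / A, pt)\<close>. Since polyhedra are absolute
  neighbourhood retracts, a neighbourhood of \<open>A\<close> deforms into \<open>A\<close>, and excision gives
  \<open>H(X, A) \<cong> H(X / A, pt)\<close> compatibly with \<open>f\<close>. All homology is finite-dimensional because a
  compact ANR is a retract of a finite union of open balls, to which Mayer-Vietoris applies.\<close>

section \<open>Traces on subquotients of a vector space\<close>

text \<open>Since \<open>f\<close> need not be simplicial, traces are computed on singular chains,
  which form infinite-dimensional spaces. Every homology group is therefore kept as a pair
  \<open>Z\<close>, \<open>B\<close> of subspaces of chains; dimension and trace of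
  \<open>Z / B\<close> are defined through representatives, and the long exact sequence becomes a
  comparison of filtrations in which no quotient space is formed. Excision and homotopy invariance
  enter through integral homology and reach rational coefficients by clearing denominators. The
  delicate step is the collapse. Excision removes \<open>A\<close> from an open neighbourhood
  \<open>N\<close>, so it compares \<open>(X, N)\<close> with its image, not \<open>(X, A)\<close>;
  \<open>N\<close> must then be pushed back into \<open>A\<close> on both sides of the projection.
  The pushing homotopy has to descend to \<open>X / A\<close>, hence it keeps \<open>A\<close> in
  \<open>A\<close> at all times. Finiteness of the homology of \<open>X / A\<close> is not obtained
  from an embedding of the quotient: it is inherited from \<open>(X, A)\<close> once the relative
  groups are identified.\<close>

lemma sum_lessThan_add:
  fixes h :: "nat \<Rightarrow> 'a::comm_monoid_add"
  shows "(\<Sum>i<n + m. h i) = (\<Sum>i<n. h i) + (\<Sum>j<m. h (n + j))"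
  by (induction m) (simp_all add: add.assoc)

locale vector_quotient = vector_space scale
  for scale :: "'a::field \<Rightarrow> 'b::ab_group_add \<Rightarrow> 'b" (infixr \<open>\<cdot>\<close> 75)
begin

text \<open>A basis \<open>e\<close> of \<open>Z / B\<close> together with its dual basis \<open>c\<close>, both lifted to \<open>Z\<close>.
  With the dual basis at hand, traces are sums \<open>\<Sum>i<n. c i (\<phi> (e i))\<close> without matrices.\<close>

definition quotient_frame :: "'b set \<Rightarrow> 'b set \<Rightarrow> nat \<Rightarrow> (nat \<Rightarrow> 'b) \<Rightarrow> (nat \<Rightarrow> 'b \<Rightarrow> 'a) \<Rightarrow> bool" where
  "quotient_frame Z B n e c \<longleftrightarrow>
     (\<forall>i<n. e i \<in> Z) \<and>
     (\<forall>i<n. \<forall>u\<in>Z. \<forall>v\<in>Z. c i (u + v) = c i u + c i v) \<and>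
     (\<forall>i<n. \<forall>q. \<forall>v\<in>Z. c i (q \<cdot> v) = q * c i v) \<and>
     (\<forall>i<n. \<forall>v\<in>B. c i v = 0) \<and>
     (\<forall>i<n. \<forall>j<n. c i (e j) = (if i = j then 1 else 0)) \<and>
     (\<forall>v\<in>Z. v - (\<Sum>i<n. c i v \<cdot> e i) \<in> B)"

text \<open>Finite dimension of \<open>Z / B\<close>, where \<open>Z\<close> and \<open>B\<close>
  themselves may be infinite-dimensional. \<open>S\<close> is allowed to leave \<open>Z\<close>, so
  that passing to a smaller \<open>Z\<close> is immediate.\<close>

definition finite_quotient :: "'b set \<Rightarrow> 'b set \<Rightarrow> bool" where
  "finite_quotient Z B \<longleftrightarrow> (\<exists>S. finite S \<and> Z \<subseteq> span (S \<union> B))"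

definition quotient_trace :: "'b set \<Rightarrow> 'b set \<Rightarrow> ('b \<Rightarrow> 'b) \<Rightarrow> 'a" where
  "quotient_trace Z B \<phi> = (THE t. \<exists>n e c. quotient_frame Z B n e c \<and> t = (\<Sum>i<n. c i (\<phi> (e i))))"

lemma quotient_frameD:
  assumes "quotient_frame Z B n e c"
  shows "\<And>i. i < n \<Longrightarrow> e i \<in> Z"
    and "\<And>i u v. i < n \<Longrightarrow> u \<in> Z \<Longrightarrow> v \<in> Z \<Longrightarrow> c i (u + v) = c i u + c i v"
    and "\<And>i q v. i < n \<Longrightarrow> v \<in> Z \<Longrightarrow> c i (q \<cdot> v) = q * c i v"
    and "\<And>i v. i < n \<Longrightarrow> v \<in> B \<Longrightarrow> c i v = 0"
    and "\<And>i j. i < n \<Longrightarrow> j < n \<Longrightarrow> c i (e j) = (if i = j then 1 else 0)"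
    and "\<And>v. v \<in> Z \<Longrightarrow> v - (\<Sum>i<n. c i v \<cdot> e i) \<in> B"
  using assms unfolding quotient_frame_def by blast+

lemma quotient_frame_sum:
  assumes fr: "quotient_frame Z B n e c" and Z: "subspace Z" and "i < n"
    and "finite K" "\<And>k. k \<in> K \<Longrightarrow> g k \<in> Z"
  shows "c i (\<Sum>k\<in>K. a k \<cdot> g k) = (\<Sum>k\<in>K. a k * c i (g k))"
  using assms(4,5)
proof (induction K rule: finite_induct)
  case empty
  have "c i (0 \<cdot> 0) = 0 * c i 0"
    using quotient_frameD(3)[OF fr \<open>i < n\<close> subspace_0[OF Z]] by blast
  then show ?case by simp
next
  case (insert k K)
  have "(\<Sum>k\<in>K. a k \<cdot> g k) \<in> Z" "a k \<cdot> g k \<in> Z"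
    using insert Z by (auto intro!: subspace_sum subspace_scale)
  then show ?case
    using insert quotient_frameD(2,3)[OF fr \<open>i < n\<close>] by simp
qed

text \<open>The functionals are additive on \<open>Z\<close> only, so \<open>u\<close> is split as
  \<open>(u - v) + v\<close> with both summands in \<open>Z\<close>.\<close>

lemma quotient_frame_cong:
  assumes fr: "quotient_frame Z B n e c" and Z: "subspace Z" and "B \<subseteq> Z" "i < n"
    and "v \<in> Z" "u - v \<in> B"
  shows "c i u = c i v"
proof -
  have "c i ((u - v) + v) = c i (u - v) + c i v"
    using assms by (intro quotient_frameD(2)[OF fr]) auto
  then show ?thesis
    using quotient_frameD(4)[OF fr \<open>i < n\<close> \<open>u - v \<in> B\<close>] by simp
qed

text \<open>Change of frame: \<open>v\<close> is congruent modulo \<open>B\<close> to its expansion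
  in the second frame, and \<open>c i\<close> depends only on the class.\<close>

lemma quotient_frame_expand:
  assumes fr: "quotient_frame Z B n e c" and fr': "quotient_frame Z B m e' c'"
    and Z: "subspace Z" and "B \<subseteq> Z" and "i < n" "v \<in> Z"
  shows "c i v = (\<Sum>k<m. c' k v * c i (e' k))"
proof -
  have "(\<Sum>k<m. c' k v \<cdot> e' k) \<in> Z"
    using quotient_frameD(1)[OF fr'] Z by (auto intro!: subspace_sum subspace_scale)
  then have "c i v = c i (\<Sum>k<m. c' k v \<cdot> e' k)"
    using quotient_frameD(6)[OF fr' \<open>v \<in> Z\<close>] assms by (intro quotient_frame_cong[OF fr Z]) auto
  also have "\<dots> = (\<Sum>k<m. c' k v * c i (e' k))"
    using quotient_frameD(1)[OF fr'] \<open>i < n\<close> by (intro quotient_frame_sum[OF fr Z]) auto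
  finally show ?thesis .
qed

text \<open>This is \<open>tr (P Q) = tr (Q P)\<close> for the two change-of-frame matrices: each
  \<open>e' k\<close> is expanded in the frame \<open>e\<close>, the sums are exchanged, and the
  inner sum is recognised as an expansion in the frame \<open>e'\<close>.\<close>

lemma quotient_frame_trace_unique:
  assumes fr: "quotient_frame Z B n e c" and fr': "quotient_frame Z B m e' c'"
    and Z: "subspace Z" and BZ: "B \<subseteq> Z"
    and lin: "Vector_Spaces.linear scale scale \<phi>" and "\<phi> ` Z \<subseteq> Z" "\<phi> ` B \<subseteq> B"
  shows "(\<Sum>i<n. c i (\<phi> (e i))) = (\<Sum>k<m. c' k (\<phi> (e' k)))"
proof -
  interpret Vector_Spaces.linear scale scale \<phi> by fact
  note fD = quotient_frameD[OF fr] and fD' = quotient_frameD[OF fr']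
  have "c' k (\<phi> (e' k)) = (\<Sum>i<n. c i (e' k) * c' k (\<phi> (e i)))" if "k < m" for k
  proof -
    have eZ: "(\<Sum>i<n. c i (e' k) \<cdot> e i) \<in> Z"
      using fD(1) Z by (auto intro!: subspace_sum subspace_scale)
    have "\<phi> (e' k - (\<Sum>i<n. c i (e' k) \<cdot> e i)) \<in> B"
      using fD(6)[of "e' k"] fD'(1) that \<open>\<phi> ` B \<subseteq> B\<close> by blast
    then have "\<phi> (e' k) - \<phi> (\<Sum>i<n. c i (e' k) \<cdot> e i) \<in> B"
      by (simp add: diff)
    then have "c' k (\<phi> (e' k)) = c' k (\<phi> (\<Sum>i<n. c i (e' k) \<cdot> e i))"
      using eZ \<open>\<phi> ` Z \<subseteq> Z\<close> by (intro quotient_frame_cong[OF fr' Z BZ that]) auto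
    also have "\<phi> (\<Sum>i<n. c i (e' k) \<cdot> e i) = (\<Sum>i<n. c i (e' k) \<cdot> \<phi> (e i))"
      by (simp add: sum scale)
    also have "c' k \<dots> = (\<Sum>i<n. c i (e' k) * c' k (\<phi> (e i)))"
      using fD(1) \<open>\<phi> ` Z \<subseteq> Z\<close> by (intro quotient_frame_sum[OF fr' Z that]) auto
    finally show ?thesis .
  qed
  then have "(\<Sum>k<m. c' k (\<phi> (e' k))) = (\<Sum>k<m. \<Sum>i<n. c i (e' k) * c' k (\<phi> (e i)))"
    by simp
  also have "\<dots> = (\<Sum>i<n. \<Sum>k<m. c' k (\<phi> (e i)) * c i (e' k))"
    by (subst sum.swap) (simp add: mult.commute)
  also have "\<dots> = (\<Sum>i<n. c i (\<phi> (e i)))"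
  proof (intro sum.cong refl)
    fix i assume "i \<in> {..<n}"
    then have "\<phi> (e i) \<in> Z" "i < n"
      using fD(1)[of i] \<open>\<phi> ` Z \<subseteq> Z\<close> by auto
    then show "(\<Sum>k<m. c' k (\<phi> (e i)) * c i (e' k)) = c i (\<phi> (e i))"
      using quotient_frame_expand[OF fr fr' Z BZ, of i "\<phi> (e i)"] by simp
  qed
  finally show ?thesis ..
qed

lemma quotient_trace_eq:
  assumes fr: "quotient_frame Z B n e c" and "subspace Z" "B \<subseteq> Z"
    and "Vector_Spaces.linear scale scale \<phi>" and "\<phi> ` Z \<subseteq> Z" "\<phi> ` B \<subseteq> B"
  shows "quotient_trace Z B \<phi> = (\<Sum>i<n. c i (\<phi> (e i)))"
  unfolding quotient_trace_def
proof (rule the_equality)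
  show "\<exists>n' e' c'. quotient_frame Z B n' e' c' \<and> (\<Sum>i<n. c i (\<phi> (e i))) = (\<Sum>i<n'. c' i (\<phi> (e' i)))"
    using fr by blast
qed (use quotient_frame_trace_unique[OF _ fr assms(2-)] in blast)

text \<open>A linear combination is finite, so it involves finitely many elements of a possibly
  infinite \<open>C\<close>; this reduces the exchange argument to finite sets.\<close>

lemma span_finite_support:
  assumes "v \<in> span (S \<union> C)"
  obtains C0 where "finite C0" "C0 \<subseteq> C" "v \<in> span (S \<union> C0)"
proof -
  obtain t r where t: "finite t" "t \<subseteq> S \<union> C" "v = (\<Sum>a\<in>t. r a \<cdot> a)"
    using assms by (auto simp: span_explicit)
  have "v \<in> span (S \<union> (t \<inter> C))"
    unfolding t(3) using t(2) by (intro span_sum span_scale span_base) auto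
  then show ?thesis
    using t(1) by (intro that[of "t \<inter> C"]) auto
qed

text \<open>Exchange: modulo \<open>C\<close>, an independent family is no larger than a spanning one.\<close>

lemma finite_relative_basis:
  assumes D: "independent (D \<union> C)" "D \<inter> C = {}" and "finite S" "D \<subseteq> span (S \<union> C)"
  shows "finite D"
proof (rule ccontr)
  assume "infinite D"
  then obtain F where F: "F \<subseteq> D" "finite F" "card F = Suc (card S)"
    using infinite_arbitrarily_large[of D "Suc (card S)"] by auto
  have "\<exists>C0. finite C0 \<and> C0 \<subseteq> C \<and> v \<in> span (S \<union> C0)" if v: "v \<in> F" for v
  proof -
    have "v \<in> span (S \<union> C)" using v F(1) assms(4) by (meson subsetD)
    then show ?thesis by (rule span_finite_support) (intro exI conjI)
  qed
  then have "\<forall>v\<in>F. \<exists>C0. finite C0 \<and> C0 \<subseteq> C \<and> v \<in> span (S \<union> C0)" by (intro ballI)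
  from bchoice[OF this] obtain C0
    where C0: "\<And>v. v \<in> F \<Longrightarrow> finite (C0 v) \<and> C0 v \<subseteq> C \<and> v \<in> span (S \<union> C0 v)"
    by (elim exE) (use bspec in fast)
  \<comment> \<open>The expansions of the finitely many elements of \<open>F\<close> use finitely
    many elements of \<open>C\<close>. Putting the same finite \<open>G\<close> on both sides of the
    exchange inequality lets its cardinality cancel, leaving
    \<open>Suc (card S) \<le> card S\<close>.\<close>
  define G where "G = (\<Union>v\<in>F. C0 v)"
  have G: "finite G" "G \<subseteq> C"
    using C0 F(2) by (auto simp: G_def)
  have "F \<subseteq> span (S \<union> G)"
  proof
    fix v assume v: "v \<in> F"
    then have "span (S \<union> C0 v) \<subseteq> span (S \<union> G)"
      by (intro span_mono) (auto simp: G_def)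
    then show "v \<in> span (S \<union> G)" using C0 v by blast
  qed
  moreover have "G \<subseteq> span (S \<union> G)" by (auto intro: span_base)
  moreover have "independent (F \<union> G)"
    using independent_mono[OF D(1)] F(1) G(2) by blast
  ultimately have "card (F \<union> G) \<le> card (S \<union> G)"
    using independent_span_bound[of "S \<union> G" "F \<union> G"] \<open>finite S\<close> G(1) by auto
  also have "\<dots> \<le> card S + card G" by (rule card_Un_le)
  finally show False
    using F D(2) G card_Un_disjoint[of F G] by auto
qed

text \<open>A basis \<open>C\<close> of \<open>B\<close> extends to a basis \<open>D'\<close> of
  \<open>Z\<close>, and \<open>D' - C\<close> projects to a basis of \<open>Z / B\<close>. Its
  coordinate functions vanish on \<open>B\<close> because elements of \<open>B\<close> are already
  represented in \<open>C\<close>.\<close>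

lemma finite_quotient_frame:
  assumes B: "subspace B" and Z: "subspace Z" and "B \<subseteq> Z" and "finite_quotient Z B"
  obtains n e c where "quotient_frame Z B n e c"
proof -
  obtain S where S: "finite S" "Z \<subseteq> span (S \<union> B)"
    using assms by (auto simp: finite_quotient_def)
  obtain C where C: "C \<subseteq> B" "independent C" "B \<subseteq> span C"
    using maximal_independent_subset by blast
  have spC: "span C = B" using C(3) span_minimal[OF C(1) B] by (rule antisym[rotated])
  obtain D' where D': "C \<subseteq> D'" "D' \<subseteq> Z" "independent D'" "Z \<subseteq> span D'"
    using maximal_independent_subset_extend[OF order_trans[OF C(1) \<open>B \<subseteq> Z\<close>] C(2)] .
  define D where "D = D' - C"
  have un: "D \<union> C = D'" using D'(1) by (auto simp: D_def)
  have "S \<union> B \<subseteq> span (S \<union> C)"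
    using C(3) span_mono[OF Un_upper2[of C S]] span_superset[of "S \<union> C"] by (meson Un_least Un_upper1 order_trans)
  then have "Z \<subseteq> span (S \<union> C)"
    using S(2) span_minimal[OF _ subspace_span] by (meson order_trans)
  then have "D \<subseteq> span (S \<union> C)" using D'(2) unfolding D_def by (meson Diff_subset order_trans)
  then have fin: "finite D"
    using finite_relative_basis[of D C S] D'(3) S(1) un by (auto simp: D_def)
  obtain e where e: "bij_betw e {..<card D} D"
    using ex_bij_betw_nat_finite[OF fin] by (auto simp: atLeast0LessThan)
  define c where "c = (\<lambda>i v. representation D' v (e i))"
  have eD: "e i \<in> D" if "i < card D" for i
    using e that by (auto simp: bij_betw_def)
  then have eD': "e i \<in> D'" "e i \<notin> C" "e i \<in> Z" if "i < card D" for i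
    using that D'(2) by (auto simp: D_def)
  have "quotient_frame Z B (card D) e c"
    unfolding quotient_frame_def
  proof (intro conjI allI impI ballI)
    fix i v assume "i < card D" "v \<in> B"
    then show "c i v = 0"
      using representation_extend[OF D'(3) _ D'(1), of v] representation_ne_zero[of C v "e i"] eD'(2)[of i]
      unfolding c_def spC by metis
  next
    fix i j assume ij: "i < card D" "j < card D"
    then show "c i (e j) = (if i = j then 1 else 0)"
      using bij_betw_imp_inj_on[OF e] representation_basis[OF D'(3) eD'(1)[OF ij(2)]]
      unfolding c_def by (simp add: inj_on_eq_iff)
  next
    fix v assume "v \<in> Z"
    then have v: "v \<in> span D'" using D'(4) by (rule subsetD[rotated])
    let ?r = "representation D' v"
    have finr: "finite {b. ?r b \<noteq> 0}" by (rule finite_representation)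
    have "v = (\<Sum>b | ?r b \<noteq> 0. ?r b \<cdot> b)"
      using sum_nonzero_representation_eq[OF D'(3) v] ..
    also have "\<dots> = (\<Sum>b\<in>D \<union> ({b. ?r b \<noteq> 0} \<inter> C). ?r b \<cdot> b)"
    proof (rule sum.mono_neutral_left)
      show "{b. ?r b \<noteq> 0} \<subseteq> D \<union> ({b. ?r b \<noteq> 0} \<inter> C)"
        using representation_ne_zero[of D' v] un by blast
    qed (use fin finr in simp_all)
    also have "\<dots> = (\<Sum>b\<in>D. ?r b \<cdot> b) + (\<Sum>b\<in>{b. ?r b \<noteq> 0} \<inter> C. ?r b \<cdot> b)"
    proof (rule sum.union_disjoint)
      show "D \<inter> ({b. ?r b \<noteq> 0} \<inter> C) = {}" unfolding D_def by blast
    qed (use fin finr in simp_all)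
    also have "(\<Sum>b\<in>D. ?r b \<cdot> b) = (\<Sum>i<card D. c i v \<cdot> e i)"
      unfolding c_def by (rule sum.reindex_bij_betw[OF e, symmetric])
    finally have eq: "v = (\<Sum>i<card D. c i v \<cdot> e i) + (\<Sum>b\<in>{b. ?r b \<noteq> 0} \<inter> C. ?r b \<cdot> b)" .
    have "v - (\<Sum>i<card D. c i v \<cdot> e i) = (\<Sum>b\<in>{b. ?r b \<noteq> 0} \<inter> C. ?r b \<cdot> b)"
      by (rule diff_eq_eq[THEN iffD2, OF trans[OF eq add.commute]])
    also have "\<dots> \<in> B"
      by (rule subspace_sum[OF B], rule subspace_scale[OF B]) (use C(1) in blast)
    finally show "v - (\<Sum>i<card D. c i v \<cdot> e i) \<in> B" .
  next
    fix i u v assume "u \<in> Z" "v \<in> Z"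
    then show "c i (u + v) = c i u + c i v"
      unfolding c_def by (simp add: representation_add[OF D'(3)] subsetD[OF D'(4)])
  next
    fix i q v assume "v \<in> Z"
    then show "c i (q \<cdot> v) = q * c i v"
      unfolding c_def by (simp add: representation_scale[OF D'(3)] subsetD[OF D'(4)])
  qed (simp add: eD'(3))
  then show ?thesis by (rule that)
qed

lemma finite_quotient_trivial: "Z \<subseteq> B \<Longrightarrow> finite_quotient Z B"
  unfolding finite_quotient_def by (intro exI[of _ "{}"]) (auto intro: span_base)

lemma finite_quotient_mono:
  assumes "finite_quotient Z B" "Y \<subseteq> Z" "B \<subseteq> C"
  shows "finite_quotient Y C"
proof -
  obtain S where "finite S" "Z \<subseteq> span (S \<union> B)" using assms by (auto simp: finite_quotient_def)
  then show ?thesis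
    unfolding finite_quotient_def using assms span_mono[of "S \<union> B" "S \<union> C"]
    by (intro exI[of _ S]) auto
qed

lemma finite_quotient_trans:
  assumes "finite_quotient Z Y" "finite_quotient Y B"
  shows "finite_quotient Z B"
proof -
  obtain S T where S: "finite S" "Z \<subseteq> span (S \<union> Y)" and T: "finite T" "Y \<subseteq> span (T \<union> B)"
    using assms by (auto simp: finite_quotient_def)
  have "S \<union> Y \<subseteq> span (S \<union> T \<union> B)"
    using T(2) span_mono[of "T \<union> B" "S \<union> T \<union> B"] by (auto intro: span_base)
  then have "Z \<subseteq> span (S \<union> T \<union> B)"
    using S(2) span_minimal[OF _ subspace_span] by blast
  then show ?thesis
    unfolding finite_quotient_def using S(1) T(1) by (intro exI[of _ "S \<union> T"]) auto
qed

lemma quotient_trace_trivial: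
  assumes "Z = B" "subspace Z" "Vector_Spaces.linear scale scale \<phi>" "\<phi> ` Z \<subseteq> Z"
  shows "quotient_trace Z B \<phi> = 0"
  \<comment> \<open>The empty frame: with length 0 its vectors and functionals are never
    evaluated.\<close>
  using quotient_trace_eq[of Z B 0 undefined undefined \<phi>] assms
  by (auto simp: quotient_frame_def)

text \<open>Lifted bases of \<open>Z / Y\<close> and \<open>Y / B\<close> together give one of
  \<open>Z / B\<close>. The functionals \<open>c'\<close> behave well on \<open>Y\<close> only, so
  they are applied to what remains after subtracting the \<open>Z / Y\<close> part, which lies in
  \<open>Y\<close>.\<close>

lemma quotient_frame_append:
  assumes Z: "subspace Z" and Y: "subspace Y" and "Y \<subseteq> Z" "B \<subseteq> Y"
    and fr: "quotient_frame Z Y n e c" and fr': "quotient_frame Y B m e' c'"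
  defines "d \<equiv> \<lambda>i v. if i < n then c i v else c' (i - n) (v - (\<Sum>k<n. c k v \<cdot> e k))"
  shows "quotient_frame Z B (n + m) (\<lambda>i. if i < n then e i else e' (i - n)) d"
proof -
  note fD = quotient_frameD[OF fr] and fD' = quotient_frameD[OF fr']
  let ?r = "\<lambda>v. v - (\<Sum>k<n. c k v \<cdot> e k)"
  have rY: "?r v = v" if "v \<in> Y" for v
    using fD(4) that by simp
  show ?thesis
    unfolding quotient_frame_def
  proof (intro conjI allI impI ballI)
    fix i assume "i < n + m"
    then show "(if i < n then e i else e' (i - n)) \<in> Z"
      using fD(1) fD'(1)[of "i - n"] \<open>Y \<subseteq> Z\<close> by auto
  next
    fix i u v assume i: "i < n + m" and uv: "u \<in> Z" "v \<in> Z"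
    have eq: "?r (u + v) = ?r u + ?r v"
      using fD(2) uv by (simp add: scale_left_distrib sum.distrib)
    show "d i (u + v) = d i u + d i v"
    proof (cases "i < n")
      case False
      then have "c' (i - n) (?r u + ?r v) = c' (i - n) (?r u) + c' (i - n) (?r v)"
        using fD(6) uv i by (intro fD'(2)) auto
      then show ?thesis
        unfolding d_def eq using False by simp
    qed (use fD(2) uv in \<open>simp add: d_def\<close>)
  next
    fix i q v assume i: "i < n + m" and v: "v \<in> Z"
    have eq: "?r (q \<cdot> v) = q \<cdot> ?r v"
      using fD(3) v by (simp add: scale_right_diff_distrib scale_sum_right)
    show "d i (q \<cdot> v) = q * d i v"
    proof (cases "i < n")
      case False
      then have "c' (i - n) (q \<cdot> ?r v) = q * c' (i - n) (?r v)"
        using fD(6) v i by (intro fD'(3)) auto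
      then show ?thesis
        unfolding d_def eq using False by simp
    qed (use fD(3) v in \<open>simp add: d_def\<close>)
  next
    fix i v assume i: "i < n + m" and v: "v \<in> B"
    then have "v \<in> Y" using \<open>B \<subseteq> Y\<close> by blast
    then show "d i v = 0"
      using fD(4) fD'(4)[of "i - n" v] i v by (simp add: d_def)
  next
    fix i j assume i: "i < n + m" and j: "j < n + m"
    have c'0: "c' k 0 = 0" if "k < m" for k
      using fD'(3)[OF that subspace_0[OF Y], of 0] by simp
    show "d i (if j < n then e j else e' (j - n)) = (if i = j then 1 else 0)"
    proof (cases "j < n")
      case True
      have "(\<Sum>k<n. c k (e j) \<cdot> e k) = (\<Sum>k<n. if k = j then e j else 0)"
        using True fD(5) by (intro sum.cong) auto
      then have "?r (e j) = 0" using True by simp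
      then show ?thesis
        using True fD(5)[OF _ True] i c'0[of "i - n"] unfolding d_def by simp
    next
      case False
      then have "e' (j - n) \<in> Y" using fD'(1)[of "j - n"] j by auto
      then show ?thesis using False fD(4) fD'(5)[of "i - n" "j - n"] i j by (auto simp: d_def)
    qed
  next
    fix v assume v: "v \<in> Z"
    show "v - (\<Sum>i<n + m. d i v \<cdot> (if i < n then e i else e' (i - n))) \<in> B"
      using fD'(6)[OF fD(6)[OF v]] by (simp add: sum_lessThan_add d_def diff_diff_eq)
  qed
qed

text \<open>In the appended frame the matrix of \<open>\<phi>\<close> is block triangular:
  \<open>\<phi> (e' j)\<close> stays in \<open>Y\<close>, where every \<open>c k\<close> vanishes,
  so the correction term of the second block disappears.\<close>

lemma quotient_trace_add:
  assumes Z: "subspace Z" and Y: "subspace Y" and B: "subspace B" and YZ: "Y \<subseteq> Z" and BY: "B \<subseteq> Y"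
    and lin: "Vector_Spaces.linear scale scale \<phi>" and inv: "\<phi> ` Z \<subseteq> Z" "\<phi> ` Y \<subseteq> Y" "\<phi> ` B \<subseteq> B"
    and fin: "finite_quotient Z B"
  shows "quotient_trace Z B \<phi> = quotient_trace Z Y \<phi> + quotient_trace Y B \<phi>"
proof -
  obtain n e c where fr: "quotient_frame Z Y n e c"
    using finite_quotient_frame[OF Y Z YZ] finite_quotient_mono[OF fin _ BY] by blast
  obtain m e' c' where fr': "quotient_frame Y B m e' c'"
    using finite_quotient_frame[OF B Y BY] finite_quotient_mono[OF fin YZ] by blast
  have YY: "\<phi> (e' j) \<in> Y" if "j < m" for j
    using quotient_frameD(1)[OF fr' that] inv(2) by blast
  have "quotient_trace Z B \<phi> =
     (\<Sum>i<n. c i (\<phi> (e i))) + (\<Sum>j<m. c' j (\<phi> (e' j) - (\<Sum>k<n. c k (\<phi> (e' j)) \<cdot> e k)))"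
    using quotient_trace_eq[OF quotient_frame_append[OF Z Y YZ BY fr fr'] Z _ lin] inv YZ BY
    by (simp add: sum_lessThan_add)
  also have "(\<Sum>j<m. c' j (\<phi> (e' j) - (\<Sum>k<n. c k (\<phi> (e' j)) \<cdot> e k))) = (\<Sum>j<m. c' j (\<phi> (e' j)))"
    using quotient_frameD(4)[OF fr] YY by (intro sum.cong) auto
  finally show ?thesis
    using quotient_trace_eq[OF fr Z YZ lin] quotient_trace_eq[OF fr' Y BY lin] inv by simp
qed

end

section \<open>Isomorphisms between subquotients of two spaces\<close>

definition quotient_iso :: "('b::ab_group_add \<Rightarrow> 'c::ab_group_add) \<Rightarrow> 'b set \<Rightarrow> 'b set \<Rightarrow> 'c set \<Rightarrow> 'c set \<Rightarrow> bool" where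
  "quotient_iso g Z B Z' B' \<longleftrightarrow> g ` Z \<subseteq> Z' \<and> g ` B \<subseteq> B' \<and>
     (\<forall>z\<in>Z. g z \<in> B' \<longrightarrow> z \<in> B) \<and> (\<forall>w\<in>Z'. \<exists>z\<in>Z. w - g z \<in> B')"

locale vector_quotient_pair = vs1: vector_quotient s1 + vs2: vector_quotient s2
  for s1 :: "'a::field \<Rightarrow> 'b::ab_group_add \<Rightarrow> 'b" and s2 :: "'a \<Rightarrow> 'c::ab_group_add \<Rightarrow> 'c"
begin

text \<open>The new functionals evaluate the old ones on a chosen preimage \<open>t w\<close> modulo
  \<open>B'\<close>. The choice need not be linear, but two preimages of the same class differ by an
  element of \<open>B\<close>, which the functionals ignore. The second conclusion records this
  independence, so that later any convenient preimage may be used.\<close>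

lemma quotient_frame_iso:
  assumes lin: "Vector_Spaces.linear s1 s2 g" and iso: "quotient_iso g Z B Z' B'"
    and Z: "vs1.subspace Z" and B: "B \<subseteq> Z" and B': "vs2.subspace B'"
    and fr: "vs1.quotient_frame Z B n e c"
  obtains c' where "vs2.quotient_frame Z' B' n (g \<circ> e) c'"
    "\<And>i z w. i < n \<Longrightarrow> z \<in> Z \<Longrightarrow> w - g z \<in> B' \<Longrightarrow> c' i w = c i z"
proof -
  interpret g: Vector_Spaces.linear s1 s2 g by fact
  note fD = vs1.quotient_frameD[OF fr]
  define t where "t = (\<lambda>w. SOME z. z \<in> Z \<and> w - g z \<in> B')"
  have t: "t w \<in> Z" "w - g (t w) \<in> B'" if "\<exists>z\<in>Z. w - g z \<in> B'" for w
    using someI_ex[of "\<lambda>z. z \<in> Z \<and> w - g z \<in> B'"] that unfolding t_def by blast+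
  define c' where "c' = (\<lambda>i w. c i (t w))"
  have c': "c' i w = c i z" if "i < n" "z \<in> Z" "w - g z \<in> B'" for i z w
  proof -
    have tw: "t w \<in> Z" "w - g (t w) \<in> B'" using t that by blast+
    have "g (t w - z) = (w - g z) - (w - g (t w))" by (simp add: g.diff)
    also have "\<dots> \<in> B'" by (rule vs2.subspace_diff[OF B' that(3) tw(2)])
    finally have "t w - z \<in> B"
      using iso tw(1) that(2) vs1.subspace_diff[OF Z] by (auto simp: quotient_iso_def)
    then show ?thesis
      unfolding c'_def using vs1.quotient_frame_cong[OF fr Z B that(1,2)] by blast
  qed
  have surj: "\<exists>z\<in>Z. w - g z \<in> B'" if "w \<in> Z'" for w
    using that iso by (auto simp: quotient_iso_def)
  have gZ: "g z \<in> Z'" if "z \<in> Z" for z using that iso by (auto simp: quotient_iso_def)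
  have gB: "g z \<in> B'" if "z \<in> B" for z using that iso by (auto simp: quotient_iso_def)
  have B'0: "0 \<in> B'" by (rule vs2.subspace_0[OF B'])
  have "vs2.quotient_frame Z' B' n (g \<circ> e) c'"
    unfolding vs2.quotient_frame_def
  proof (intro conjI allI impI ballI)
    fix i u v assume i: "i < n" and uv: "u \<in> Z'" "v \<in> Z'"
    obtain x y where xy: "x \<in> Z" "u - g x \<in> B'" "y \<in> Z" "v - g y \<in> B'"
      using surj uv by blast
    have "(u + v) - g (x + y) = (u - g x) + (v - g y)" by (simp add: g.add)
    also have "\<dots> \<in> B'" using xy by (intro vs2.subspace_add[OF B'])
    finally have "c' i (u + v) = c i (x + y)"
      using c'[OF i] vs1.subspace_add[OF Z] xy by blast
    then show "c' i (u + v) = c' i u + c' i v"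
      using c'[OF i] xy fD(2)[OF i] by simp
  next
    fix i q v assume i: "i < n" and v: "v \<in> Z'"
    obtain y where y: "y \<in> Z" "v - g y \<in> B'" using surj v by blast
    have "s2 q v - g (s1 q y) = s2 q (v - g y)" by (simp add: g.scale vs2.scale_right_diff_distrib)
    also have "\<dots> \<in> B'" using y by (intro vs2.subspace_scale[OF B'])
    finally have "c' i (s2 q v) = c i (s1 q y)"
      using c'[OF i] vs1.subspace_scale[OF Z] y by blast
    then show "c' i (s2 q v) = q * c' i v"
      using c'[OF i] y fD(3)[OF i] by simp
  next
    fix i v assume i: "i < n" and v: "v \<in> B'"
    have "c' i v = c i 0" using v by (intro c'[OF i vs1.subspace_0[OF Z]]) simp
    then show "c' i v = 0" using fD(3)[OF i vs1.subspace_0[OF Z], of 0] by simp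
  next
    fix i j assume ij: "i < n" "j < n"
    have "c' i (g (e j)) = c i (e j)" using B'0 fD(1) ij by (intro c') auto
    then show "c' i ((g \<circ> e) j) = (if i = j then 1 else 0)" using fD(5) ij by simp
  next
    fix w assume "w \<in> Z'"
    then obtain z where z: "z \<in> Z" "w - g z \<in> B'" using surj by blast
    have "w - (\<Sum>i<n. s2 (c' i w) ((g \<circ> e) i)) = (w - g z) + g (z - (\<Sum>i<n. s1 (c i z) (e i)))"
      using c' z by (simp add: g.diff g.sum g.scale)
    also have "\<dots> \<in> B'"
      using z gB[OF fD(6)[OF z(1)]] by (intro vs2.subspace_add[OF B'])
    finally show "w - (\<Sum>i<n. s2 (c' i w) ((g \<circ> e) i)) \<in> B'" .
  qed (use fD(1) gZ in auto)
  then show ?thesis using that c' by blast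
qed

lemma quotient_trace_iso:
  assumes lin: "Vector_Spaces.linear s1 s2 g" and iso: "quotient_iso g Z B Z' B'"
    and Z: "vs1.subspace Z" and B: "vs1.subspace B" "B \<subseteq> Z"
    and Z': "vs2.subspace Z'" and B': "vs2.subspace B'" "B' \<subseteq> Z'"
    and phi: "Vector_Spaces.linear s1 s1 \<phi>" "\<phi> ` Z \<subseteq> Z" "\<phi> ` B \<subseteq> B"
    and phi': "Vector_Spaces.linear s2 s2 \<phi>'" "\<phi>' ` Z' \<subseteq> Z'" "\<phi>' ` B' \<subseteq> B'"
    and comm: "\<And>z. z \<in> Z \<Longrightarrow> \<phi>' (g z) = g (\<phi> z)"
    and fin: "vs1.finite_quotient Z B"
  shows "vs1.quotient_trace Z B \<phi> = vs2.quotient_trace Z' B' \<phi>'"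
proof -
  obtain n e c where fr: "vs1.quotient_frame Z B n e c"
    using vs1.finite_quotient_frame[OF B(1) Z B(2) fin] by blast
  obtain c' where fr': "vs2.quotient_frame Z' B' n (g \<circ> e) c'"
    and c': "\<And>i z w. i < n \<Longrightarrow> z \<in> Z \<Longrightarrow> w - g z \<in> B' \<Longrightarrow> c' i w = c i z"
    using quotient_frame_iso[OF lin iso Z B(2) B'(1) fr] by blast
  have "c' i (\<phi>' ((g \<circ> e) i)) = c i (\<phi> (e i))" if "i < n" for i
    using that vs1.quotient_frameD(1)[OF fr that] phi(2) vs2.subspace_0[OF B'(1)]
    by (intro c') (auto simp: comm)
  then show ?thesis
    using vs1.quotient_trace_eq[OF fr Z B(2) phi] vs2.quotient_trace_eq[OF fr' Z' B'(2) phi'] by simp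
qed

lemma finite_quotient_iso:
  assumes lin: "Vector_Spaces.linear s1 s2 g" and iso: "quotient_iso g Z B Z' B'"
    and Z: "vs1.subspace Z" and B: "vs1.subspace B"
    and Z': "vs2.subspace Z'" and B': "vs2.subspace B'" "B' \<subseteq> Z'"
  shows "vs1.finite_quotient Z B \<longleftrightarrow> vs2.finite_quotient Z' B'"
proof
  interpret g: Vector_Spaces.linear s1 s2 g by fact
  assume "vs1.finite_quotient Z B"
  then obtain S where S: "finite S" "Z \<subseteq> vs1.span (S \<union> B)" by (auto simp: vs1.finite_quotient_def)
  have "Z' \<subseteq> vs2.span (g ` S \<union> B')"
  proof
    fix w assume "w \<in> Z'"
    then obtain z where z: "z \<in> Z" "w - g z \<in> B'" using iso by (auto simp: quotient_iso_def)
    have "g z \<in> vs2.span (g ` (S \<union> B))" using z S(2) g.span_image by blast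
    also have "\<dots> \<subseteq> vs2.span (g ` S \<union> B')"
      using iso by (intro vs2.span_mono) (auto simp: quotient_iso_def)
    finally have "g z + (w - g z) \<in> vs2.span (g ` S \<union> B')"
      using z(2) by (intro vs2.span_add) (auto intro: vs2.span_base)
    then show "w \<in> vs2.span (g ` S \<union> B')" by simp
  qed
  then show "vs2.finite_quotient Z' B'"
    unfolding vs2.finite_quotient_def using S(1) by blast
next
  interpret g: Vector_Spaces.linear s1 s2 g by fact
  assume "vs2.finite_quotient Z' B'"
  \<comment> \<open>A frame is taken instead of the spanning set itself because its vectors lie in
    \<open>Z'\<close> and therefore have preimages in \<open>Z\<close>.\<close>
  then obtain n e c where fr: "vs2.quotient_frame Z' B' n e c"
    using vs2.finite_quotient_frame[OF B'(1) Z' B'(2)] by blast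
  note fD = vs2.quotient_frameD[OF fr]
  have "\<exists>z\<in>Z. e i - g z \<in> B'" if "i < n" for i
    using fD(1)[OF that] iso by (auto simp: quotient_iso_def)
  then obtain x where x: "\<And>i. i < n \<Longrightarrow> x i \<in> Z" "\<And>i. i < n \<Longrightarrow> e i - g (x i) \<in> B'"
    by metis
  have "Z \<subseteq> vs1.span (x ` {..<n} \<union> B)"
  proof
    fix z assume z: "z \<in> Z"
    let ?y = "\<Sum>i<n. s1 (c i (g z)) (x i)"
    have gz: "g z \<in> Z'" using z iso by (auto simp: quotient_iso_def)
    have yZ: "?y \<in> Z" using x(1) by (intro vs1.subspace_sum[OF Z] vs1.subspace_scale[OF Z]) auto
    have "g (z - ?y) = (g z - (\<Sum>i<n. s2 (c i (g z)) (e i))) + (\<Sum>i<n. s2 (c i (g z)) (e i - g (x i)))"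
      by (simp add: g.diff g.sum g.scale vs2.scale_right_diff_distrib sum_subtractf)
    also have "\<dots> \<in> B'"
      using fD(6)[OF gz] x(2)
      by (intro vs2.subspace_add[OF B'(1)] vs2.subspace_sum[OF B'(1)] vs2.subspace_scale[OF B'(1)]) auto
    finally have "z - ?y \<in> B"
      using iso vs1.subspace_diff[OF Z z yZ] by (auto simp: quotient_iso_def)
    moreover have "?y \<in> vs1.span (x ` {..<n} \<union> B)"
      by (intro vs1.span_sum vs1.span_scale vs1.span_base) auto
    ultimately have "(z - ?y) + ?y \<in> vs1.span (x ` {..<n} \<union> B)"
      by (intro vs1.span_add) (auto intro: vs1.span_base)
    then show "z \<in> vs1.span (x ` {..<n} \<union> B)" by simp
  qed
  then show "vs1.finite_quotient Z B"
    unfolding vs1.finite_quotient_def by (intro exI[of _ "x ` {..<n}"]) auto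
qed

end

section \<open>Relative rational homology\<close>

global_interpretation rchain: vector_quotient "rchain_scale :: rat \<Rightarrow> 'a rchain \<Rightarrow> 'a rchain"
  by unfold_locales (auto simp: rchain_scale_simps)

global_interpretation rchain_pair:
  vector_quotient_pair "rchain_scale :: rat \<Rightarrow> 'a rchain \<Rightarrow> 'a rchain"
    "rchain_scale :: rat \<Rightarrow> 'b rchain \<Rightarrow> 'b rchain"
  by unfold_locales

abbreviation rchain_linear :: "('a rchain \<Rightarrow> 'b rchain) \<Rightarrow> bool" where
  "rchain_linear \<equiv> Vector_Spaces.linear rchain_scale rchain_scale"

lemma rchain_linearI:
  assumes "\<And>x y. g (x + y) = g x + g y" "\<And>q x. g (rchain_scale q x) = rchain_scale q (g x)"
  shows "rchain_linear g"
  by (simp add: Vector_Spaces.linear_iff assms rchain.vector_space_axioms)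

lemma rchain_linear_boundary: "rchain_linear (rchain_boundary p)"
  by (simp add: rchain_linearI rchain_boundary_add rchain_boundary_scale)

lemma rchain_scale_single [simp]:
  "rchain_scale q (Poly_Mapping.single x r) = Poly_Mapping.single x (q * r)"
  by (auto intro!: poly_mapping_eqI simp: lookup_single when_def)

lemma rchain_map_superset:
  assumes "finite S" "Poly_Mapping.keys c \<subseteq> S"
  shows "rchain_map p f c = (\<Sum>\<sigma>\<in>S. Poly_Mapping.single (simplex_map p f \<sigma>) (Poly_Mapping.lookup c \<sigma>))"
  unfolding rchain_map_def
  using sum_keys_superset[OF assms, of "\<lambda>\<sigma>. Poly_Mapping.single (simplex_map p f \<sigma>)"] by simp

lemma rchain_linear_map: "rchain_linear (rchain_map p f)"
proof (rule rchain_linearI)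
  fix c d :: "'a rchain" and q
  show "rchain_map p f (c + d) = rchain_map p f c + rchain_map p f d"
    using rchain_map_superset[of "Poly_Mapping.keys c \<union> Poly_Mapping.keys d" _ p f]
    by (simp add: keys_add lookup_add single_add sum.distrib)
  have "Poly_Mapping.keys (rchain_scale q c) \<subseteq> Poly_Mapping.keys c"
    by (auto simp: in_keys_iff)
  then show "rchain_map p f (rchain_scale q c) = rchain_scale q (rchain_map p f c)"
    using rchain_map_superset[of "Poly_Mapping.keys c" _ p f]
    by (simp add: rchain.scale_sum_right)
qed

lemma rchain_map_diff: "rchain_map p f (c - d) = rchain_map p f c - rchain_map p f d"
  by (rule module_hom.diff[OF rchain_linear_map[unfolded linear_iff_module_hom]])

lemma rchain_map_0 [simp]: "rchain_map p f 0 = 0"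
  by (simp add: rchain_map_def)

lemma rchain_map_add: "rchain_map p f (c + d) = rchain_map p f c + rchain_map p f d"
  by (rule module_hom.add[OF rchain_linear_map[unfolded linear_iff_module_hom]])

lemma rchain_map_scale: "rchain_map p f (rchain_scale q c) = rchain_scale q (rchain_map p f c)"
  by (rule module_hom.scale[OF rchain_linear_map[unfolded linear_iff_module_hom]])

lemma rchain_boundary_diff: "rchain_boundary p (c - d) = rchain_boundary p c - rchain_boundary p d"
  by (rule module_hom.diff[OF rchain_linear_boundary[unfolded linear_iff_module_hom]])

section \<open>Integral chains as a lattice in the rational chains\<close>

definition rat_chain :: "'a chain \<Rightarrow> 'a rchain" where
  "rat_chain c = Poly_Mapping.map of_int c"

lemma lookup_rat_chain [simp]: "Poly_Mapping.lookup (rat_chain c) \<sigma> = of_int (Poly_Mapping.lookup c \<sigma>)"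
  by (simp add: rat_chain_def Poly_Mapping.map.rep_eq when_def)

lemma keys_rat_chain [simp]: "Poly_Mapping.keys (rat_chain c) = Poly_Mapping.keys c"
  by (auto simp: in_keys_iff)

lemma rat_chain_simps:
  "rat_chain 0 = 0"
  "rat_chain (c + d) = rat_chain c + rat_chain d"
  "rat_chain (c - d) = rat_chain c - rat_chain d"
  "rat_chain (frag_cmul k c) = rchain_scale (of_int k) (rat_chain c)"
  "rat_chain (frag_of \<sigma>) = Poly_Mapping.single \<sigma> 1"
  by (auto intro!: poly_mapping_eqI simp: lookup_add lookup_minus lookup_single when_def)

lemma rat_chain_sum: "rat_chain (sum g S) = (\<Sum>x\<in>S. rat_chain (g x))"
  by (induction S rule: infinite_finite_induct) (simp_all add: rat_chain_simps)

lemma rat_chain_eq_iff [simp]: "rat_chain c = rat_chain d \<longleftrightarrow> c = d"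
  by (metis lookup_rat_chain of_int_eq_iff poly_mapping_eqI)

lemma rat_chain_rchains [simp]: "rat_chain c \<in> rchains p X \<longleftrightarrow> singular_chain p X c"
  by (simp add: rchains_def singular_chain_def)

lemma rat_chain_boundary: "rat_chain (chain_boundary p c) = rchain_boundary p (rat_chain c)"
proof (cases "p = 0")
  case False
  have "rat_chain (frag_cmul ((- 1) ^ k) (frag_of \<tau>)) = Poly_Mapping.single \<tau> ((- 1) ^ k)"
    for k and \<tau> :: "(nat \<Rightarrow> real) \<Rightarrow> 'a"
    by (simp add: rat_chain_simps)
  then show ?thesis
    using False by (simp add: chain_boundary_def rchain_boundary_def frag_extend_def rat_chain_sum
        rat_chain_simps(4) rchain.scale_sum_right mult.commute)
qed (simp add: chain_boundary_def rchain_boundary_def rat_chain_simps)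

lemma rat_chain_map: "rat_chain (chain_map p f c) = rchain_map p f (rat_chain c)"
  by (simp add: chain_map_def rchain_map_def frag_extend_def rat_chain_sum rat_chain_simps)

lemma common_denominator:
  fixes S :: "rat set"
  assumes "finite S"
  shows "\<exists>N>0. \<forall>q\<in>S. \<exists>k. of_int N * q = of_int k"
  using assms
proof (induction S rule: finite_induct)
  case empty
  show ?case by (intro exI[of _ 1]) auto
next
  case (insert q S)
  then obtain N where N: "N > 0" "\<forall>q\<in>S. \<exists>k. of_int N * q = of_int k" by blast
  obtain a b where ab: "q = of_int a / of_int b" "b > 0"
    by (metis quotient_of_div quotient_of_denom_pos surj_pair)
  have "\<exists>k. of_int (N * b) * r = of_int k" if r: "r \<in> insert q S" for r
  proof (cases "r = q")
    case True
    then show ?thesis using ab by (intro exI[of _ "N * a"]) simp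
  next
    case False
    then obtain k where "of_int N * r = of_int k" using N r by blast
    then have "of_int (N * b) * r = of_int (k * b)" by (simp add: mult.commute mult.left_commute)
    then show ?thesis by blast
  qed
  then show ?case using N(1) ab(2) by (intro exI[of _ "N * b"]) auto
qed

text \<open>A chain has finitely many coefficients, so one integer clears them all. Scaling by it is
  invertible over the rationals; hence linear identities and membership in subspaces can be checked
  on integral chains.\<close>

lemma clear_denominators:
  obtains N c where "N > 0" "rchain_scale (of_int N) r = rat_chain c"
proof -
  obtain N where N: "N > 0" "\<forall>q\<in>Poly_Mapping.lookup r ` Poly_Mapping.keys r. \<exists>k. of_int N * q = of_int k"
    using common_denominator[of "Poly_Mapping.lookup r ` Poly_Mapping.keys r"] by auto
  \<comment> \<open>The floor merely names the integer that the product already is.\<close>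
  have "rchain_scale (of_int N) r = rat_chain (Poly_Mapping.map (\<lambda>q. \<lfloor>of_int N * q\<rfloor>) r)"
  proof (rule poly_mapping_eqI)
    fix \<sigma>
    show "Poly_Mapping.lookup (rchain_scale (of_int N) r) \<sigma> =
      Poly_Mapping.lookup (rat_chain (Poly_Mapping.map (\<lambda>q. \<lfloor>of_int N * q\<rfloor>) r)) \<sigma>"
    proof (cases "\<sigma> \<in> Poly_Mapping.keys r")
      case True
      then obtain k where "of_int N * Poly_Mapping.lookup r \<sigma> = of_int k" using N(2) by auto
      then show ?thesis using True by (simp add: Poly_Mapping.map.rep_eq when_def in_keys_iff)
    qed (simp add: Poly_Mapping.map.rep_eq in_keys_iff)
  qed
  then show ?thesis using N(1) that by blast
qed

lemma subspace_rchains: "rchain.subspace (rchains p X)"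
  by (auto simp: rchain.subspace_def rchains_closed)

lemma subspace_scale_iff:
  assumes "rchain.subspace V" "N \<noteq> 0"
  shows "rchain_scale N r \<in> V \<longleftrightarrow> r \<in> V"
proof
  assume "rchain_scale N r \<in> V"
  then have "rchain_scale (1 / N) (rchain_scale N r) \<in> V"
    using assms(1) by (rule rchain.subspace_scale[rotated])
  then show "r \<in> V" using assms(2) by simp
qed (simp add: assms rchain.subspace_scale)

lemma rchains_clear_denominators:
  assumes "r \<in> rchains p X"
  obtains N c where "N > 0" "rchain_scale (of_int N) r = rat_chain c" "singular_chain p X c"
proof -
  obtain N c where N: "N > 0" "rchain_scale (of_int N) r = rat_chain c"
    by (rule clear_denominators)
  then have "singular_chain p X c"
    using assms by (metis rat_chain_rchains rchains_closed(3))
  with N show ?thesis using that by blast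
qed

lemma rchain_boundary_boundary:
  assumes "r \<in> rchains p X"
  shows "rchain_boundary (p - 1) (rchain_boundary p r) = 0"
proof -
  obtain N c where N: "N > 0" "rchain_scale (of_int N) r = rat_chain c" "singular_chain p X c"
    using rchains_clear_denominators[OF assms] .
  have "rchain_scale (of_int N) (rchain_boundary (p - 1) (rchain_boundary p r)) =
      rat_chain (chain_boundary (p - Suc 0) (chain_boundary p c))"
    by (simp add: rat_chain_boundary N(2)[symmetric] rchain_boundary_scale)
  then show ?thesis
    using N(1,3) by (simp add: chain_boundary_boundary rat_chain_simps)
qed

lemma rchains_boundary:
  assumes "r \<in> rchains p X"
  shows "rchain_boundary p r \<in> rchains (p - 1) X"
proof -
  obtain N c where N: "N > 0" "rchain_scale (of_int N) r = rat_chain c" "singular_chain p X c"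
    using rchains_clear_denominators[OF assms] .
  have "rchain_scale (of_int N) (rchain_boundary p r) = rat_chain (chain_boundary p c)"
    by (simp add: rat_chain_boundary N(2)[symmetric] rchain_boundary_scale)
  also have "\<dots> \<in> rchains (p - 1) X"
    using singular_chain_boundary[OF N(3)] by simp
  finally show ?thesis
    using N(1) by (subst (asm) subspace_scale_iff[OF subspace_rchains]) simp_all
qed

lemma rchain_map_boundary:
  assumes "r \<in> rchains p X"
  shows "rchain_boundary p (rchain_map p f r) = rchain_map (p - 1) f (rchain_boundary p r)"
proof -
  obtain N c where N: "N > 0" "rchain_scale (of_int N) r = rat_chain c" "singular_chain p X c"
    using rchains_clear_denominators[OF assms] .
  have "chain_boundary p (chain_map p f c) = chain_map (p - Suc 0) f (chain_boundary p c)"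
    using chain_boundary_chain_map[OF N(3)] .
  then have "rat_chain (chain_boundary p (chain_map p f c)) = rat_chain (chain_map (p - Suc 0) f (chain_boundary p c))"
    by simp
  then show ?thesis
    using N(1) by (simp add: rat_chain_boundary rat_chain_map N(2)[symmetric] rchain_boundary_scale rchain_map_scale)
qed

lemma rchains_map:
  assumes "r \<in> rchains p X" "continuous_map X Y f"
  shows "rchain_map p f r \<in> rchains p Y"
proof -
  obtain N c where N: "N > 0" "rchain_scale (of_int N) r = rat_chain c" "singular_chain p X c"
    using rchains_clear_denominators[OF assms(1)] .
  have "rchain_scale (of_int N) (rchain_map p f r) = rat_chain (chain_map p f c)"
    by (simp add: rat_chain_map N(2)[symmetric] rchain_map_scale)
  also have "\<dots> \<in> rchains p Y"
    using singular_chain_chain_map[OF N(3) assms(2)] by simp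
  finally show ?thesis
    using N(1) by (subst (asm) subspace_scale_iff[OF subspace_rchains]) simp_all
qed

section \<open>Cycles and boundaries of a pair\<close>

lemma rchains_mono: "rchains p (subtopology X S) \<subseteq> rchains p X"
  by (auto simp: rchains_def singular_simplex_subtopology)

lemma rchains_empty [simp]: "rchains p (trivial_topology :: 'a topology) = {0}"
proof -
  have "singular_simplex_set p (trivial_topology :: 'a topology) = {}"
    using singular_simplex_empty[of "trivial_topology :: 'a topology" p] by auto
  then show ?thesis unfolding rchains_def by (simp only: subset_empty keys_eq_empty) simp
qed

text \<open>In degree 0 the boundary is 0 and \<open>p - 1\<close> is read as 0, so every 0-chain
  qualifies, as it should.\<close>

definition rel_rcycles :: "nat \<Rightarrow> 'a topology \<Rightarrow> 'a set \<Rightarrow> 'a rchain set" where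
  "rel_rcycles p X S = {c \<in> rchains p X. rchain_boundary p c \<in> rchains (p - 1) (subtopology X S)}"

text \<open>The chains of \<open>S\<close> are counted among the boundaries instead of being divided
  out first, so relative homology is again a subquotient of the chains of \<open>X\<close>. Empty
  \<open>S\<close> gives absolute homology, since the empty space has no chain but 0.\<close>

definition rel_rboundaries :: "nat \<Rightarrow> 'a topology \<Rightarrow> 'a set \<Rightarrow> 'a rchain set" where
  "rel_rboundaries p X S = rboundaries p X + rchains p (subtopology X S)"

lemma rel_rcycles_empty: "rel_rcycles p X {} = rcycles p X"
  by (simp add: rel_rcycles_def rcycles_def)

lemma rel_rboundaries_empty: "rel_rboundaries p X {} = rboundaries p X"
  by (simp add: rel_rboundaries_def)

lemma rboundaries_subset_rcycles: "rboundaries p X \<subseteq> rcycles p X"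
  using rchain_boundary_boundary[of _ "Suc p" X] rchains_boundary[of _ "Suc p" X]
  by (auto simp: rboundaries_def rcycles_def)

lemma subspace_rcycles: "rchain.subspace (rcycles p X)"
  by (auto simp: rchain.subspace_def rcycles_closed)

lemma subspace_rboundaries: "rchain.subspace (rboundaries p X)"
  by (auto simp: rchain.subspace_def rboundaries_closed)

lemma set_plus_eq_pairs: "U + V = {x + y | x y. x \<in> U \<and> y \<in> V}"
  by (auto simp: set_plus_def)

lemma subspace_set_plus:
  "rchain.subspace U \<Longrightarrow> rchain.subspace V \<Longrightarrow> rchain.subspace (U + V)"
  unfolding set_plus_eq_pairs by (rule rchain.subspace_sums)

lemma subspace_rel_rboundaries: "rchain.subspace (rel_rboundaries p X S)"
  unfolding rel_rboundaries_def by (intro subspace_set_plus subspace_rboundaries subspace_rchains)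

lemma subspace_rel_rcycles: "rchain.subspace (rel_rcycles p X S)"
  by (auto simp: rchain.subspace_def rel_rcycles_def rchains_closed rchain_boundary_add rchain_boundary_scale)

lemma rel_rboundaries_subset_rel_rcycles: "rel_rboundaries p X S \<subseteq> rel_rcycles p X S"
proof
  fix x assume "x \<in> rel_rboundaries p X S"
  then obtain b a where x: "x = b + a" "b \<in> rboundaries p X" "a \<in> rchains p (subtopology X S)"
    by (auto simp: rel_rboundaries_def elim: set_plus_elim)
  have "b \<in> rcycles p X" using x(2) rboundaries_subset_rcycles by blast
  then show "x \<in> rel_rcycles p X S"
    using x(3) rchains_mono[of p X S] rchains_boundary[OF x(3)]
    by (auto simp: x(1) rel_rcycles_def rcycles_def rchain_boundary_add intro: rchains_closed)
qed

lemma rcycles_map: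
  "continuous_map X Y f \<Longrightarrow> rchain_map p f ` rcycles p X \<subseteq> rcycles p Y"
  by (auto simp: rcycles_def rchains_map rchain_map_boundary)

lemma rboundaries_map:
  assumes "continuous_map X Y f"
  shows "rchain_map p f ` rboundaries p X \<subseteq> rboundaries p Y"
proof clarify
  fix b assume "b \<in> rboundaries p X"
  then obtain d where "d \<in> rchains (Suc p) X" "b = rchain_boundary (Suc p) d"
    by (auto simp: rboundaries_def)
  then show "rchain_map p f b \<in> rboundaries p Y"
    using rchain_map_boundary[of d "Suc p" X f] rchains_map[OF _ assms]
    by (auto simp: rboundaries_def intro!: image_eqI[of _ _ "rchain_map (Suc p) f d"])
qed

lemma continuous_map_subtopologies:
  assumes "continuous_map X Y f" "f ` (topspace X \<inter> S) \<subseteq> T"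
  shows "continuous_map (subtopology X S) (subtopology Y T) f"
  using assms by (auto simp: continuous_map_in_subtopology continuous_map_from_subtopology)

lemma rel_rcycles_map:
  assumes "continuous_map X Y f" "f ` (topspace X \<inter> S) \<subseteq> T"
  shows "rchain_map p f ` rel_rcycles p X S \<subseteq> rel_rcycles p Y T"
  using assms(1) rchains_map[OF _ continuous_map_subtopologies[OF assms]]
  by (auto simp: rel_rcycles_def rchains_map rchain_map_boundary)

lemma rel_rboundaries_map:
  assumes "continuous_map X Y f" "f ` (topspace X \<inter> S) \<subseteq> T"
  shows "rchain_map p f ` rel_rboundaries p X S \<subseteq> rel_rboundaries p Y T"
proof clarify
  fix x assume "x \<in> rel_rboundaries p X S"
  then obtain b a where x: "x = b + a" "b \<in> rboundaries p X" "a \<in> rchains p (subtopology X S)"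
    by (auto simp: rel_rboundaries_def elim: set_plus_elim)
  have "rchain_map p f b \<in> rboundaries p Y" using x(2) rboundaries_map[OF assms(1)] by blast
  moreover have "rchain_map p f a \<in> rchains p (subtopology Y T)"
    using x(3) rchains_map[OF _ continuous_map_subtopologies[OF assms]] by blast
  ultimately show "rchain_map p f x \<in> rel_rboundaries p Y T"
    by (auto simp: x(1) rel_rboundaries_def rchain_map_add intro: set_plus_intro)
qed

subsection \<open>Additivity for pairs\<close>

abbreviation rel_trace :: "nat \<Rightarrow> 'a topology \<Rightarrow> 'a set \<Rightarrow> ('a \<Rightarrow> 'a) \<Rightarrow> rat" where
  "rel_trace p X S f \<equiv> rchain.quotient_trace (rel_rcycles p X S) (rel_rboundaries p X S) (rchain_map p f)"

abbreviation rel_finite :: "nat \<Rightarrow> 'a topology \<Rightarrow> 'a set \<Rightarrow> bool" where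
  "rel_finite p X S \<equiv> rchain.finite_quotient (rel_rcycles p X S) (rel_rboundaries p X S)"

abbreviation rel_acyclic :: "nat \<Rightarrow> 'a topology \<Rightarrow> 'a set \<Rightarrow> bool" where
  "rel_acyclic p X S \<equiv> rel_rcycles p X S \<subseteq> rel_rboundaries p X S"

lemma finite_quotient_set_plus:
  assumes "rchain.finite_quotient Z B" "0 \<in> B" "0 \<in> C"
  shows "rchain.finite_quotient (Z + C) (B + C)"
proof -
  obtain S where S: "finite S" "Z \<subseteq> rchain.span (S \<union> B)"
    using assms by (auto simp: rchain.finite_quotient_def)
  have BC: "B \<subseteq> B + C" "C \<subseteq> B + C"
    using set_plus_intro[OF _ assms(3)] set_plus_intro[OF assms(2)] by fastforce+
  then have "rchain.span (S \<union> B) \<subseteq> rchain.span (S \<union> (B + C))"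
    by (intro rchain.span_mono) auto
  then have "Z + C \<subseteq> rchain.span (S \<union> (B + C))"
    using S(2) BC(2) by (auto elim!: set_plus_elim intro!: rchain.span_add intro: rchain.span_base)
  then show ?thesis
    using S(1) by (auto simp: rchain.finite_quotient_def)
qed

lemma subspace_set_plus_self: "rchain.subspace U \<Longrightarrow> B \<subseteq> U \<Longrightarrow> 0 \<in> B \<Longrightarrow> B + U = U"
  using set_zero_plus2[of B U] rchain.subspace_add[of U] by (auto elim!: set_plus_elim)

lemma set_plus_mono_left: "0 \<in> C \<Longrightarrow> B \<subseteq> B + (C :: 'a::monoid_add set)"
  using set_plus_intro[of _ B 0 C] by auto

lemma set_plus_mono_right: "0 \<in> B \<Longrightarrow> C \<subseteq> B + (C :: 'a::monoid_add set)"
  using set_plus_intro[of 0 B _ C] by auto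

text \<open>The long exact sequence of the pair \<open>(X, S)\<close> at the level of chains:
  \<open>ZS / (ZS \<inter> BX) \<cong> (BX + ZS) / BX\<close> is the image of \<open>H\<^sub>p(S) \<rightarrow> H\<^sub>p(X)\<close>,
  \<open>ZX / (BX + ZS) \<cong> (ZX + CS) / (BX + CS)\<close> that of \<open>H\<^sub>p(X) \<rightarrow> H\<^sub>p(X, S)\<close>, and
  \<open>(ZS \<inter> BX) / BS\<close> that of the connecting map \<open>H\<^sub>p\<^sub>+\<^sub>1(X, S) \<rightarrow> H\<^sub>p(S)\<close>.\<close>

locale rchain_pair_pieces =
  fixes X :: "'a topology" and S :: "'a set" and p :: nat
begin

abbreviation "ZX \<equiv> rcycles p X"
abbreviation "BX \<equiv> rboundaries p X"
abbreviation "ZS \<equiv> rcycles p (subtopology X S)"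
abbreviation "BS \<equiv> rboundaries p (subtopology X S)"
abbreviation "CS \<equiv> rchains p (subtopology X S)"

lemma zero_mems: "0 \<in> ZX" "0 \<in> BX" "0 \<in> ZS" "0 \<in> BS" "0 \<in> CS"
  by (auto simp: rcycles_closed rboundaries_closed rchains_closed)

lemma inclusions: "BX \<subseteq> ZX" "BS \<subseteq> ZS" "ZS \<subseteq> CS" "ZS \<subseteq> ZX" "BS \<subseteq> BX" "CS \<subseteq> rchains p X"
proof -
  show "BX \<subseteq> ZX" "BS \<subseteq> ZS" by (rule rboundaries_subset_rcycles)+
  show "ZS \<subseteq> CS" "ZS \<subseteq> ZX" "CS \<subseteq> rchains p X" using rchains_mono[of p X S] by (auto simp: rcycles_def)
  show "BS \<subseteq> BX" unfolding rboundaries_def using rchains_mono[of "Suc p" X S] by (rule image_mono)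
qed

lemma relative_inclusions:
  "BX + CS \<subseteq> ZX + CS" "ZX + CS \<subseteq> rel_rcycles p X S" "BX \<subseteq> BX + ZS" "BX + ZS \<subseteq> ZX" "BS \<subseteq> ZS \<inter> BX"
proof -
  show "BX + CS \<subseteq> ZX + CS" using inclusions(1) by (intro set_plus_mono2) auto
  show "ZX + CS \<subseteq> rel_rcycles p X S"
    using inclusions(6) rchains_boundary[of _ p "subtopology X S"]
    by (auto elim!: set_plus_elim simp: rel_rcycles_def rcycles_def rchain_boundary_add intro: rchains_closed)
  show "BX \<subseteq> BX + ZS" using zero_mems by (intro set_plus_mono_left)
  show "BX + ZS \<subseteq> ZX" using inclusions by (auto elim!: set_plus_elim intro!: rcycles_closed)
  show "BS \<subseteq> ZS \<inter> BX" using inclusions by blast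
qed

lemma iso_images: "quotient_iso id ZX (BX + ZS) (ZX + CS) (BX + CS)"
  unfolding quotient_iso_def
proof (intro conjI ballI impI)
  show "id ` ZX \<subseteq> ZX + CS" using zero_mems set_plus_mono_left by auto
  show "id ` (BX + ZS) \<subseteq> BX + CS" using inclusions by (simp add: set_plus_mono2)
  fix z
  show "z \<in> BX + ZS" if z: "z \<in> ZX" "id z \<in> BX + CS"
  proof -
    obtain b a where ba: "z = b + a" "b \<in> BX" "a \<in> CS" using z(2) by (auto elim: set_plus_elim)
    \<comment> \<open>If a cycle is a boundary plus a chain of \<open>S\<close>, that chain of
      \<open>S\<close> is the difference of two cycles and so lies in \<open>ZS\<close>.\<close>
    then have "rchain_boundary p b = 0" using inclusions(1) by (auto simp: rcycles_def)
    then have "a \<in> ZS" using ba z(1) by (auto simp: rcycles_def rchain_boundary_add)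
    then show ?thesis using ba by auto
  qed
  fix w assume "w \<in> ZX + CS"
  then obtain z a where "w = z + a" "z \<in> ZX" "a \<in> CS" by (auto elim: set_plus_elim)
  then show "\<exists>z\<in>ZX. w - id z \<in> BX + CS"
    using set_plus_mono_right[OF zero_mems(2), of CS] by (intro bexI[of _ z]) auto
qed

text \<open>The second isomorphism theorem for \<open>ZS\<close> and \<open>BX\<close>.\<close>

lemma iso_coimages: "quotient_iso id ZS (ZS \<inter> BX) (BX + ZS) BX"
  unfolding quotient_iso_def
proof (intro conjI ballI impI)
  show "id ` ZS \<subseteq> BX + ZS" using zero_mems set_plus_mono_right by auto
  fix w assume "w \<in> BX + ZS"
  then obtain b a where "w = b + a" "b \<in> BX" "a \<in> ZS" by (auto elim: set_plus_elim)
  then show "\<exists>z\<in>ZS. w - id z \<in> BX" by (intro bexI[of _ a]) auto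
qed auto

lemmas subspaces = subspace_rcycles subspace_rboundaries subspace_rchains subspace_set_plus
  rchain.subspace_inter subspace_rel_rcycles subspace_rel_rboundaries

end

text \<open>Kernel of the connecting map: if the boundary of \<open>z\<close> also bounds a chain
  \<open>a\<close> of \<open>S\<close>, then \<open>z - a\<close> is an absolute cycle. Image: a
  cycle of \<open>S\<close> that bounds in \<open>X\<close> is hit by any filling of it, which is a
  relative cycle.\<close>

lemma iso_connecting:
  "quotient_iso (rchain_boundary (Suc p)) (rel_rcycles (Suc p) X S)
     (rcycles (Suc p) X + rchains (Suc p) (subtopology X S))
     (rcycles p (subtopology X S) \<inter> rboundaries p X) (rboundaries p (subtopology X S))"
  unfolding quotient_iso_def
proof (intro conjI ballI impI)
  show "rchain_boundary (Suc p) ` rel_rcycles (Suc p) X S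
    \<subseteq> rcycles p (subtopology X S) \<inter> rboundaries p X"
    using rchain_boundary_boundary[of _ "Suc p" X] by (auto simp: rel_rcycles_def rcycles_def rboundaries_def)
  show "rchain_boundary (Suc p) ` (rcycles (Suc p) X + rchains (Suc p) (subtopology X S))
    \<subseteq> rboundaries p (subtopology X S)"
    by (auto elim!: set_plus_elim simp: rcycles_def rboundaries_def rchain_boundary_add)
  fix z
  show "z \<in> rcycles (Suc p) X + rchains (Suc p) (subtopology X S)"
    if z: "z \<in> rel_rcycles (Suc p) X S" "rchain_boundary (Suc p) z \<in> rboundaries p (subtopology X S)"
  proof -
    obtain a where a: "a \<in> rchains (Suc p) (subtopology X S)" "rchain_boundary (Suc p) z = rchain_boundary (Suc p) a"
      using z(2) unfolding rboundaries_def by blast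
    then have "a \<in> rchains (Suc p) X" using rchains_mono by blast
    then have "z - a \<in> rcycles (Suc p) X"
      using a z(1) rchain.subspace_diff[OF subspace_rchains]
      by (auto simp: rcycles_def rel_rcycles_def rchain_boundary_diff)
    then have "(z - a) + a \<in> rcycles (Suc p) X + rchains (Suc p) (subtopology X S)"
      using a(1) by (rule set_plus_intro)
    then show ?thesis by simp
  qed
  fix w assume w: "w \<in> rcycles p (subtopology X S) \<inter> rboundaries p X"
  then obtain z where z: "z \<in> rchains (Suc p) X" "w = rchain_boundary (Suc p) z"
    by (auto simp: rboundaries_def)
  with w have "z \<in> rel_rcycles (Suc p) X S" by (auto simp: rel_rcycles_def rcycles_def)
  with z(2) show "\<exists>z\<in>rel_rcycles (Suc p) X S. w - rchain_boundary (Suc p) z \<in> rboundaries p (subtopology X S)"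
    by (intro bexI[of _ z]) (auto simp: rboundaries_closed)
qed

text \<open>Every 0-chain is a cycle, so in degree 0 the piece on which the connecting map would act
  is trivial. This is the right-hand end of the long exact sequence.\<close>

lemma rel_rcycles_0: "rel_rcycles 0 X S = rcycles 0 X + rchains 0 (subtopology X S)"
proof -
  have *: "rel_rcycles 0 X S = rchains 0 X" "rcycles 0 X = rchains 0 X"
    by (auto simp: rel_rcycles_def rcycles_def rchain_boundary_def rchains_closed)
  show ?thesis
    unfolding * using subspace_set_plus_self[OF subspace_rchains rchains_mono rchains_closed(1), of 0 X S]
    by (simp add: add.commute)
qed

text \<open>Of the two layers of \<open>H\<^sub>p(X, S)\<close>, the lower one is a quotient of the
  homology of \<open>X\<close>, and the connecting map embeds the upper one in that of
  \<open>S\<close>, one degree down; for \<open>p = 0\<close> the upper layer is trivial.\<close>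

lemma rel_finite_relative:
  assumes "rel_finite p X {}" and "rel_finite (p - 1) (subtopology X S) {}"
  shows "rel_finite p X S"
proof -
  interpret rchain_pair_pieces X S p .
  have "rchain.finite_quotient (ZX + CS) (BX + CS)"
    using assms(1) zero_mems by (intro finite_quotient_set_plus) (simp_all add: rel_rcycles_empty rel_rboundaries_empty)
  moreover have "rchain.finite_quotient (rel_rcycles p X S) (ZX + CS)"
  proof (cases p)
    case 0
    then show ?thesis by (simp add: rchain.finite_quotient_trivial rel_rcycles_0)
  next
    case (Suc q)
    have "rchain.finite_quotient (rcycles q (subtopology X S) \<inter> rboundaries q X) (rboundaries q (subtopology X S))"
      using assms(2) by (rule rchain.finite_quotient_mono) (auto simp: Suc rel_rcycles_empty rel_rboundaries_empty)
    then show ?thesis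
      unfolding Suc using rchain_pair_pieces.relative_inclusions(5)[of q X S]
      by (subst rchain_pair.finite_quotient_iso[OF rchain_linear_boundary iso_connecting])
        (auto intro!: subspaces)
  qed
  ultimately show ?thesis
    unfolding rel_rboundaries_def by (rule rchain.finite_quotient_trans[rotated])
qed

text \<open>In the filtration \<open>BX \<subseteq> BX + ZS \<subseteq> ZX\<close> the lower layer
  is a quotient of the homology of \<open>S\<close>, and the upper one embeds in that of the
  pair.\<close>

lemma rel_finite_absolute:
  assumes "rel_finite p (subtopology X S) {}" and "rel_finite p X S"
  shows "rel_finite p X {}"
proof -
  interpret rchain_pair_pieces X S p .
  have "rchain.finite_quotient (ZS + BX) (BS + BX)"
    using assms(1) zero_mems by (intro finite_quotient_set_plus) (simp_all add: rel_rcycles_empty rel_rboundaries_empty)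
  then have 1: "rchain.finite_quotient (BX + ZS) BX"
    using subspace_set_plus_self[OF subspaces(2) inclusions(5) zero_mems(4)] by (simp add: add.commute)
  have "rchain.finite_quotient (ZX + CS) (BX + CS)"
    using assms(2) by (rule rchain.finite_quotient_mono) (auto simp: rel_rboundaries_def dest: set_mp[OF relative_inclusions(2)])
  then have "rchain.finite_quotient ZX (BX + ZS)"
    using relative_inclusions
    by (subst rchain_pair.finite_quotient_iso[OF rchain.linear_id iso_images]) (auto intro!: subspaces)
  then have "rchain.finite_quotient ZX BX" using 1 by (rule rchain.finite_quotient_trans)
  then show ?thesis by (simp add: rel_rcycles_empty rel_rboundaries_empty)
qed

lemma rel_acyclic_relative:
  assumes "rel_acyclic (Suc p) X {}" and "rel_acyclic p (subtopology X S) {}"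
  shows "rel_acyclic (Suc p) X S"
proof
  interpret rchain_pair_pieces X S "Suc p" .
  fix z assume z: "z \<in> rel_rcycles (Suc p) X S"
  have "rchain_boundary (Suc p) z \<in> rcycles p (subtopology X S) \<inter> rboundaries p X"
    using iso_connecting[of p X S] z unfolding quotient_iso_def by blast
  then have "rchain_boundary (Suc p) z \<in> rboundaries p (subtopology X S)"
    using assms(2) by (auto simp: rel_rcycles_empty rel_rboundaries_empty)
  then have "z \<in> ZX + CS"
    using iso_connecting[of p X S] z unfolding quotient_iso_def by blast
  moreover have "ZX + CS \<subseteq> BX + CS"
    using assms(1) by (intro set_plus_mono2) (auto simp: rel_rcycles_empty rel_rboundaries_empty)
  ultimately show "z \<in> rel_rboundaries (Suc p) X S" by (auto simp: rel_rboundaries_def)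
qed

lemma rel_acyclic_absolute:
  assumes "rel_acyclic p (subtopology X S) {}" and "rel_acyclic p X S"
  shows "rel_acyclic p X {}"
proof
  interpret rchain_pair_pieces X S p .
  fix z assume "z \<in> rel_rcycles p X {}"
  then have z: "z \<in> ZX" by (simp add: rel_rcycles_empty)
  then have "z \<in> rel_rcycles p X S" by (auto simp: rcycles_def rel_rcycles_def rchains_closed)
  then have "z \<in> BX + CS" using assms(2) by (auto simp: rel_rboundaries_def)
  then have "z \<in> BX + ZS" using iso_images z by (auto simp: quotient_iso_def)
  moreover have "ZS \<subseteq> BS" using assms(1) by (simp add: rel_rcycles_empty rel_rboundaries_empty)
  ultimately have "z \<in> BX"
    using inclusions(5) by (auto elim!: set_plus_elim intro!: rboundaries_closed)
  then show "z \<in> rel_rboundaries p X {}" by (simp add: rel_rboundaries_empty)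
qed

text \<open>Each of the three groups is cut by one intermediate subspace: \<open>BX + ZS\<close>,
  \<open>ZS \<inter> BX\<close> and \<open>ZX + CS\<close>. The layers shared with the homology of
  \<open>X\<close> match by \<open>iso_images\<close> and \<open>iso_coimages\<close>. What is left
  over is \<open>d p\<close>, the trace on the kernel of the map from the homology of
  \<open>S\<close> to that of \<open>X\<close>, and \<open>d (p - 1)\<close>, which the connecting
  map carries from the top layer of the relative group one degree down.\<close>

lemma rel_trace_pieces:
  fixes f :: "'a \<Rightarrow> 'a"
  assumes f: "continuous_map X X f" "f ` (topspace X \<inter> S) \<subseteq> S"
    and finX: "\<And>p. rel_finite p X {}" and finS: "\<And>p. rel_finite p (subtopology X S) {}"
  defines "d \<equiv> \<lambda>p. rchain.quotient_trace (rcycles p (subtopology X S) \<inter> rboundaries p X)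
      (rboundaries p (subtopology X S)) (rchain_map p f)"
  shows "rel_trace p X S f + rel_trace p (subtopology X S) {} f
    = rel_trace p X {} f + d p + (if p = 0 then 0 else d (p - 1))"
proof -
  interpret rchain_pair_pieces X S p .
  let ?tr = "\<lambda>Z B. rchain.quotient_trace Z B (rchain_map p f)"
  have fS: "continuous_map (subtopology X S) (subtopology X S) f"
    using f by (rule continuous_map_subtopologies)
  have inv: "rchain_map p f ` ZX \<subseteq> ZX" "rchain_map p f ` BX \<subseteq> BX" "rchain_map p f ` ZS \<subseteq> ZS"
    "rchain_map p f ` BS \<subseteq> BS" "rchain_map p f ` CS \<subseteq> CS"
    "rchain_map p f ` rel_rcycles p X S \<subseteq> rel_rcycles p X S"
    using rcycles_map[OF f(1)] rboundaries_map[OF f(1)] rcycles_map[OF fS] rboundaries_map[OF fS]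
      rchains_map[OF _ fS] rel_rcycles_map[OF f] by auto
  have inv_plus: "rchain_map p f ` (U + V) \<subseteq> U + V"
    if "rchain_map p f ` U \<subseteq> U" "rchain_map p f ` V \<subseteq> V" for U V
    using that by (force elim!: set_plus_elim simp: rchain_map_add)
  note inv' = inv inv_plus[OF inv(2) inv(3)] inv_plus[OF inv(2) inv(5)] inv_plus[OF inv(1) inv(5)]
  have X: "?tr ZX BX = ?tr ZX (BX + ZS) + ?tr (BX + ZS) BX"
    using finX[of p] inv' relative_inclusions
    by (intro rchain.quotient_trace_add)
      (auto simp: rel_rcycles_empty rel_rboundaries_empty intro!: subspaces rchain_linear_map)
  have S: "?tr ZS BS = ?tr ZS (ZS \<inter> BX) + ?tr (ZS \<inter> BX) BS"
    using finS[of p] inv' relative_inclusions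
    by (intro rchain.quotient_trace_add)
      (auto simp: rel_rcycles_empty rel_rboundaries_empty intro!: subspaces rchain_linear_map)
  have fin: "rel_finite p X S" using finX finS by (rule rel_finite_relative)
  have XS: "?tr (rel_rcycles p X S) (BX + CS) = ?tr (rel_rcycles p X S) (ZX + CS) + ?tr (ZX + CS) (BX + CS)"
    using fin inv' relative_inclusions
    by (intro rchain.quotient_trace_add)
      (auto simp: rel_rboundaries_def intro!: subspaces rchain_linear_map)
  have "?tr ZX (BX + ZS) = ?tr (ZX + CS) (BX + CS)"
  proof (rule rchain_pair.quotient_trace_iso[OF rchain.linear_id iso_images])
    show "rchain.finite_quotient ZX (BX + ZS)"
      using finX[of p] relative_inclusions(3)
      by (auto simp: rel_rcycles_empty rel_rboundaries_empty elim!: rchain.finite_quotient_mono)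
  qed (use inv' relative_inclusions in \<open>auto intro!: subspaces rchain_linear_map\<close>)
  moreover have "?tr ZS (ZS \<inter> BX) = ?tr (BX + ZS) BX"
  proof (rule rchain_pair.quotient_trace_iso[OF rchain.linear_id iso_coimages])
    show "rchain.finite_quotient ZS (ZS \<inter> BX)"
      using finS[of p] relative_inclusions(5)
      by (auto simp: rel_rcycles_empty rel_rboundaries_empty elim!: rchain.finite_quotient_mono)
  qed (use inv' relative_inclusions in \<open>auto intro!: subspaces rchain_linear_map\<close>)
  moreover have "?tr (rel_rcycles p X S) (ZX + CS) = (if p = 0 then 0 else d (p - 1))"
  proof (cases p)
    case 0
    then show ?thesis
      using rchain.quotient_trace_trivial[OF rel_rcycles_0[of X S] subspaces(6) rchain_linear_map[of 0 f]] inv'(6)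
      by simp
  next
    case (Suc q)
    have inv'': "rchain_map q f ` (rcycles q (subtopology X S) \<inter> rboundaries q X) \<subseteq> rcycles q (subtopology X S) \<inter> rboundaries q X"
      using rcycles_map[OF fS] rboundaries_map[OF f(1)] by blast
    have "?tr (rel_rcycles p X S) (ZX + CS) = d q"
      unfolding d_def Suc
    proof (rule rchain_pair.quotient_trace_iso[OF rchain_linear_boundary iso_connecting])
      show "rchain.finite_quotient (rel_rcycles (Suc q) X S) (rcycles (Suc q) X + rchains (Suc q) (subtopology X S))"
        using fin relative_inclusions(1) unfolding Suc rel_rboundaries_def
        by (elim rchain.finite_quotient_mono) auto
      show "rchain_map q f (rchain_boundary (Suc q) z) = rchain_boundary (Suc q) (rchain_map (Suc q) f z)"
        if "z \<in> rel_rcycles (Suc q) X S" for z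
        using that rchain_map_boundary[of z "Suc q" X f] by (simp add: rel_rcycles_def)
    qed (use inv' inv'' rboundaries_map[OF fS] relative_inclusions rchain_pair_pieces.relative_inclusions(5)[of q X S]
          in \<open>auto simp: Suc intro!: subspaces rchain_linear_map\<close>)
    then show ?thesis by (simp add: Suc)
  qed
  ultimately show ?thesis
    using X S XS by (simp add: rel_rcycles_empty rel_rboundaries_empty rel_rboundaries_def d_def)
qed

subsection \<open>Comparison with integral homology\<close>

lemma rat_chain_rel_rcycles [simp]: "rat_chain c \<in> rel_rcycles p X S \<longleftrightarrow> singular_relcycle p X S c"
  by (simp add: rel_rcycles_def singular_relcycle_def mod_subset_def flip: rat_chain_boundary)

lemma rat_chain_rel_rboundaries:
  assumes "singular_relboundary p X S c"
  shows "rat_chain c \<in> rel_rboundaries p X S"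
proof -
  obtain d where d: "singular_chain (Suc p) X d"
    "singular_chain p (subtopology X S) (chain_boundary (Suc p) d - c)"
    using assms by (auto simp: singular_relboundary_def mod_subset_def)
  have "singular_chain p (subtopology X S) (c - chain_boundary (Suc p) d)"
    using singular_chain_minus[of p "subtopology X S" "chain_boundary (Suc p) d - c"] d(2) by simp
  then have "rat_chain (c - chain_boundary (Suc p) d) \<in> rchains p (subtopology X S)" by simp
  moreover have "rat_chain (chain_boundary (Suc p) d) \<in> rboundaries p X"
    using d(1) by (auto simp: rboundaries_def rat_chain_boundary)
  ultimately have "rat_chain (chain_boundary (Suc p) d) + rat_chain (c - chain_boundary (Suc p) d)
    \<in> rel_rboundaries p X S"
    unfolding rel_rboundaries_def by (rule set_plus_intro[rotated])
  then show ?thesis by (simp add: rat_chain_simps)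
qed

text \<open>An integral chain that bounds rationally need not bound integrally, because of torsion.
  So the denominators of the filling \<open>d\<close> and of the chain \<open>a\<close> in
  \<open>S\<close> are cleared, not those of \<open>r\<close>.\<close>

lemma rel_rboundaries_clear_denominators:
  assumes "r \<in> rel_rboundaries p X S"
  obtains N c where "N > 0" "rchain_scale (of_int N) r = rat_chain c" "singular_relboundary p X S c"
proof -
  obtain d a where r: "r = rchain_boundary (Suc p) d + a" "d \<in> rchains (Suc p) X"
    "a \<in> rchains p (subtopology X S)"
    using assms by (auto simp: rel_rboundaries_def rboundaries_def elim!: set_plus_elim)
  obtain M d' where M: "M > 0" "rchain_scale (of_int M) d = rat_chain d'" "singular_chain (Suc p) X d'"
    using rchains_clear_denominators[OF r(2)] .
  obtain N a' where N: "N > 0" "rchain_scale (of_int N) a = rat_chain a'" "singular_chain p (subtopology X S) a'"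
    using rchains_clear_denominators[OF r(3)] .
  let ?c = "chain_boundary (Suc p) (frag_cmul N d') + frag_cmul M a'"
  have "rchain_scale (of_int (M * N)) r =
      rchain_boundary (Suc p) (rchain_scale (of_int N) (rchain_scale (of_int M) d)) +
      rchain_scale (of_int M) (rchain_scale (of_int N) a)"
    by (simp add: r(1) rchain_boundary_scale rchain_scale_simps(1) mult.commute)
  also have "\<dots> = rat_chain ?c"
    by (simp only: M(2) N(2) rat_chain_simps rat_chain_boundary)
  finally have "rchain_scale (of_int (M * N)) r = rat_chain ?c" .
  moreover have "singular_relboundary p X S ?c"
    unfolding singular_relboundary_def mod_subset_def
    using M(3) N(3) singular_chain_cmul[OF N(3), of "- M"] singular_chain_cmul[OF M(3), of N]
    by (intro exI[of _ "frag_cmul N d'"]) simp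
  moreover have "M * N > 0" using M(1) N(1) by simp
  ultimately show ?thesis using that by blast
qed

text \<open>Rational homology is integral homology tensored with the rationals, so an isomorphism
  of integral homology groups gives one in rational homology, by clearing denominators.\<close>

lemma quotient_iso_hom_induced:
  assumes f: "continuous_map X Y f" "f \<in> topspace X \<inter> S \<rightarrow> T"
    and bij: "bij_betw (hom_induced (int p) X S Y T f)
      (carrier (relative_homology_group (int p) X S)) (carrier (relative_homology_group (int p) Y T))"
  shows "quotient_iso (rchain_map p f) (rel_rcycles p X S) (rel_rboundaries p X S)
    (rel_rcycles p Y T) (rel_rboundaries p Y T)"
  unfolding quotient_iso_def
proof (intro conjI ballI impI)
  have fim: "f ` (topspace X \<inter> S) \<subseteq> T" using f(2) by blast
  show "rchain_map p f ` rel_rcycles p X S \<subseteq> rel_rcycles p Y T"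
    "rchain_map p f ` rel_rboundaries p X S \<subseteq> rel_rboundaries p Y T"
    using rel_rcycles_map[OF f(1) fim] rel_rboundaries_map[OF f(1) fim] by blast+
next
  fix z assume z: "z \<in> rel_rcycles p X S" "rchain_map p f z \<in> rel_rboundaries p Y T"
  obtain N c where N: "N > 0" "rchain_scale (of_int N) z = rat_chain c"
    by (rule clear_denominators)
  have c: "rat_chain c \<in> rel_rcycles p X S"
    using z(1) by (simp only: N(2)[symmetric] rchain.subspace_scale[OF subspace_rel_rcycles])
  have "rat_chain (chain_map p f c) \<in> rel_rboundaries p Y T"
    using z(2) by (simp only: rat_chain_map N(2)[symmetric] rchain_map_scale
        rchain.subspace_scale[OF subspace_rel_rboundaries])
  \<comment> \<open>The integral class of the image of \<open>c\<close> may be a nonzero torsion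
    class; only a multiple of it is known to bound, and injectivity is applied to that
    multiple.\<close>
  then obtain M c' where M: "M > 0" "rchain_scale (of_int M) (rat_chain (chain_map p f c)) = rat_chain c'"
    "singular_relboundary p Y T c'"
    by (rule rel_rboundaries_clear_denominators)
  have "rat_chain c' = rat_chain (chain_map p f (frag_cmul M c))"
    by (simp only: M(2)[symmetric] rat_chain_map rat_chain_simps rchain_map_scale)
  then have c': "c' = chain_map p f (frag_cmul M c)" by simp
  have Mc: "singular_relcycle p X S (frag_cmul M c)"
    using c rchain.subspace_scale[OF subspace_rel_rcycles, of "rat_chain c" p X S "of_int M"]
    by (simp only: rat_chain_simps(4)[symmetric] rat_chain_rel_rcycles)
  have "hom_induced (int p) X S Y T f (homologous_rel_set p X S (frag_cmul M c)) =
      hom_induced (int p) X S Y T f (homologous_rel_set p X S 0)"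
  proof -
    have "homologous_rel_set p Y T (chain_map p f (frag_cmul M c)) = homologous_rel_set p Y T (chain_map p f 0)"
      unfolding homologous_rel_set_eq unfolding homologous_rel_def c'[symmetric] using M(3) by simp
    then show ?thesis
      using hom_induced_chain_map_gen[OF f Mc] hom_induced_chain_map_gen[OF f, of p 0] by simp
  qed
  then have "homologous_rel_set p X S (frag_cmul M c) = homologous_rel_set p X S 0"
    using bij_betw_imp_inj_on[OF bij] Mc
    by (auto simp: inj_on_def carrier_relative_homology_group)
  then have "singular_relboundary p X S (frag_cmul M c)"
    unfolding homologous_rel_set_eq by (simp add: homologous_rel_def)
  then have "rchain_scale (of_int M) (rchain_scale (of_int N) z) \<in> rel_rboundaries p X S"
    using rat_chain_rel_rboundaries by (metis N(2) rat_chain_simps(4))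
  then show "z \<in> rel_rboundaries p X S"
    using M(1) N(1) by (simp only: subspace_scale_iff[OF subspace_rel_rboundaries] of_int_eq_0_iff)
next
  fix w assume w: "w \<in> rel_rcycles p Y T"
  obtain N c where N: "N > 0" "rchain_scale (of_int N) w = rat_chain c"
    by (rule clear_denominators)
  have "rat_chain c \<in> rel_rcycles p Y T"
    using w by (simp only: N(2)[symmetric] rchain.subspace_scale[OF subspace_rel_rcycles])
  then have "homologous_rel_set p Y T c \<in> carrier (relative_homology_group (int p) Y T)"
    by (auto simp: carrier_relative_homology_group)
  then have "homologous_rel_set p Y T c \<in> hom_induced (int p) X S Y T f ` homologous_rel_set p X S ` singular_relcycle_set p X S"
    using bij_betw_imp_surj_on[OF bij] by (simp only: carrier_relative_homology_group)
  then obtain b where b: "singular_relcycle p X S b"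
    "homologous_rel_set p Y T c = hom_induced (int p) X S Y T f (homologous_rel_set p X S b)"
    by blast
  then have "singular_relboundary p Y T (c - chain_map p f b)"
    unfolding hom_induced_chain_map_gen[OF f b(1)] homologous_rel_set_eq by (simp add: homologous_rel_def)
  then have "rat_chain (c - chain_map p f b) \<in> rel_rboundaries p Y T"
    by (rule rat_chain_rel_rboundaries)
  then have "rchain_scale (1 / of_int N) (rchain_scale (of_int N) w - rchain_map p f (rat_chain b)) \<in> rel_rboundaries p Y T"
    by (simp only: N(2) rat_chain_simps rat_chain_map rchain.subspace_scale[OF subspace_rel_rboundaries])
  moreover have "rchain_scale (1 / of_int N) (rchain_scale (of_int N) w - rchain_map p f (rat_chain b))
      = w - rchain_map p f (rchain_scale (1 / of_int N) (rat_chain b))"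
    using N(1) by (simp add: rchain_scale_simps(2) rchain_map_scale)
  ultimately show "\<exists>z\<in>rel_rcycles p X S. w - rchain_map p f z \<in> rel_rboundaries p Y T"
    using b(1) by (intro bexI[of _ "rchain_scale (1 / of_int N) (rat_chain b)"])
      (simp_all add: rchain.subspace_scale[OF subspace_rel_rcycles])
qed

lemma rel_finite_iso:
  assumes "quotient_iso (rchain_map p f) (rel_rcycles p X S) (rel_rboundaries p X S)
    (rel_rcycles p Y T) (rel_rboundaries p Y T)"
  shows "rel_finite p X S \<longleftrightarrow> rel_finite p Y T"
  by (rule rchain_pair.finite_quotient_iso[OF rchain_linear_map assms subspace_rel_rcycles
      subspace_rel_rboundaries subspace_rel_rcycles subspace_rel_rboundaries
      rel_rboundaries_subset_rel_rcycles])

lemma rel_acyclic_iso: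
  assumes "quotient_iso (rchain_map p f) (rel_rcycles p X S) (rel_rboundaries p X S)
    (rel_rcycles p Y T) (rel_rboundaries p Y T)"
  shows "rel_acyclic p X S \<longleftrightarrow> rel_acyclic p Y T"
proof
  assume "rel_acyclic p X S"
  show "rel_acyclic p Y T"
  proof
    fix w assume "w \<in> rel_rcycles p Y T"
    then obtain z where "z \<in> rel_rcycles p X S" "w - rchain_map p f z \<in> rel_rboundaries p Y T"
      using assms by (auto simp: quotient_iso_def)
    moreover have "rchain_map p f z \<in> rel_rboundaries p Y T"
      using calculation(1) assms \<open>rel_acyclic p X S\<close> by (auto simp: quotient_iso_def)
    ultimately have "(w - rchain_map p f z) + rchain_map p f z \<in> rel_rboundaries p Y T"
      using rchain.subspace_add[OF subspace_rel_rboundaries] by blast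
    then show "w \<in> rel_rboundaries p Y T" by simp
  qed
next
  assume "rel_acyclic p Y T"
  then show "rel_acyclic p X S"
    using assms unfolding quotient_iso_def by blast
qed

subsection \<open>The trace on rational homology\<close>

text \<open>The hypotheses are what a basis of the quotient supplies: existence of coordinates and
  independence modulo \<open>B\<close>. The dual functionals are then forced, and the second
  conclusion reads them off from any expansion.\<close>

lemma (in vector_quotient) quotient_frameI:
  assumes Z: "subspace Z" and B: "subspace B" "B \<subseteq> Z" and e: "\<And>i. i < n \<Longrightarrow> e i \<in> Z"
    and ex: "\<And>v. v \<in> Z \<Longrightarrow> \<exists>a. v - (\<Sum>i<n. a i \<cdot> e i) \<in> B"
    and ind: "\<And>a. (\<Sum>i<n. a i \<cdot> e i) \<in> B \<Longrightarrow> \<forall>i<n. a i = 0"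
  obtains c where "quotient_frame Z B n e c"
    "\<And>v a i. v - (\<Sum>i<n. a i \<cdot> e i) \<in> B \<Longrightarrow> v \<in> Z \<Longrightarrow> i < n \<Longrightarrow> c i v = a i"
proof -
  from ex have "\<forall>v\<in>Z. \<exists>a. v - (\<Sum>i<n. a i \<cdot> e i) \<in> B" by (intro ballI)
  from bchoice[OF this] obtain a where a: "\<And>v. v \<in> Z \<Longrightarrow> v - (\<Sum>i<n. a v i \<cdot> e i) \<in> B"
    by auto
  define c where "c = (\<lambda>i v. a v i)"
  have c: "c i v = b i" if "v - (\<Sum>i<n. b i \<cdot> e i) \<in> B" "v \<in> Z" "i < n" for v b i
  proof -
    have "(v - (\<Sum>i<n. b i \<cdot> e i)) - (v - (\<Sum>i<n. a v i \<cdot> e i)) \<in> B"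
      by (rule subspace_diff[OF B(1) that(1) a[OF that(2)]])
    then have "(\<Sum>i<n. (a v i - b i) \<cdot> e i) \<in> B"
      by (simp add: scale_left_diff_distrib sum_subtractf)
    then show ?thesis using ind that(3) unfolding c_def by fastforce
  qed
  have "quotient_frame Z B n e c"
    unfolding quotient_frame_def
  proof (intro conjI allI impI ballI)
    fix i u v assume i: "i < n" and uv: "u \<in> Z" "v \<in> Z"
    have "(u - (\<Sum>i<n. a u i \<cdot> e i)) + (v - (\<Sum>i<n. a v i \<cdot> e i)) \<in> B"
      by (rule subspace_add[OF B(1) a[OF uv(1)] a[OF uv(2)]])
    then have "(u + v) - (\<Sum>i<n. (a u i + a v i) \<cdot> e i) \<in> B"
      by (simp add: scale_left_distrib sum.distrib algebra_simps)
    then show "c i (u + v) = c i u + c i v"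
      using c[OF _ subspace_add[OF Z uv] i, of "\<lambda>i. a u i + a v i"] by (simp add: c_def)
  next
    fix i q v assume i: "i < n" and v: "v \<in> Z"
    have "q \<cdot> (v - (\<Sum>i<n. a v i \<cdot> e i)) \<in> B"
      by (rule subspace_scale[OF B(1) a[OF v]])
    then have "q \<cdot> v - (\<Sum>i<n. (q * a v i) \<cdot> e i) \<in> B"
      by (simp add: scale_right_diff_distrib scale_sum_right)
    then show "c i (q \<cdot> v) = q * c i v"
      using c[OF _ subspace_scale[OF Z v, of q] i, of "\<lambda>i. q * a v i"] by (simp add: c_def)
  next
    fix i v assume i: "i < n" and v: "v \<in> B"
    then show "c i v = 0"
      using c[of v "\<lambda>_. 0" i] B(2) by auto
  next
    fix i j assume ij: "i < n" "j < n"
    have "(\<Sum>i<n. (if i = j then 1 else 0) \<cdot> e i) = (\<Sum>i<n. if i = j then e j else 0)"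
      by (intro sum.cong) auto
    then have "e j - (\<Sum>i<n. (if i = j then 1 else 0) \<cdot> e i) \<in> B"
      using ij(2) subspace_0[OF B(1)] by simp
    then show "c i (e j) = (if i = j then 1 else 0)"
      using c[OF _ e[OF ij(2)] ij(1), of "\<lambda>i. if i = j then 1 else 0"] by simp
  qed (use e a c_def in auto)
  then show ?thesis using that c by blast
qed

lemma finsum_rat_ring: "(\<Oplus>\<^bsub>rat_ring\<^esub>i\<in>{..<n::nat}. h i) = (\<Sum>i<n. h i)"
proof -
  interpret field rat_ring by (rule field_rat_ring)
  have simps: "carrier rat_ring = UNIV" "\<zero>\<^bsub>rat_ring\<^esub> = 0" "x \<oplus>\<^bsub>rat_ring\<^esub> y = x + y" for x y
    by (simp_all add: rat_ring_def)
  show ?thesis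
  proof (induction n)
    case (Suc n)
    have "(\<Oplus>\<^bsub>rat_ring\<^esub>i\<in>insert n {..<n}. h i) = h n \<oplus>\<^bsub>rat_ring\<^esub> (\<Oplus>\<^bsub>rat_ring\<^esub>i\<in>{..<n}. h i)"
      by (rule finsum_insert) (simp_all add: simps)
    then show ?case by (simp add: lessThan_Suc simps Suc)
  qed (simp add: simps)
qed

lemma finsum_rat_homology:
  assumes "\<And>i. i < n \<Longrightarrow> e i \<in> rcycles p X"
  shows "(\<Oplus>\<^bsub>rat_homology p X\<^esub>i\<in>{..<n::nat}. a i \<odot>\<^bsub>rat_homology p X\<^esub> rhom_class p X (e i))
    = rhom_class p X (\<Sum>i<n. rchain_scale (a i) (e i))"
proof -
  interpret module rat_ring "rat_homology p X" by (rule module_rat_homology)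
  have mem: "a i \<odot>\<^bsub>rat_homology p X\<^esub> rhom_class p X (e i) \<in> carrier (rat_homology p X)" if "i < n" for i
    using rcycles_closed(3)[OF assms[OF that]] by (simp add: rat_homology_simps(1,4))
  show ?thesis
    using mem
  proof (induction n)
    case (Suc n)
    have "(\<Oplus>\<^bsub>rat_homology p X\<^esub>i\<in>insert n {..<n}. a i \<odot>\<^bsub>rat_homology p X\<^esub> rhom_class p X (e i)) =
      a n \<odot>\<^bsub>rat_homology p X\<^esub> rhom_class p X (e n) \<oplus>\<^bsub>rat_homology p X\<^esub>
      (\<Oplus>\<^bsub>rat_homology p X\<^esub>i\<in>{..<n}. a i \<odot>\<^bsub>rat_homology p X\<^esub> rhom_class p X (e i))"
      using Suc.prems by (intro finsum_insert) auto
    then show ?case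
      using Suc by (simp add: lessThan_Suc rat_homology_simps(3,4))
  qed (simp add: rat_homology_simps(2))
qed

text \<open>Homologous chains have homologous images, so all members of the union that defines the
  induced map coincide.\<close>

lemma rat_hom_induced_class:
  assumes "continuous_map X Y f"
  shows "rat_hom_induced p X Y f (rhom_class p X z) = rhom_class p Y (rchain_map p f z)"
proof -
  have eq: "rhom_class p Y (rchain_map p f c) = rhom_class p Y (rchain_map p f z)"
    if c: "c \<in> rhom_class p X z" for c
  proof -
    have "c - z \<in> rboundaries p X" using c by (simp only: rhom_class_def mem_Collect_eq)
    then have "rchain_map p f (c - z) \<in> rboundaries p Y"
      using rboundaries_map[OF assms, of p] by blast
    then show ?thesis by (simp only: rhom_class_eq rchain_map_diff)
  qed
  have "(\<Union>c\<in>rhom_class p X z. rhom_class p Y (rchain_map p f c)) =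
      (\<Union>c\<in>rhom_class p X z. rhom_class p Y (rchain_map p f z))"
    by (rule SUP_cong[OF refl eq])
  moreover have "rhom_class p X z \<noteq> {}" using rhom_class_self by blast
  ultimately show ?thesis unfolding rat_hom_induced_def by (simp only: UN_constant if_False)
qed

lemma ex1_implies_eq: "\<exists>!x. P x \<Longrightarrow> P a \<Longrightarrow> P b \<Longrightarrow> a = b"
  by blast

text \<open>\<open>module_trace\<close> is a definite description, so both existence and uniqueness
  are needed. A frame provides a basis of classes together with a matrix; conversely any basis lifts
  to a frame, whose functionals return the matrix entries, so the trace is the same number.\<close>

lemma module_trace_eq:
  assumes f: "continuous_map X X f" and fin: "rel_finite p X {}"
  shows "module_trace rat_ring (rat_homology p X) (rat_hom_induced p X X f) = rel_trace p X {} f"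
proof -
  let ?Z = "rcycles p X" and ?B = "rboundaries p X" and ?H = "rat_homology p X"
  have Z: "rchain.subspace ?Z" and B: "rchain.subspace ?B" "?B \<subseteq> ?Z"
    by (auto intro: subspace_rcycles subspace_rboundaries set_mp[OF rboundaries_subset_rcycles])
  have inv: "rchain_map p f ` ?Z \<subseteq> ?Z" "rchain_map p f ` ?B \<subseteq> ?B"
    using rcycles_map[OF f] rboundaries_map[OF f] by auto
  have carrier: "carrier rat_ring = UNIV" by (simp add: rat_ring_def)
  have trace: "rel_trace p X {} f = (\<Sum>i<n. c i (rchain_map p f (e i)))"
    if "rchain.quotient_frame ?Z ?B n e c" for n e c
    using rchain.quotient_trace_eq[OF that Z B(2) rchain_linear_map inv]
    by (simp add: rel_rcycles_empty rel_rboundaries_empty)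
  obtain n e c where fr: "rchain.quotient_frame ?Z ?B n e c"
    using rchain.finite_quotient_frame[OF B(1) Z B(2)] fin
    by (auto simp: rel_rcycles_empty rel_rboundaries_empty)
  note fD = rchain.quotient_frameD[OF fr]
  have combo: "(\<Sum>i<n. rchain_scale (a i) (e i)) \<in> ?Z"
    if "\<And>i. i < n \<Longrightarrow> e i \<in> ?Z" for n a and e :: "nat \<Rightarrow> 'a rchain"
    using that by (intro rchain.subspace_sum[OF Z] rchain.subspace_scale[OF Z]) auto
  show ?thesis
    unfolding module_trace_def
  proof (rule the_equality)
    have "\<exists>!a. a \<in> {..<n} \<rightarrow>\<^sub>E carrier rat_ring \<and>
        v = (\<Oplus>\<^bsub>?H\<^esub>i\<in>{..<n}. a i \<odot>\<^bsub>?H\<^esub> rhom_class p X (e i))" if v: "v \<in> carrier ?H" for v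
    proof -
      obtain z where z: "z \<in> ?Z" "v = rhom_class p X z" using v by (auto simp: rat_homology_simps)
      have *: "v = (\<Oplus>\<^bsub>?H\<^esub>i\<in>{..<n}. a i \<odot>\<^bsub>?H\<^esub> rhom_class p X (e i)) \<longleftrightarrow> (\<forall>i<n. a i = c i z)" for a
      proof -
        have "v = (\<Oplus>\<^bsub>?H\<^esub>i\<in>{..<n}. a i \<odot>\<^bsub>?H\<^esub> rhom_class p X (e i)) \<longleftrightarrow>
            z - (\<Sum>i<n. rchain_scale (a i) (e i)) \<in> ?B"
          using fD(1) by (simp add: finsum_rat_homology z rhom_class_eq)
        also have "\<dots> \<longleftrightarrow> (\<forall>i<n. a i = c i z)"
        proof
          assume zB: "z - (\<Sum>i<n. rchain_scale (a i) (e i)) \<in> ?B"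
          show "\<forall>i<n. a i = c i z"
          proof (intro allI impI)
            fix i assume i: "i < n"
            have "c i z = c i (\<Sum>k<n. rchain_scale (a k) (e k))"
              using fD(1) by (intro rchain.quotient_frame_cong[OF fr Z B(2) i combo zB]) auto
            also have "\<dots> = (\<Sum>k<n. a k * c i (e k))"
              using fD(1) by (intro rchain.quotient_frame_sum[OF fr Z i]) auto
            also have "\<dots> = (\<Sum>k<n. if k = i then a i else 0)"
              using fD(5)[OF i] by (intro sum.cong) auto
            finally show "a i = c i z" using i by simp
          qed
        next
          assume "\<forall>i<n. a i = c i z"
          then show "z - (\<Sum>i<n. rchain_scale (a i) (e i)) \<in> ?B" using fD(6)[OF z(1)] by simp
        qed
        finally show ?thesis .
      qed
      show ?thesis
        unfolding * by (intro ex1I[of _ "\<lambda>i\<in>{..<n}. c i z"]) (auto simp: carrier PiE_def intro!: extensionalityI[where A = "{..<n}"])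
    qed
    then have "module_basis rat_ring ?H n (\<lambda>i. rhom_class p X (e i))"
      unfolding module_basis_def using fD(1) by (auto simp: rat_homology_simps(1))
    moreover have "rat_hom_induced p X X f (rhom_class p X (e j)) =
        (\<Oplus>\<^bsub>?H\<^esub>i\<in>{..<n}. c i (rchain_map p f (e j)) \<odot>\<^bsub>?H\<^esub> rhom_class p X (e i))" if "j < n" for j
      using fD(1) fD(6)[of "rchain_map p f (e j)"] fD(1)[OF that] inv(1)
      by (auto simp: rat_hom_induced_class[OF f] finsum_rat_homology rhom_class_eq)
    ultimately show "\<exists>n E m. module_basis rat_ring ?H n E \<and> (\<forall>i<n. \<forall>j<n. m i j \<in> carrier rat_ring) \<and>
        (\<forall>j<n. rat_hom_induced p X X f (E j) = (\<Oplus>\<^bsub>?H\<^esub>i\<in>{..<n}. m i j \<odot>\<^bsub>?H\<^esub> E i)) \<and>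
        rel_trace p X {} f = (\<Oplus>\<^bsub>rat_ring\<^esub>i\<in>{..<n}. m i i)"
      by (intro exI[of _ n] exI[of _ "\<lambda>i. rhom_class p X (e i)"] exI[of _ "\<lambda>i j. c i (rchain_map p f (e j))"])
        (simp add: carrier finsum_rat_ring trace[OF fr])
  next
    fix t assume "\<exists>n E m. module_basis rat_ring ?H n E \<and> (\<forall>i<n. \<forall>j<n. m i j \<in> carrier rat_ring) \<and>
        (\<forall>j<n. rat_hom_induced p X X f (E j) = (\<Oplus>\<^bsub>?H\<^esub>i\<in>{..<n}. m i j \<odot>\<^bsub>?H\<^esub> E i)) \<and>
        t = (\<Oplus>\<^bsub>rat_ring\<^esub>i\<in>{..<n}. m i i)"
    then obtain n E m where basis: "module_basis rat_ring ?H n E"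
      and m: "\<And>j. j < n \<Longrightarrow> rat_hom_induced p X X f (E j) = (\<Oplus>\<^bsub>?H\<^esub>i\<in>{..<n}. m i j \<odot>\<^bsub>?H\<^esub> E i)"
      and t: "t = (\<Sum>i<n. m i i)"
      by (auto simp: finsum_rat_ring)
    have "\<forall>i\<in>{..<n}. \<exists>z. z \<in> ?Z \<and> E i = rhom_class p X z"
    proof
      fix i assume "i \<in> {..<n}"
      moreover have "E \<in> {..<n} \<rightarrow> rhom_class p X ` ?Z"
        using basis unfolding module_basis_def rat_homology_simps(1) by (rule conjunct1)
      ultimately have "E i \<in> rhom_class p X ` ?Z" by (rule Pi_mem[rotated])
      then show "\<exists>z. z \<in> ?Z \<and> E i = rhom_class p X z" by blast
    qed
    from bchoice[OF this] obtain e where e: "\<And>i. i < n \<Longrightarrow> e i \<in> ?Z" "\<And>i. i < n \<Longrightarrow> E i = rhom_class p X (e i)"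
      by auto
    have sums: "(\<Oplus>\<^bsub>?H\<^esub>i\<in>{..<n}. a i \<odot>\<^bsub>?H\<^esub> E i) = rhom_class p X (\<Sum>i<n. rchain_scale (a i) (e i))" for a
    proof -
      interpret module rat_ring ?H by (rule module_rat_homology)
      have "(\<Oplus>\<^bsub>?H\<^esub>i\<in>{..<n}. a i \<odot>\<^bsub>?H\<^esub> E i) = (\<Oplus>\<^bsub>?H\<^esub>i\<in>{..<n}. a i \<odot>\<^bsub>?H\<^esub> rhom_class p X (e i))"
        using e by (intro finsum_cong') (auto simp: rat_homology_simps rcycles_closed)
      then show ?thesis using e(1) by (simp add: finsum_rat_homology)
    qed
    have uniq: "\<exists>!a. a \<in> {..<n} \<rightarrow>\<^sub>E UNIV \<and> z - (\<Sum>i<n. rchain_scale (a i) (e i)) \<in> ?B" if "z \<in> ?Z" for z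
    proof -
      have "rhom_class p X z \<in> carrier ?H" using that by (simp add: rat_homology_simps(1))
      then have "\<exists>!a. a \<in> {..<n} \<rightarrow>\<^sub>E UNIV \<and> rhom_class p X z = rhom_class p X (\<Sum>i<n. rchain_scale (a i) (e i))"
        using basis unfolding module_basis_def carrier sums by blast
      then show ?thesis by (simp only: rhom_class_eq)
    qed
    obtain c where fr: "rchain.quotient_frame ?Z ?B n e c"
      and c: "\<And>v a i. v - (\<Sum>i<n. rchain_scale (a i) (e i)) \<in> ?B \<Longrightarrow> v \<in> ?Z \<Longrightarrow> i < n \<Longrightarrow> c i v = a i"
    proof (rule rchain.quotient_frameI[OF Z B, of n e])
      \<comment> \<open>Independence is uniqueness of the coordinates of the zero class. Uniqueness
        holds among extensional functions, so both \<open>a\<close> and the zero family are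
        restricted to \<open>{..<n}\<close> before they are compared.\<close>
      fix a assume "(\<Sum>i<n. rchain_scale (a i) (e i)) \<in> ?B"
      moreover have "(\<Sum>i<n. rchain_scale (restrict b {..<n} i) (e i)) = (\<Sum>i<n. rchain_scale (b i) (e i))" for b
        by (intro sum.cong) auto
      ultimately have 1: "0 - (\<Sum>i<n. rchain_scale (restrict a {..<n} i) (e i)) \<in> ?B"
        "0 - (\<Sum>i<n. rchain_scale (restrict (\<lambda>_. 0) {..<n} i) (e i)) \<in> ?B"
        using rboundaries_minus[of _ p X] rchain.subspace_0[OF B(1)] by auto
      have eq: "restrict a {..<n} = restrict (\<lambda>_. 0) {..<n}"
      proof (rule ex1_implies_eq[OF uniq[OF rchain.subspace_0[OF Z]]])
        show "restrict a {..<n} \<in> {..<n} \<rightarrow>\<^sub>E UNIV \<and>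
            0 - (\<Sum>i<n. rchain_scale (restrict a {..<n} i) (e i)) \<in> ?B"
          by (rule conjI[OF _ 1(1)]) simp
        show "restrict (\<lambda>_. 0) {..<n} \<in> {..<n} \<rightarrow>\<^sub>E UNIV \<and>
            0 - (\<Sum>i<n. rchain_scale (restrict (\<lambda>_. 0) {..<n} i) (e i)) \<in> ?B"
          by (rule conjI[OF _ 1(2)]) simp
      qed
      show "\<forall>i<n. a i = 0"
      proof (intro allI impI)
        fix i assume "i < n"
        then show "a i = 0" using fun_cong[OF eq, of i] by simp
      qed
    next
      fix v assume "v \<in> ?Z"
      from ex1_implies_ex[OF uniq[OF this]] show "\<exists>a. v - (\<Sum>i<n. rchain_scale (a i) (e i)) \<in> ?B"
        by (elim exE conjE) (rule exI)
    next
      fix c assume "rchain.quotient_frame ?Z ?B n e c"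
        "\<And>v a i. v - (\<Sum>i<n. rchain_scale (a i) (e i)) \<in> ?B \<Longrightarrow> v \<in> ?Z \<Longrightarrow> i < n \<Longrightarrow> c i v = a i"
      then show thesis by (rule that)
    qed (rule e(1))
    have "m i j = c i (rchain_map p f (e j))" if "i < n" "j < n" for i j
    proof -
      have "rhom_class p X (rchain_map p f (e j)) = rhom_class p X (\<Sum>i<n. rchain_scale (m i j) (e i))"
        using m[OF that(2)] e(2)[OF that(2)] by (simp add: sums rat_hom_induced_class[OF f])
      then show ?thesis
        using c[of "rchain_map p f (e j)" "\<lambda>i. m i j" i] e(1)[OF that(2)] inv(1) that(1)
        by (auto simp: rhom_class_eq)
    qed
    then show "t = rel_trace p X {} f" by (simp add: t trace[OF fr])
  qed
qed

subsection \<open>Points\<close>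

text \<open>In positive degrees the integral cycles of a point are boundaries, which carries over by
  scaling. In degree 0 the constant simplex \<open>?s\<close> is the only simplex and nothing but 0
  bounds, so its coefficient is the single coordinate and every self-map fixes it.\<close>

lemma point_homology:
  fixes X :: "'a topology"
  assumes a: "topspace X = {a}"
  shows rel_acyclic_point: "p > 0 \<Longrightarrow> rel_acyclic p X {}"
    and rel_finite_point: "rel_finite p X {}"
    and rel_trace_point: "continuous_map X X f \<Longrightarrow> rel_trace 0 X {} f = 1"
proof -
  show acyclic: "rel_acyclic p X {}" if p: "p > 0" for p
  proof
    fix z assume z: "z \<in> rel_rcycles p X {}"
    obtain N c where N: "N > 0" "rchain_scale (of_int N) z = rat_chain c"
      by (rule clear_denominators)
    have "rat_chain c \<in> rel_rcycles p X {}"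
      using z by (simp only: N(2)[symmetric] rchain.subspace_scale[OF subspace_rel_rcycles])
    then have "singular_relboundary p X {} c"
      using singular_boundary_eq_cycle_singleton[OF a, of p c] p by simp
    then have "rat_chain c \<in> rel_rboundaries p X {}" by (rule rat_chain_rel_rboundaries)
    then show "z \<in> rel_rboundaries p X {}"
      using N(1) subspace_scale_iff[OF subspace_rel_rboundaries, of "of_int N" z p X "{}"]
      by (simp add: N(2))
  qed
  let ?s = "restrict (\<lambda>x. a) (standard_simplex 0) :: (nat \<Rightarrow> real) \<Rightarrow> 'a"
  let ?e = "Poly_Mapping.single ?s (1::rat)"
  have keys: "c \<in> rchains 0 X \<longleftrightarrow> Poly_Mapping.keys c \<subseteq> {?s}" for c
    by (auto simp: rchains_def singular_simplex_singleton[OF a])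
  have Z: "rel_rcycles 0 X {} = rchains 0 X"
    by (auto simp: rel_rcycles_def rchain_boundary_def)
  have B: "rel_rboundaries 0 X {} = {0}"
  proof -
    have "z = 0" if z: "z \<in> rel_rboundaries 0 X {}" for z
    proof -
      obtain N c where "N > 0" "rchain_scale (of_int N) z = rat_chain c" "singular_relboundary 0 X {} c"
        using rel_rboundaries_clear_denominators[OF z] .
      then show ?thesis using singular_boundary_singleton[OF a, of 0 c] by (simp add: rat_chain_simps)
    qed
    then show ?thesis using rchain.subspace_0[OF subspace_rel_rboundaries, of 0 X "{}"] by blast
  qed
  have eZ: "?e \<in> rchains 0 X" by (simp add: keys)
  have expand: "v = rchain_scale (Poly_Mapping.lookup v ?s) ?e" if "v \<in> rchains 0 X" for v
    using that by (auto intro!: poly_mapping_eqI simp: keys lookup_single when_def in_keys_iff)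
  have fr: "rchain.quotient_frame (rel_rcycles 0 X {}) (rel_rboundaries 0 X {}) 1 (\<lambda>_. ?e)
      (\<lambda>_ v. Poly_Mapping.lookup v ?s)"
    unfolding rchain.quotient_frame_def Z B using eZ expand by (auto simp: lookup_add)
  show "rel_finite p X {}"
  proof (cases "p = 0")
    case True
    have "rchains 0 X \<subseteq> rchain.span ({?e} \<union> {0})"
    proof
      fix v assume v: "v \<in> rchains 0 X"
      show "v \<in> rchain.span ({?e} \<union> {0})"
        by (subst expand[OF v], rule rchain.span_scale, rule rchain.span_base) simp
    qed
    then show ?thesis unfolding True Z B rchain.finite_quotient_def by blast
  qed (use acyclic rchain.finite_quotient_trivial in blast)
  assume f: "continuous_map X X f"
  have "simplex_map 0 f ?s = ?s"
    using singular_simplex_simplex_map[OF _ f, of 0 ?s] by (simp add: singular_simplex_singleton[OF a])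
  then have "rchain_map 0 f ?e = ?e" by (simp add: rchain_map_def)
  moreover have inv: "rchain_map 0 f ` rel_rcycles 0 X {} \<subseteq> rel_rcycles 0 X {}"
    "rchain_map 0 f ` rel_rboundaries 0 X {} \<subseteq> rel_rboundaries 0 X {}"
    using rel_rcycles_map[OF f, of "{}" "{}"] rel_rboundaries_map[OF f, of "{}" "{}"] by auto
  ultimately show "rel_trace 0 X {} f = 1"
    using rchain.quotient_trace_eq[OF fr subspace_rel_rcycles rel_rboundaries_subset_rel_rcycles rchain_linear_map inv]
    by simp
qed

subsection \<open>Lefschetz numbers of pairs\<close>

text \<open>Vanishing above some degree is included so that the alternating sum of traces has
  finitely many nonzero terms.\<close>

definition homology_finite :: "'a topology \<Rightarrow> 'a set \<Rightarrow> bool" where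
  "homology_finite X S \<longleftrightarrow> (\<forall>p. rel_finite p X S) \<and> (\<exists>N. \<forall>p\<ge>N. rel_acyclic p X S)"

lemma homology_finiteI:
  assumes "\<And>p. rel_finite p X S" "\<And>p. p \<ge> N \<Longrightarrow> rel_acyclic p X S"
  shows "homology_finite X S"
  unfolding homology_finite_def by (intro conjI allI exI[of _ N] impI assms)

lemma homology_finiteD: "homology_finite X S \<Longrightarrow> rel_finite p X S"
  unfolding homology_finite_def by (elim conjE) (erule spec)

lemma homology_finiteE:
  assumes "homology_finite X S"
  obtains N where "\<And>p. p \<ge> N \<Longrightarrow> rel_acyclic p X S"
  using conjunct2[OF assms[unfolded homology_finite_def]] by (elim exE) (rule that, erule allE, erule mp)

lemma homology_finite_relative:
  assumes "homology_finite X {}" "homology_finite (subtopology X S) {}"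
  shows "homology_finite X S"
proof -
  obtain M N where M: "\<And>p. p \<ge> M \<Longrightarrow> rel_acyclic p X {}"
    and N: "\<And>p. p \<ge> N \<Longrightarrow> rel_acyclic p (subtopology X S) {}"
    using homology_finiteE[OF assms(1)] homology_finiteE[OF assms(2)] by metis
  \<comment> \<open>The successor compensates for the connecting map, which lands one degree lower
    in \<open>S\<close>.\<close>
  have "rel_acyclic p X S" if p: "p \<ge> Suc (max M N)" for p
  proof -
    obtain q where q: "p = Suc q" "q \<ge> M" "q \<ge> N" using p by (cases p) auto
    show ?thesis
      unfolding q(1) using q(2,3) by (intro rel_acyclic_relative[OF M N]) simp_all
  qed
  then show ?thesis
    by (rule homology_finiteI[OF rel_finite_relative[OF homology_finiteD[OF assms(1)] homology_finiteD[OF assms(2)]]])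
qed

lemma homology_finite_absolute:
  assumes "homology_finite (subtopology X S) {}" "homology_finite X S"
  shows "homology_finite X {}"
proof -
  obtain M N where M: "\<And>p. p \<ge> M \<Longrightarrow> rel_acyclic p (subtopology X S) {}"
    and N: "\<And>p. p \<ge> N \<Longrightarrow> rel_acyclic p X S"
    using homology_finiteE[OF assms(1)] homology_finiteE[OF assms(2)] by metis
  have "rel_acyclic p X {}" if p: "p \<ge> max M N" for p
    using p by (intro rel_acyclic_absolute[OF M N]) simp_all
  then show ?thesis
    by (rule homology_finiteI[OF rel_finite_absolute[OF homology_finiteD[OF assms(1)] homology_finiteD[OF assms(2)]]])
qed

lemma homology_finite_iso:
  assumes "\<And>p. quotient_iso (rchain_map p f) (rel_rcycles p X S) (rel_rboundaries p X S)
    (rel_rcycles p Y T) (rel_rboundaries p Y T)"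
  shows "homology_finite X S \<longleftrightarrow> homology_finite Y T"
  unfolding homology_finite_def by (simp only: rel_finite_iso[OF assms] rel_acyclic_iso[OF assms])

lemma rel_trace_acyclic:
  assumes "continuous_map X X f" "f ` (topspace X \<inter> S) \<subseteq> S" "rel_acyclic p X S"
  shows "rel_trace p X S f = 0"
  using assms(3) rel_rboundaries_subset_rel_rcycles
  by (intro rchain.quotient_trace_trivial subset_antisym subspace_rel_rcycles rchain_linear_map
      rel_rcycles_map[OF assms(1,2)]) 

definition rel_Lefschetz_number :: "('a \<Rightarrow> 'a) \<Rightarrow> 'a topology \<Rightarrow> 'a set \<Rightarrow> rat" where
  "rel_Lefschetz_number f X S = Sum_any (\<lambda>p. (-1) ^ p * rel_trace p X S f)"

lemma rel_Lefschetz_number_eq: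
  assumes f: "continuous_map X X f" "f ` (topspace X \<inter> S) \<subseteq> S" and N: "\<And>p. p \<ge> N \<Longrightarrow> rel_acyclic p X S"
  shows "rel_Lefschetz_number f X S = (\<Sum>p<N. (-1) ^ p * rel_trace p X S f)"
  unfolding rel_Lefschetz_number_def
proof (rule Sum_any.expand_superset)
  have "rel_trace p X S f = 0" if "p \<ge> N" for p
    by (rule rel_trace_acyclic[OF f N[OF that]])
  then show "{p. (-1) ^ p * rel_trace p X S f \<noteq> 0} \<subseteq> {..<N}"
    by (force simp: not_less[symmetric])
qed simp

lemma Lefschetz_number_eq:
  assumes "continuous_map X X f" "homology_finite X {}"
  shows "Lefschetz_number f X = rel_Lefschetz_number f X {}"
  using assms unfolding Lefschetz_number_def rel_Lefschetz_number_def homology_finite_def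
  by (simp add: module_trace_eq)

text \<open>Each \<open>d p\<close> returns in the next degree with the opposite sign, so the sum
  telescopes to its last term.\<close>

lemma alternating_sum_shift:
  fixes d :: "nat \<Rightarrow> rat"
  shows "(\<Sum>p<Suc n. (-1) ^ p * (d p + (if p = 0 then 0 else d (p - 1)))) = (-1) ^ n * d n"
  by (induction n) (simp_all add: algebra_simps)

lemma Lefschetz_number_pair:
  assumes f: "continuous_map X X f" "f ` (topspace X \<inter> S) \<subseteq> S"
    and X: "homology_finite X {}" and S: "homology_finite (subtopology X S) {}"
  shows "Lefschetz_number f X = Lefschetz_number f (subtopology X S) + rel_Lefschetz_number f X S"
proof -
  have fS: "continuous_map (subtopology X S) (subtopology X S) f"
    using f by (rule continuous_map_subtopologies)
  define d where "d = (\<lambda>p. rchain.quotient_trace (rcycles p (subtopology X S) \<inter> rboundaries p X)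
      (rboundaries p (subtopology X S)) (rchain_map p f))"
  have pieces: "rel_trace p X S f + rel_trace p (subtopology X S) {} f
      = rel_trace p X {} f + (d p + (if p = 0 then 0 else d (p - 1)))" for p
    using rel_trace_pieces[OF f homology_finiteD[OF X] homology_finiteD[OF S], of p] unfolding d_def by simp
  obtain N1 N2 N3 where N1: "\<And>p. p \<ge> N1 \<Longrightarrow> rel_acyclic p X {}"
    and N2: "\<And>p. p \<ge> N2 \<Longrightarrow> rel_acyclic p (subtopology X S) {}"
    and N3: "\<And>p. p \<ge> N3 \<Longrightarrow> rel_acyclic p X S"
    using homology_finiteE[OF X] homology_finiteE[OF S] homology_finiteE[OF homology_finite_relative[OF X S]]
    by metis
  \<comment> \<open>A degree beyond all three bounds. The sums include degree \<open>N\<close>, so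
    the telescoped remainder is \<open>d N\<close>, which is 0 because the homology of
    \<open>S\<close> vanishes there.\<close>
  define N where "N = N1 + N2 + N3"
  have dN: "d N = 0"
  proof -
    have "rel_acyclic N (subtopology X S) {}" by (rule N2) (simp add: N_def)
    then have eq: "rcycles N (subtopology X S) \<inter> rboundaries N X = rboundaries N (subtopology X S)"
      using rchain_pair_pieces.relative_inclusions(5)[of N X S]
      unfolding rel_rcycles_empty rel_rboundaries_empty by blast
    show ?thesis
      unfolding d_def
    proof (rule rchain.quotient_trace_trivial[OF eq _ rchain_linear_map])
      show "rchain.subspace (rcycles N (subtopology X S) \<inter> rboundaries N X)"
        by (intro rchain.subspace_inter subspace_rcycles subspace_rboundaries)
      show "rchain_map N f ` (rcycles N (subtopology X S) \<inter> rboundaries N X)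
          \<subseteq> rcycles N (subtopology X S) \<inter> rboundaries N X"
        unfolding eq by (rule rboundaries_map[OF fS])
    qed
  qed
  let ?sum = "\<lambda>t. \<Sum>p<Suc N. (-1) ^ p * (t p :: rat)"
  have "?sum (\<lambda>p. rel_trace p X S f) + ?sum (\<lambda>p. rel_trace p (subtopology X S) {} f)
      = ?sum (\<lambda>p. rel_trace p X S f + rel_trace p (subtopology X S) {} f)"
    by (simp only: distrib_left sum.distrib)
  also have "\<dots> = ?sum (\<lambda>p. rel_trace p X {} f) + ?sum (\<lambda>p. d p + (if p = 0 then 0 else d (p - 1)))"
    by (simp only: pieces distrib_left[of "(-1) ^ _"] sum.distrib)
  also have "?sum (\<lambda>p. d p + (if p = 0 then 0 else d (p - 1))) = 0"
    unfolding alternating_sum_shift dN by simp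
  finally have "?sum (\<lambda>p. rel_trace p X S f) + ?sum (\<lambda>p. rel_trace p (subtopology X S) {} f)
      = ?sum (\<lambda>p. rel_trace p X {} f)" by simp
  moreover have "rel_Lefschetz_number f X S = ?sum (\<lambda>p. rel_trace p X S f)"
    by (rule rel_Lefschetz_number_eq[OF f N3]) (simp add: N_def)
  moreover have "rel_Lefschetz_number f X {} = ?sum (\<lambda>p. rel_trace p X {} f)"
    by (rule rel_Lefschetz_number_eq[OF f(1) _ N1]) (simp_all add: N_def)
  moreover have "rel_Lefschetz_number f (subtopology X S) {} = ?sum (\<lambda>p. rel_trace p (subtopology X S) {} f)"
    by (rule rel_Lefschetz_number_eq[OF fS _ N2]) (simp_all add: N_def)
  ultimately show ?thesis
    using Lefschetz_number_eq[OF f(1) X] Lefschetz_number_eq[OF fS S] by simp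
qed

text \<open>Conjugate endomorphisms have equal traces. The square commutes on points of
  \<open>X\<close> by assumption and on integral chains by functoriality; rational chains follow by
  scaling.\<close>

lemma rel_Lefschetz_number_iso:
  assumes q: "\<And>p. quotient_iso (rchain_map p q) (rel_rcycles p X S) (rel_rboundaries p X S)
      (rel_rcycles p Y T) (rel_rboundaries p Y T)"
    and f: "continuous_map X X f" "f ` (topspace X \<inter> S) \<subseteq> S"
    and g: "continuous_map Y Y g" "g ` (topspace Y \<inter> T) \<subseteq> T"
    and comm: "\<And>x. x \<in> topspace X \<Longrightarrow> g (q x) = q (f x)"
    and fin: "\<And>p. rel_finite p X S"
  shows "rel_Lefschetz_number f X S = rel_Lefschetz_number g Y T"
proof -
  have comm': "rchain_map p g (rchain_map p q z) = rchain_map p q (rchain_map p f z)"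
    if z: "z \<in> rel_rcycles p X S" for p z
  proof -
    have zX: "z \<in> rchains p X" using z by (simp add: rel_rcycles_def)
    obtain N c where N: "N > 0" "rchain_scale (of_int N) z = rat_chain c" "singular_chain p X c"
      using rchains_clear_denominators[OF zX] .
    have "chain_map p g (chain_map p q c) = chain_map p (g \<circ> q) c" by (simp add: chain_map_compose)
    also have "\<dots> = chain_map p (q \<circ> f) c"
      by (rule chain_map_eq[OF N(3)]) (simp add: comm)
    also have "\<dots> = chain_map p q (chain_map p f c)" by (simp add: chain_map_compose)
    finally have "rat_chain (chain_map p g (chain_map p q c)) = rat_chain (chain_map p q (chain_map p f c))"
      by simp
    then show ?thesis
      using N(1) by (simp add: rat_chain_map N(2)[symmetric] rchain_map_scale)
  qed
  have "rel_trace p X S f = rel_trace p Y T g" for p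
  proof (rule rchain_pair.quotient_trace_iso[where g = "rchain_map p q"])
    show "rchain_map p g (rchain_map p q z) = rchain_map p q (rchain_map p f z)"
      if "z \<in> rel_rcycles p X S" for z
      using that by (rule comm')
  qed (rule rchain_linear_map q[of p] subspace_rel_rcycles subspace_rel_rboundaries
      rel_rboundaries_subset_rel_rcycles rel_rcycles_map[OF f] rel_rboundaries_map[OF f]
      rel_rcycles_map[OF g] rel_rboundaries_map[OF g] fin)+
  then show ?thesis by (simp add: rel_Lefschetz_number_def)
qed

lemma homology_finite_point:
  assumes "topspace X = {a}"
  shows "homology_finite X {}"
  by (rule homology_finiteI[OF rel_finite_point[OF assms] rel_acyclic_point[OF assms], of 1]) simp

lemma Lefschetz_number_point:
  assumes a: "topspace X = {a}" and f: "continuous_map X X f"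
  shows "Lefschetz_number f X = 1"
proof -
  have "rel_Lefschetz_number f X {} = (\<Sum>p<1. (-1) ^ p * rel_trace p X {} f)"
    by (rule rel_Lefschetz_number_eq[OF f]) (simp_all add: rel_acyclic_point[OF a])
  then show ?thesis
    using Lefschetz_number_eq[OF f homology_finite_point[OF a]] rel_trace_point[OF a f] by simp
qed

section \<open>Maps with equal values, and retracts\<close>

lemma rchain_map_cong:
  assumes "c \<in> rchains p X" "\<And>x. x \<in> topspace X \<Longrightarrow> f x = g x"
  shows "rchain_map p f c = rchain_map p g c"
  unfolding rchain_map_def
proof (intro sum.cong refl arg_cong2[of _ _ _ _ Poly_Mapping.single])
  fix s assume "s \<in> Poly_Mapping.keys c"
  then have "singular_simplex p X s" using assms(1) by (auto simp: rchains_def)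
  then show "simplex_map p f s = simplex_map p g s" by (rule simplex_map_eq) (rule assms(2))
qed

lemma rchain_map_ident:
  assumes "c \<in> rchains p X" "\<And>x. x \<in> topspace X \<Longrightarrow> f x = x"
  shows "rchain_map p f c = c"
proof -
  obtain N b where N: "N > 0" "rchain_scale (of_int N) c = rat_chain b" "singular_chain p X b"
    using rchains_clear_denominators[OF assms(1)] .
  have "chain_map p f b = b" using N(3) assms(2) by (rule chain_map_id_gen)
  then have "rchain_scale (of_int N) (rchain_map p f c) = rchain_scale (of_int N) c"
    by (simp only: rchain_map_scale[symmetric] N(2) rat_chain_map[symmetric])
  then show ?thesis using N(1) by simp
qed

text \<open>Chains of \<open>X\<close> meet only the values of the map on \<open>X\<close>. This
  lets \<open>restrict f A\<close>, which is arbitrary off \<open>A\<close>, be exchanged for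
  \<open>f\<close>.\<close>

lemma Lefschetz_number_cong:
  assumes "\<And>x. x \<in> topspace X \<Longrightarrow> f x = g x" "continuous_map X X f" "homology_finite X {}"
  shows "Lefschetz_number f X = Lefschetz_number g X"
proof -
  have g: "continuous_map X X g" using assms(1,2) by (rule continuous_map_eq[rotated])
  have eq: "rchain_map p f z = rchain_map p g z" if "z \<in> rel_rcycles p X {}" for p z
    using that assms(1) by (intro rchain_map_cong[of _ p X]) (auto simp: rel_rcycles_def)
  have "rel_trace p X {} f = rel_trace p X {} g" for p
  proof -
    have inv: "rchain_map p h ` rel_rcycles p X {} \<subseteq> rel_rcycles p X {}"
      "rchain_map p h ` rel_rboundaries p X {} \<subseteq> rel_rboundaries p X {}"
      if "continuous_map X X h" for h
      using rel_rcycles_map[OF that, of "{}" "{}"] rel_rboundaries_map[OF that, of "{}" "{}"] by auto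
    have iso: "quotient_iso id (rel_rcycles p X {}) (rel_rboundaries p X {}) (rel_rcycles p X {}) (rel_rboundaries p X {})"
      unfolding quotient_iso_def using rchain.subspace_0[OF subspace_rel_rboundaries]
      by (intro conjI ballI impI) (auto intro!: bexI)
    show ?thesis
    proof (rule rchain_pair.quotient_trace_iso[where g = id])
      show "rchain_map p g (id z) = id (rchain_map p f z)" if "z \<in> rel_rcycles p X {}" for z
        using eq[OF that] by simp
    qed (rule rchain.linear_id iso rchain_linear_map subspace_rel_rcycles subspace_rel_rboundaries
      rel_rboundaries_subset_rel_rcycles inv[OF assms(2)] inv[OF g] homology_finiteD[OF assms(3)])+
  qed
  then show ?thesis
    using Lefschetz_number_eq[OF assms(2,3)] Lefschetz_number_eq[OF g assms(3)]
    by (simp add: rel_Lefschetz_number_def)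
qed

text \<open>The retraction fixes cycles of \<open>S\<close> and sends boundaries of \<open>X\<close>
  to boundaries of \<open>S\<close>. Hence the homology of \<open>S\<close> is identified with its
  image \<open>(ZS + BX) / BX\<close> in the homology of \<open>X\<close>, which is finite.\<close>

lemma homology_finite_retract:
  assumes X: "homology_finite X {}" and r: "continuous_map X (subtopology X S) r"
    "\<And>x. x \<in> topspace X \<inter> S \<Longrightarrow> r x = x"
  shows "homology_finite (subtopology X S) {}"
proof -
  have incl: "rcycles p (subtopology X S) \<subseteq> rcycles p X"
    "rboundaries p (subtopology X S) \<subseteq> rboundaries p X" for p
    by (rule rchain_pair_pieces.inclusions(4), rule rchain_pair_pieces.inclusions(5))
  have inj: "z \<in> rboundaries p (subtopology X S)"
    if z: "z \<in> rcycles p (subtopology X S)" "z \<in> rboundaries p X" for p z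
  proof -
    have "z \<in> rchains p (subtopology X S)" using z(1) by (simp add: rcycles_def)
    then have "rchain_map p r z = z"
      by (rule rchain_map_ident) (simp add: r(2))
    then show ?thesis using rboundaries_map[OF r(1), of p] z(2) by (metis image_subset_iff)
  qed
  have iso: "quotient_iso id (rcycles p (subtopology X S)) (rboundaries p (subtopology X S))
      (rcycles p (subtopology X S) + rboundaries p X) (rboundaries p X)" for p
    unfolding quotient_iso_def
  proof (intro conjI ballI impI)
    show "id ` rcycles p (subtopology X S) \<subseteq> rcycles p (subtopology X S) + rboundaries p X"
      using set_plus_mono_left[OF rboundaries_closed(1)] by simp
    show "id ` rboundaries p (subtopology X S) \<subseteq> rboundaries p X" using incl(2) by simp
    fix w assume "w \<in> rcycles p (subtopology X S) + rboundaries p X"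
    then obtain z b where "w = z + b" "z \<in> rcycles p (subtopology X S)" "b \<in> rboundaries p X"
      by (rule set_plus_elim)
    then show "\<exists>z\<in>rcycles p (subtopology X S). w - id z \<in> rboundaries p X"
      by (intro bexI[of _ z]) simp_all
  qed (simp add: inj)
  have "rel_finite p (subtopology X S) {}" for p
  proof -
    have "rcycles p (subtopology X S) + rboundaries p X \<subseteq> rcycles p X"
      using incl(1)[of p] rboundaries_subset_rcycles[of p X] by (auto elim!: set_plus_elim intro!: rcycles_closed)
    moreover have "rchain.finite_quotient (rcycles p X) (rboundaries p X)"
      using homology_finiteD[OF X, of p] by (simp only: rel_rcycles_empty rel_rboundaries_empty)
    ultimately have "rchain.finite_quotient (rcycles p (subtopology X S) + rboundaries p X) (rboundaries p X)"
      using rchain.finite_quotient_mono[OF _ _ subset_refl] by blast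
    then show ?thesis
      unfolding rel_rcycles_empty rel_rboundaries_empty
      by (rule rchain_pair.finite_quotient_iso[OF rchain.linear_id iso subspace_rcycles
          subspace_rboundaries subspace_set_plus[OF subspace_rcycles subspace_rboundaries]
          subspace_rboundaries set_plus_mono_right[OF rcycles_closed(1)], THEN iffD2])
  qed
  moreover obtain N where N: "\<And>p. p \<ge> N \<Longrightarrow> rel_acyclic p X {}"
    using homology_finiteE[OF X] by metis
  moreover have "rel_acyclic p (subtopology X S) {}" if "p \<ge> N" for p
    using N[OF that] incl(1)[of p] inj[of _ p] unfolding rel_rcycles_empty rel_rboundaries_empty by blast
  ultimately show ?thesis by (intro homology_finiteI)
qed

section \<open>Collapsing a subspace\<close>

lemma continuous_map_collapse_proj: "continuous_map X (collapse_topology X A) (collapse_proj A)"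
  unfolding continuous_map_def
  by (auto simp: topspace_collapse_topology openin_collapse_topology)

lemma closedin_collapse_point:
  assumes "closedin X A"
  shows "closedin (collapse_topology X A) {None}"
proof -
  have "{x \<in> topspace X. collapse_proj A x \<in> topspace (collapse_topology X A) - {None}} = topspace X - A"
    by (auto simp: topspace_collapse_topology collapse_proj_def)
  then have "openin (collapse_topology X A) (topspace (collapse_topology X A) - {None})"
    using assms by (auto simp: openin_collapse_topology closedin_def topspace_collapse_topology)
  then show ?thesis by (simp add: closedin_def topspace_collapse_topology)
qed

text \<open>A set containing \<open>A\<close> is saturated for the collapse, so its image has the
  set itself as preimage.\<close>

lemma openin_collapse_neighbourhood:
  assumes "openin X N" "A \<subseteq> N"
  shows "openin (collapse_topology X A) (insert None (collapse_proj A ` N))"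
proof -
  have "N \<subseteq> topspace X" using assms(1) by (rule openin_subset)
  then have "{x \<in> topspace X. collapse_proj A x \<in> insert None (collapse_proj A ` N)} = N"
    using assms(2) by (auto simp: collapse_proj_def split: if_splits)
  then show ?thesis
    using assms(1) \<open>N \<subseteq> topspace X\<close> by (auto simp: openin_collapse_topology)
qed

lemma homeomorphic_map_collapse_proj:
  assumes "closedin X A"
  shows "homeomorphic_map (subtopology X (topspace X - A))
    (subtopology (collapse_topology X A) (topspace (collapse_topology X A) - {None})) (collapse_proj A)"
proof (rule bijective_open_imp_homeomorphic_map)
  let ?Y = "collapse_topology X A"
  have opA: "openin X (topspace X - A)" and opY: "openin ?Y (topspace ?Y - {None})"
    using assms closedin_collapse_point[OF assms] by (auto simp: closedin_def)
  show "continuous_map (subtopology X (topspace X - A)) (subtopology ?Y (topspace ?Y - {None})) (collapse_proj A)"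
    using continuous_map_collapse_proj[of X A]
    by (intro continuous_map_subtopologies) (auto simp: topspace_collapse_topology collapse_proj_def)
  show "open_map (subtopology X (topspace X - A)) (subtopology ?Y (topspace ?Y - {None})) (collapse_proj A)"
    unfolding open_map_def
  proof (intro allI impI)
    fix U assume "openin (subtopology X (topspace X - A)) U"
    then have U: "openin X U" "U \<subseteq> topspace X - A"
      using openin_open_subtopology[OF opA] by auto
    have "{x \<in> topspace X. collapse_proj A x \<in> collapse_proj A ` U} = U"
      using U(2) by (auto simp: collapse_proj_def split: if_splits)
    then have "openin ?Y (collapse_proj A ` U)"
      using U by (auto simp: openin_collapse_topology)
    moreover have "collapse_proj A ` U \<subseteq> topspace ?Y - {None}"
      using U(2) by (auto simp: topspace_collapse_topology collapse_proj_def)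
    ultimately show "openin (subtopology ?Y (topspace ?Y - {None})) (collapse_proj A ` U)"
      using openin_open_subtopology[OF opY] by blast
  qed
  show "collapse_proj A ` topspace (subtopology X (topspace X - A)) = topspace (subtopology ?Y (topspace ?Y - {None}))"
    by (auto simp: topspace_collapse_topology collapse_proj_def)
  show "inj_on (collapse_proj A) (topspace (subtopology X (topspace X - A)))"
    by (auto simp: inj_on_def collapse_proj_def)
qed

text \<open>\<open>A\<close> is closed inside the open set \<open>N\<close>, and \<open>None\<close>
  inside \<open>M\<close>, so both can be excised. What remains on the two sides is homeomorphic,
  because away from \<open>A\<close> no points are identified; the naturality square then transfers
  bijectivity.\<close>

lemma bij_hom_induced_collapse_neighbourhood:
  assumes A: "closedin X A" and N: "openin X N" "A \<subseteq> N"
  defines "Y \<equiv> collapse_topology X A" and "M \<equiv> insert None (collapse_proj A ` N)"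
  shows "bij_betw (hom_induced p X N Y M (collapse_proj A))
    (carrier (relative_homology_group p X N)) (carrier (relative_homology_group p Y M))"
proof -
  let ?q = "collapse_proj A"
  let ?X' = "subtopology X (topspace X - A)" and ?Y' = "subtopology Y (topspace Y - {None})"
  have NX: "N \<subseteq> topspace X" using N(1) by (rule openin_subset)
  have M: "openin Y M" unfolding Y_def M_def by (rule openin_collapse_neighbourhood[OF N])
  have None: "closedin Y {None}" unfolding Y_def by (rule closedin_collapse_point[OF A])
  have "hom_induced p (subtopology X (topspace X - A)) (N - A) (subtopology X (topspace X)) N id
      \<in> iso (relative_homology_group p ?X' (N - A)) (relative_homology_group p (subtopology X (topspace X)) N)"
    using A N NX by (intro homology_excision_axiom) (simp_all add: closure_of_closedin interior_of_openin)
  then have i: "bij_betw (hom_induced p ?X' (N - A) X N id) (carrier (relative_homology_group p ?X' (N - A)))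
      (carrier (relative_homology_group p X N))"
    by (simp add: iso_def)
  have "hom_induced p ?Y' (M - {None}) (subtopology Y (topspace Y)) M id
      \<in> iso (relative_homology_group p ?Y' (M - {None})) (relative_homology_group p (subtopology Y (topspace Y)) M)"
    using None M openin_subset[OF M]
    by (intro homology_excision_axiom) (simp_all add: closure_of_closedin interior_of_openin, simp add: M_def)
  then have j: "bij_betw (hom_induced p ?Y' (M - {None}) Y M id) (carrier (relative_homology_group p ?Y' (M - {None})))
      (carrier (relative_homology_group p Y M))"
    by (simp add: iso_def)
  have homeo: "homeomorphic_map ?X' ?Y' ?q"
    unfolding Y_def by (rule homeomorphic_map_collapse_proj[OF A])
  have "hom_induced p ?X' (N - A) ?Y' (M - {None}) ?q
      \<in> iso (relative_homology_group p ?X' (N - A)) (relative_homology_group p ?Y' (M - {None}))"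
    using NX by (intro homeomorphic_map_relative_homology_iso homeo) (auto simp: M_def collapse_proj_def)
  then have k: "bij_betw (hom_induced p ?X' (N - A) ?Y' (M - {None}) ?q)
      (carrier (relative_homology_group p ?X' (N - A))) (carrier (relative_homology_group p ?Y' (M - {None})))"
    by (simp add: iso_def)
  have q: "continuous_map X Y ?q" unfolding Y_def by (rule continuous_map_collapse_proj)
  have "hom_induced p X N Y M ?q \<circ> hom_induced p ?X' (N - A) X N id = hom_induced p ?X' (N - A) Y M (?q \<circ> id)"
    by (rule hom_induced_compose[symmetric]) (auto intro: q continuous_map_from_subtopology simp: M_def)
  also have "\<dots> = hom_induced p ?X' (N - A) Y M (id \<circ> ?q)" by simp
  also have "\<dots> = hom_induced p ?Y' (M - {None}) Y M id \<circ> hom_induced p ?X' (N - A) ?Y' (M - {None}) ?q"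
    by (rule hom_induced_compose)
      (auto intro: homeomorphic_imp_continuous_map[OF homeo] simp: M_def collapse_proj_def)
  finally show ?thesis
    using bij_betw_comp_iff[OF i, of "hom_induced p X N Y M ?q"] bij_betw_trans[OF k j] by simp
qed

text \<open>It is enough to deform a neighbourhood \<open>N\<close> of \<open>A\<close> into \<open>A\<close> inside \<open>X\<close>; the
  deformation need not stay inside \<open>N\<close>. At time \<open>1\<close> it gives maps of pairs
  \<open>(X, N) \<rightarrow> (X, A)\<close> and \<open>(X / A, M) \<rightarrow> (X / A, None)\<close> that are one-sided inverses of the inclusions.\<close>

proposition bij_hom_induced_collapse:
  fixes h :: "real \<times> 'a \<Rightarrow> 'a"
  assumes A: "closedin X A" and N: "openin X N" "A \<subseteq> N"
    and h: "continuous_map (prod_topology (top_of_set {0..1}) X) X h"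
    and h0: "\<And>x. x \<in> topspace X \<Longrightarrow> h (0, x) = x"
    and hA: "\<And>t a. t \<in> {0..1} \<Longrightarrow> a \<in> A \<Longrightarrow> h (t, a) \<in> A"
    and h1: "\<And>x. x \<in> N \<Longrightarrow> h (1, x) \<in> A"
  defines "Y \<equiv> collapse_topology X A"
  shows "bij_betw (hom_induced p X A Y {None} (collapse_proj A))
    (carrier (relative_homology_group p X A)) (carrier (relative_homology_group p Y {None}))"
proof -
  let ?q = "collapse_proj A"
  define M where "M = insert None (?q ` N)"
  have q: "continuous_map X Y ?q" unfolding Y_def by (rule continuous_map_collapse_proj)
  have bij: "bij_betw (hom_induced p X N Y M ?q)
      (carrier (relative_homology_group p X N)) (carrier (relative_homology_group p Y M))"
    unfolding Y_def M_def by (rule bij_hom_induced_collapse_neighbourhood[OF A N])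
  show ?thesis
  \<comment> \<open>For empty \<open>A\<close> the point \<open>None\<close> is not in the image of
    the projection, which is then no quotient map. In that case \<open>N\<close> is empty too, as it
    is sent into \<open>A\<close>, and the claim is \<open>bij\<close> itself.\<close>
  proof (cases "A = {}")
    case True
    then have "N = {}" using h1 by blast
    then show ?thesis using bij True by (simp add: M_def)
  next
    case False
    define h' where "h' = (\<lambda>t x. h (t, x))"
    define k where "k = (\<lambda>(t, y). collapse_map A (h' t) y)"
    have AX: "A \<subseteq> topspace X" using A by (rule closedin_subset)
    have kq: "k (t, ?q x) = ?q (h (t, x))" if "t \<in> {0..1}" for t x
      unfolding k_def h'_def using collapse_map_proj[of "\<lambda>x. h (t, x)" A x] hA[OF that] by auto
    have quot: "quotient_map X Y ?q"
      unfolding Y_def using AX False by (intro quotient_map_collapse_proj) blast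
    \<comment> \<open>A quotient map stays one after taking the product with the locally compact
      Hausdorff interval. This is what makes the descended homotopy \<open>k\<close>
      continuous.\<close>
    have "quotient_map (prod_topology (top_of_set {0..1::real}) X) (prod_topology (top_of_set {0..1}) Y) (\<lambda>(t, x). (t, ?q x))"
      by (rule quotient_map_prod_right[OF _ _ quot])
        (auto simp: compact_imp_locally_compact_space compact_space_subtopology Hausdorff_space_subtopology)
    moreover have "continuous_map (prod_topology (top_of_set {0..1}) X) Y (k \<circ> (\<lambda>(t, x). (t, ?q x)))"
      by (rule continuous_map_eq[OF continuous_map_compose[OF h q]]) (auto simp: kq)
    ultimately have k: "continuous_map (prod_topology (top_of_set {0..1}) Y) Y k"
      by (simp only: continuous_compose_quotient_map_eq)
    have ht: "continuous_map X X (h' t)" if "t \<in> {0..1}" for t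
      using continuous_map_o_Pair[OF h, of t] that by (simp add: h'_def o_def)
    have kt: "continuous_map Y Y (\<lambda>y. k (t, y))" if "t \<in> {0..1}" for t
      using continuous_map_o_Pair[OF k, of t] that by (simp add: o_def)
    have hA': "h' t \<in> A \<rightarrow> A" if "t \<in> {0..1}" for t
      using hA[OF that] by (auto simp: h'_def)
    have kN: "(\<lambda>y. k (t, y)) \<in> {None} \<rightarrow> {None}" for t
      by (auto simp: k_def collapse_map_def)
    have qA: "?q \<in> A \<rightarrow> {None}" "?q \<in> N \<rightarrow> M" by (auto simp: collapse_proj_def M_def)
    have h1N: "h' 1 \<in> N \<rightarrow> A" using h1 by (auto simp: h'_def)
    have k1M: "(\<lambda>y. k (1, y)) \<in> M \<rightarrow> {None}"
      using h1 kq[of 1] by (auto simp: M_def k_def collapse_map_def collapse_proj_def h'_def)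
    have k0: "k (0, y) = y" if y: "y \<in> topspace Y" for y
    proof (cases "y = None")
      case False
      then obtain x where "x \<in> topspace X" "y = ?q x"
        using y unfolding Y_def topspace_collapse_topology by blast
      then show ?thesis using kq[of 0 x] h0 by simp
    qed (simp add: k_def collapse_map_def)
    have homX: "hom_induced p X A X A (h' 1) = hom_induced p X A X A id"
    proof -
      have "homotopic_with (\<lambda>f. f \<in> A \<rightarrow> A) X X (h' 0) (h' 1)"
        unfolding homotopic_with_def using h hA' by (intro exI[of _ h]) (auto simp: h'_def)
      then have "hom_induced p X A X A (h' 0) = hom_induced p X A X A (h' 1)"
        by (rule homology_homotopy_axiom)
      moreover have "hom_induced p X A X A (h' 0) = hom_induced p X A X A id"
        by (rule hom_induced_eq) (simp add: h'_def h0)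
      ultimately show ?thesis by simp
    qed
    have homY: "hom_induced p Y {None} Y {None} (\<lambda>y. k (1, y)) = hom_induced p Y {None} Y {None} id"
    proof -
      have "homotopic_with (\<lambda>f. f \<in> {None} \<rightarrow> {None}) Y Y (\<lambda>y. k (0, y)) (\<lambda>y. k (1, y))"
        unfolding homotopic_with_def using k kN by (intro exI[of _ k]) auto
      then have "hom_induced p Y {None} Y {None} (\<lambda>y. k (0, y)) = hom_induced p Y {None} Y {None} (\<lambda>y. k (1, y))"
        by (rule homology_homotopy_axiom)
      moreover have "hom_induced p Y {None} Y {None} (\<lambda>y. k (0, y)) = hom_induced p Y {None} Y {None} id"
        by (rule hom_induced_eq) (simp add: k0)
      ultimately show ?thesis by simp
    qed
    let ?HXA = "carrier (relative_homology_group p X A)" and ?HXN = "carrier (relative_homology_group p X N)"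
    let ?HYB = "carrier (relative_homology_group p Y {None})"
    let ?Q = "hom_induced p X A Y {None} ?q" and ?Q' = "hom_induced p X N Y M ?q"
    let ?i = "hom_induced p X A X N id" and ?j = "hom_induced p Y {None} Y M id"
    let ?r = "hom_induced p X N X A (h' 1)" and ?s = "hom_induced p Y M Y {None} (\<lambda>y. k (1, y))"
    have idA: "id \<in> A \<rightarrow> N" "id \<in> {None} \<rightarrow> M" using N(2) by (auto simp: M_def)
    have idX: "continuous_map X X id" "continuous_map Y Y id" by auto
    have one: "(1::real) \<in> {0..1}" by simp
    have ri: "?r (?i x) = x" if "x \<in> ?HXA" for x
      using hom_induced_compose'[OF idX(1) idA(1) ht[OF one] h1N] homX hom_induced_id[OF that] by simp
    have sj: "?s (?j y) = y" if "y \<in> ?HYB" for y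
      using hom_induced_compose'[OF idX(2) idA(2) kt[OF one] k1M] homY hom_induced_id[OF that] by simp
    have Q'i: "?Q' (?i x) = ?j (?Q x)" for x
      using hom_induced_compose'[OF idX(1) idA(1) q qA(2)] hom_induced_compose'[OF q qA(1) idX(2) idA(2)] by simp
    have Qr: "?Q (?r x) = ?s (?Q' x)" for x
    proof -
      have "?Q (?r x) = hom_induced p X N Y {None} (?q \<circ> h' 1) x"
        by (rule hom_induced_compose'[OF ht[OF one] h1N q qA(1)])
      also have "hom_induced p X N Y {None} (?q \<circ> h' 1) = hom_induced p X N Y {None} ((\<lambda>y. k (1, y)) \<circ> ?q)"
        by (rule hom_induced_eq) (simp add: kq h'_def)
      also have "\<dots> x = ?s (?Q' x)"
        by (rule hom_induced_compose'[OF q qA(2) kt[OF one] k1M, symmetric])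
      finally show ?thesis .
    qed
    \<comment> \<open>By the four identities above, \<open>?Q\<close> is a retract of the bijection
      \<open>?Q'\<close>: \<open>?i\<close> and \<open>?j\<close> embed the one into the other,
      \<open>?r\<close> and \<open>?s\<close> undo them, and both squares commute. A retract of a
      bijection is a bijection.\<close>
    show ?thesis
    proof (rule bij_betw_imageI)
      show "inj_on ?Q ?HXA"
      proof (rule inj_onI)
        fix x y assume xy: "x \<in> ?HXA" "y \<in> ?HXA" "?Q x = ?Q y"
        then have "?Q' (?i x) = ?Q' (?i y)" by (simp add: Q'i)
        then have "?i x = ?i y"
          by (rule inj_onD[OF bij_betw_imp_inj_on[OF bij] _ hom_induced_carrier hom_induced_carrier])
        then have "?r (?i x) = ?r (?i y)" by (rule arg_cong)
        then show "x = y" by (simp only: ri[OF xy(1)] ri[OF xy(2)])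
      qed
      show "?Q ` ?HXA = ?HYB"
      proof (rule antisym)
        show "?Q ` ?HXA \<subseteq> ?HYB" by (auto intro: hom_induced_carrier)
        show "?HYB \<subseteq> ?Q ` ?HXA"
        proof
          fix y assume y: "y \<in> ?HYB"
          have "?j y \<in> ?Q' ` ?HXN"
            using bij_betw_imp_surj_on[OF bij] hom_induced_carrier[of p Y "{None}" Y M id y] by simp
          then obtain x where "?j y = ?Q' x" by blast
          then have "?s (?Q' x) = y" using sj[OF y] by (simp only:)
          then have "?Q (?r x) = y" using Qr[of x] by (simp only:)
          then show "y \<in> ?Q ` ?HXA" using hom_induced_carrier by (rule image_eqI[OF sym])
        qed
      qed
    qed
  qed
qed

text \<open>The motion is prescribed on a closed part of the cylinder
  \<open>{0..1} \<times> X\<close>: the identity at time 0 and over \<open>A\<close>, a retraction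
  to \<open>A\<close> at time 1 near \<open>A\<close>. As \<open>X\<close> is an ANR, this extends
  to a map \<open>G\<close> on a neighbourhood \<open>W\<close> of that part. \<open>W\<close> need
  not be the whole cylinder, so a Urysohn function slows down time in order that no point leaves
  \<open>W\<close>.\<close>

lemma ANR_neighbourhood_deformation:
  fixes X A :: "'a::euclidean_space set"
  assumes X: "ANR X" and A: "ANR A" and cl: "closedin (top_of_set X) A"
  obtains N and h :: "real \<times> 'a \<Rightarrow> 'a" where "openin (top_of_set X) N" "A \<subseteq> N"
    "continuous_on ({0..1} \<times> X) h" "h \<in> {0..1} \<times> X \<rightarrow> X"
    "\<And>x. x \<in> X \<Longrightarrow> h (0, x) = x" "\<And>t a. t \<in> {0..1} \<Longrightarrow> a \<in> A \<Longrightarrow> h (t, a) = a"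
    "\<And>x. x \<in> N \<Longrightarrow> h (1, x) \<in> A"
proof -
  have AX: "A \<subseteq> X" using cl by (rule closedin_imp_subset)
  obtain V where V: "openin (top_of_set X) V" "A retract_of V"
    using ANR_imp_neighbourhood_retract[OF A cl] .
  then obtain r where r: "continuous_on V r" "r ` V \<subseteq> A" "\<And>x. x \<in> A \<Longrightarrow> r x = x" "A \<subseteq> V"
    by (auto simp: retract_of_def retraction_def)
  have "closedin (top_of_set X) (X - V)" using V(1) by (simp add: closedin_diff)
  moreover have "A \<inter> (X - V) = {}" using r(4) by blast
  ultimately obtain S T where ST: "openin (top_of_set X) S" "openin (top_of_set X) T" "A \<subseteq> S" "X - V \<subseteq> T" "S \<inter> T = {}"
    by (rule separation_normal_local[OF cl])
  \<comment> \<open>The extension property takes data on closed sets, so the retraction is used only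
    on a closed neighbourhood \<open>C\<close> of \<open>A\<close> inside \<open>V\<close>.\<close>
  define C where "C = X - T"
  have C: "closedin (top_of_set X) C" "C \<subseteq> V" "S \<subseteq> C" "C \<subseteq> X"
    using ST openin_imp_subset[OF ST(1)] by (auto simp: C_def closedin_diff)
  let ?I = "{0..1::real}"
  define D1 where "D1 = {0::real} \<times> X \<union> ?I \<times> A"
  define D2 where "D2 = {1::real} \<times> C"
  have clD: "closedin (top_of_set (?I \<times> X)) D1" "closedin (top_of_set (?I \<times> X)) D2"
    unfolding D1_def D2_def using cl C(1)
    by (auto intro!: closedin_Un closedin_Times)
  have D: "D1 \<subseteq> ?I \<times> X" "D2 \<subseteq> ?I \<times> X" using AX C(4) by (auto simp: D1_def D2_def)
  \<comment> \<open>\<open>D1\<close> and \<open>D2\<close> can meet only at time 1 over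
    \<open>A\<close>, where \<open>r\<close> is the identity; so the two prescriptions agree
    there.\<close>
  define F where "F = (\<lambda>z. if z \<in> D1 then snd z else r (snd z))"
  have F2: "F z = r (snd z)" if "z \<in> D2" for z
    using that r(3) by (auto simp: F_def D1_def D2_def)
  have contF: "continuous_on (D1 \<union> D2) F"
  proof (rule continuous_on_Un_local)
    show "closedin (top_of_set (D1 \<union> D2)) D1" "closedin (top_of_set (D1 \<union> D2)) D2"
      using clD D by (auto intro: closedin_subset_trans)
    show "continuous_on D1 F"
      by (rule continuous_on_eq[of _ snd]) (auto simp: F_def intro: continuous_intros)
    have "continuous_on D2 (\<lambda>z. r (snd z))"
      using C(2) by (intro continuous_on_compose2[OF r(1)] continuous_intros) (auto simp: D2_def)
    then show "continuous_on D2 F" by (rule continuous_on_eq) (simp add: F2)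
  qed
  have FX: "F \<in> D1 \<union> D2 \<rightarrow> X"
  proof (rule Pi_I)
    fix z assume "z \<in> D1 \<union> D2"
    show "F z \<in> X"
    proof (cases "z \<in> D1")
      case False
      then have "z \<in> D2" using \<open>z \<in> D1 \<union> D2\<close> by blast
      then have "snd z \<in> V" using C(2) by (auto simp: D2_def)
      then show ?thesis using F2[OF \<open>z \<in> D2\<close>] r(2) AX by auto
    next
      case True
      then have "snd z \<in> X" using subsetD[OF D(1)] by (simp add: mem_Times_iff)
      then show ?thesis using True by (simp add: F_def)
    qed
  qed
  have "closedin (top_of_set (?I \<times> X)) (D1 \<union> D2)" using clD by (rule closedin_Un)
  then have "\<exists>W G. D1 \<union> D2 \<subseteq> W \<and> openin (top_of_set (?I \<times> X)) W \<and>
      continuous_on W G \<and> G \<in> W \<rightarrow> X \<and> (\<forall>z\<in>D1 \<union> D2. G z = F z)"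
    by (rule ANR_imp_absolute_neighbourhood_extensor[OF X contF FX]) (intro exI conjI ballI)
  then obtain W G where W: "D1 \<union> D2 \<subseteq> W" "openin (top_of_set (?I \<times> X)) W"
    and G: "continuous_on W G" "G \<in> W \<rightarrow> X" "\<And>z. z \<in> D1 \<union> D2 \<Longrightarrow> G z = F z"
    by (elim exE conjE) (rule that, assumption+, erule bspec)
  \<comment> \<open>The points whose time interval does not lie entirely in \<open>W\<close>. The
    set is closed because it is a projection along a compact interval.\<close>
  define T' where "T' = {x. \<exists>t. t \<in> ?I \<and> (t, x) \<in> ?I \<times> X - W}"
  have clT': "closedin (top_of_set X) T'"
    unfolding T'_def using W(2) by (intro closedin_compact_projection compact_Icc closedin_diff) auto
  define R where "R = T' \<union> (X - S)"
  have clR: "closedin (top_of_set X) R"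
    unfolding R_def using clT' ST(1) by (intro closedin_Un closedin_diff) auto
  have "A \<inter> R = {}"
  proof -
    have "(t, x) \<in> W" if "x \<in> A" "t \<in> ?I" for t x
    proof -
      have "(t, x) \<in> D1" using that by (simp add: D1_def)
      then show ?thesis using W(1) by blast
    qed
    then have "A \<inter> T' = {}" unfolding T'_def by blast
    then show ?thesis using ST(3) unfolding R_def by blast
  qed
  then have "\<exists>u :: 'a \<Rightarrow> real. continuous_on X u \<and> (\<forall>x\<in>X. u x \<in> closed_segment 1 0) \<and>
      (\<forall>x\<in>A. u x = 1) \<and> (\<forall>x\<in>R. u x = 0)"
    by (rule Urysohn_local[OF cl clR, of 1 0]) (intro exI conjI ballI)
  then obtain u :: "'a \<Rightarrow> real" where u: "continuous_on X u" "\<And>x. x \<in> X \<Longrightarrow> u x \<in> closed_segment 1 0"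
      "\<And>x. x \<in> A \<Longrightarrow> u x = 1" "\<And>x. x \<in> R \<Longrightarrow> u x = 0"
    by (elim exE conjE) (rule that, assumption, (erule bspec, assumption)+)
  have u01: "u x \<in> ?I" if "x \<in> X" for x using u(2)[OF that] by (simp add: closed_segment_eq_real_ivl)
  \<comment> \<open>Doubling and cutting off makes \<open>v\<close> equal to 1 on the open set
    \<open>u x > 1/2\<close>, not merely on \<open>A\<close>; thus at time 1 all of \<open>N\<close>
    reaches \<open>D2\<close>, where \<open>G\<close> is the retraction.\<close>
  define v where "v = (\<lambda>x. min 1 (2 * u x))"
  have v01: "v x \<in> ?I" if "x \<in> X" for x using u01[OF that] by (auto simp: v_def)
  have vW: "(t * v x, x) \<in> W" if "t \<in> ?I" "x \<in> X" for t x
  proof (cases "x \<in> R")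
    case True
    then have "(t * v x, x) \<in> D1" using u(4) that by (simp add: v_def D1_def)
    then show ?thesis using W(1) by blast
  next
    case False
    have "t * v x \<in> ?I" using that(1) v01[OF that(2)] by (auto simp: mult_le_one)
    then show ?thesis using False that(2) by (auto simp: R_def T'_def)
  qed
  define h where "h = (\<lambda>(t, x). G (t * v x, x))"
  define N where "N = {x \<in> X. u x \<in> {1/2<..}}"
  have vcont: "continuous_on X v" unfolding v_def using u(1) by (intro continuous_intros)
  show ?thesis
  proof (rule that)
    show "openin (top_of_set X) N"
      unfolding N_def using continuous_openin_preimage_gen[OF u(1), of "{1/2<..}"]
      by (simp add: vimage_def Int_def)
    show "A \<subseteq> N" using u(3) AX by (auto simp: N_def)
    have "continuous_on (?I \<times> X) (\<lambda>z. G (fst z * v (snd z), snd z))"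
      using vW by (intro continuous_on_compose2[OF G(1)] continuous_intros continuous_on_compose2[OF vcont]) auto
    then show "continuous_on (?I \<times> X) h" by (simp add: h_def case_prod_unfold)
    show "h \<in> ?I \<times> X \<rightarrow> X" using vW G(2) by (auto simp: h_def)
    show "h (0, x) = x" if "x \<in> X" for x
    proof -
      have "(0, x) \<in> D1" using that by (simp add: D1_def)
      then show ?thesis using G(3)[of "(0, x)"] by (simp add: h_def F_def)
    qed
    show "h (t, a) = a" if "t \<in> ?I" "a \<in> A" for t a
    proof -
      have "(t, a) \<in> D1" using that by (simp add: D1_def)
      then show ?thesis using G(3)[of "(t, a)"] u(3)[OF that(2)] by (simp add: h_def F_def v_def)
    qed
    show "h (1, x) \<in> A" if "x \<in> N" for x
    proof -
      have x: "x \<in> X" "u x > 1/2" using that by (auto simp: N_def)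
      then have "x \<notin> R" using u(4)[of x] by auto
      then have xC: "x \<in> C" using x(1) C(3) by (auto simp: R_def)
      then have "(1, x) \<in> D2" by (simp add: D2_def)
      moreover have "v x = 1" using x(2) by (simp add: v_def)
      ultimately have "h (1, x) = r x" using G(3)[of "(1, x)"] F2[of "(1, x)"] by (simp add: h_def)
      then show ?thesis using xC C(2) r(2) by auto
    qed
  qed
qed

lemma bij_hom_induced_collapse_ANR:
  fixes X A :: "'a::euclidean_space set"
  assumes "ANR X" "ANR A" "closedin (top_of_set X) A"
  shows "bij_betw (hom_induced p (top_of_set X) A (collapse_topology (top_of_set X) A) {None} (collapse_proj A))
    (carrier (relative_homology_group p (top_of_set X) A))
    (carrier (relative_homology_group p (collapse_topology (top_of_set X) A) {None}))"
proof (rule ANR_neighbourhood_deformation[OF assms])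
  fix N and h :: "real \<times> 'a \<Rightarrow> 'a"
  assume N: "openin (top_of_set X) N" "A \<subseteq> N"
    and h: "continuous_on ({0..1} \<times> X) h" "h \<in> {0..1} \<times> X \<rightarrow> X"
    "\<And>x. x \<in> X \<Longrightarrow> h (0, x) = x" "\<And>t a. t \<in> {0..1} \<Longrightarrow> a \<in> A \<Longrightarrow> h (t, a) = a"
    "\<And>x. x \<in> N \<Longrightarrow> h (1, x) \<in> A"
  show ?thesis
  proof (rule bij_hom_induced_collapse[OF assms(3) N, where h = h])
    show "continuous_map (prod_topology (top_of_set {0..1}) (top_of_set X)) (top_of_set X) h"
      unfolding prod_topology_subtopology_eu using h(1,2) by (simp only: continuous_map_subtopology_eu)
    show "h (0, x) = x" if "x \<in> topspace (top_of_set X)" for x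
      using h(3) that by simp
    show "h (t, a) \<in> A" if "t \<in> {0..1}" "a \<in> A" for t a
      using h(4)[OF that] that(2) by simp
  qed (rule h(5))
qed

section \<open>Finiteness of the homology of compact ANRs\<close>

lemma homology_finite_empty: "homology_finite trivial_topology {}"
proof -
  have "rel_acyclic p (trivial_topology :: 'a topology) {}" for p
    using rchain.subspace_0[OF subspace_rel_rboundaries, of p "trivial_topology :: 'a topology" "{}"]
    by (auto simp: rel_rcycles_def)
  then show ?thesis
    by (intro homology_finiteI[of _ _ 0] rchain.finite_quotient_trivial)
qed

text \<open>The Mayer-Vietoris argument split into two pairs: excising the complement of
  \<open>V\<close> identifies \<open>(V, U \<inter> V)\<close> with \<open>(X, U)\<close>. The first
  pair is finite because \<open>V\<close> and \<open>U \<inter> V\<close> are, and then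
  \<open>X\<close> is finite because \<open>U\<close> and \<open>(X, U)\<close> are.\<close>

lemma homology_finite_Un:
  assumes U: "openin X U" and V: "openin X V" and UV: "U \<union> V = topspace X"
    and fin: "homology_finite (subtopology X U) {}" "homology_finite (subtopology X V) {}"
      "homology_finite (subtopology X (U \<inter> V)) {}"
  shows "homology_finite X {}"
proof -
  have eqs: "topspace X - (topspace X - V) = V" "U - (topspace X - V) = U \<inter> V"
    using openin_subset[OF U] openin_subset[OF V] by auto
  have iso: "hom_induced p (subtopology X V) (U \<inter> V) X U id
      \<in> iso (relative_homology_group p (subtopology X V) (U \<inter> V)) (relative_homology_group p X U)" for p
  proof -
    have "X closure_of (topspace X - V) \<subseteq> X interior_of U"
      using U V UV by (auto simp: closure_of_closedin interior_of_openin closedin_diff)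
    from homology_excision_axiom[OF this openin_subset[OF U], of p]
    show ?thesis by (simp only: eqs subtopology_topspace)
  qed
  have "quotient_iso (rchain_map p id) (rel_rcycles p (subtopology X V) (U \<inter> V))
      (rel_rboundaries p (subtopology X V) (U \<inter> V)) (rel_rcycles p X U) (rel_rboundaries p X U)" for p
  proof (rule quotient_iso_hom_induced)
    show "continuous_map (subtopology X V) X id"
      by (rule continuous_map_from_subtopology) simp
    show "bij_betw (hom_induced (int p) (subtopology X V) (U \<inter> V) X U id)
        (carrier (relative_homology_group (int p) (subtopology X V) (U \<inter> V)))
        (carrier (relative_homology_group (int p) X U))"
      using iso[of "int p"] unfolding iso_def by blast
  qed auto
  then have "homology_finite (subtopology X V) (U \<inter> V) \<longleftrightarrow> homology_finite X U"
    by (rule homology_finite_iso)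
  moreover have "subtopology (subtopology X V) (U \<inter> V) = subtopology X (U \<inter> V)"
    by (simp add: subtopology_subtopology Int_commute Int_left_commute)
  ultimately have "homology_finite X U"
    using homology_finite_relative[OF fin(2), of "U \<inter> V"] fin(3) by metis
  then show ?thesis by (rule homology_finite_absolute[OF fin(1)])
qed

text \<open>Contraction along segments makes the inclusion of one point a homotopy
  equivalence.\<close>

lemma homology_finite_convex:
  fixes S :: "'a::real_normed_vector set"
  assumes "convex S"
  shows "homology_finite (top_of_set S) {}"
proof (cases "S = {}")
  case True
  then show ?thesis using homology_finite_empty by simp
next
  case False
  then obtain a where a: "a \<in> S" by blast
  have "homotopic_with (\<lambda>x. True) (top_of_set S) (top_of_set S) (\<lambda>x. a) id"
    using a assms by (intro homotopic_with_linear) (auto simp: convex_contains_segment)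
  then have *: "homotopic_with (\<lambda>x. True) (top_of_set S) (top_of_set S) (id \<circ> (\<lambda>x. a)) id"
    by (simp add: o_def)
  have iso: "hom_induced p (top_of_set {a}) {} (top_of_set S) {} id
      \<in> iso (homology_group p (top_of_set {a})) (homology_group p (top_of_set S))" for p
    using a by (intro homotopy_equivalence_homology_group_isomorphism[where g = "\<lambda>x. a"] * homotopic_with_equal) auto
  have "quotient_iso (rchain_map p id) (rel_rcycles p (top_of_set {a}) {})
      (rel_rboundaries p (top_of_set {a}) {}) (rel_rcycles p (top_of_set S) {}) (rel_rboundaries p (top_of_set S) {})" for p
  proof (rule quotient_iso_hom_induced)
    show "bij_betw (hom_induced (int p) (top_of_set {a}) {} (top_of_set S) {} id)
        (carrier (homology_group (int p) (top_of_set {a}))) (carrier (homology_group (int p) (top_of_set S)))"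
      using iso[of "int p"] unfolding iso_def by blast
  qed (use a in auto)
  then have "homology_finite (top_of_set {a}) {} \<longleftrightarrow> homology_finite (top_of_set S) {}"
    by (rule homology_finite_iso)
  moreover have "homology_finite (top_of_set {a}) {}" by (rule homology_finite_point[of _ a]) simp
  ultimately show ?thesis by blast
qed

text \<open>The induction must range over all families of length \<open>n\<close>: the last set
  meets the union of the others in the union of the \<open>n\<close> sets
  \<open>V i \<inter> V n\<close>, which are again open and convex.\<close>

lemma homology_finite_open_convex_Union:
  fixes V :: "nat \<Rightarrow> 'a::real_normed_vector set"
  assumes "\<And>i. i < n \<Longrightarrow> open (V i) \<and> convex (V i)"
  shows "homology_finite (top_of_set (\<Union>i<n. V i)) {}"
  using assms
proof (induction n arbitrary: V)
  case 0
  then show ?case using homology_finite_empty by simp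
next
  case (Suc n)
  let ?W = "\<Union>i<n. V i" and ?X = "top_of_set ((\<Union>i<n. V i) \<union> V n)"
  have un: "(\<Union>i<Suc n. V i) = ?W \<union> V n" by (auto simp: lessThan_Suc)
  have opn: "open (V i)" if "i < Suc n" for i using Suc.prems that by blast
  have sub: "subtopology ?X U = top_of_set U" if "U \<subseteq> ?W \<union> V n" for U
    using that by (simp add: subtopology_subtopology Int_absorb1)
  have "homology_finite (top_of_set ?W) {}"
    by (rule Suc.IH) (simp add: Suc.prems)
  moreover have "homology_finite (top_of_set (V n)) {}"
    using Suc.prems[of n] by (intro homology_finite_convex) simp
  moreover have "homology_finite (top_of_set (\<Union>i<n. V i \<inter> V n)) {}"
    by (rule Suc.IH) (simp add: Suc.prems open_Int convex_Int)
  moreover have "(\<Union>i<n. V i \<inter> V n) = ?W \<inter> V n" by blast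
  ultimately have fin: "homology_finite (subtopology ?X ?W) {}" "homology_finite (subtopology ?X (V n)) {}"
    "homology_finite (subtopology ?X (?W \<inter> V n)) {}"
    by (simp_all add: sub le_infI1)
  show ?case
    unfolding un
  proof (rule homology_finite_Un[OF _ _ _ fin])
    have "open ?W" using opn by (intro open_UN) auto
    then show "openin ?X ?W" by (intro open_subset) auto
    show "openin ?X (V n)" using opn[of n] by (intro open_subset) auto
    show "?W \<union> V n = topspace ?X" by simp
  qed
qed

lemma homology_finite_compact_ANR:
  fixes S :: "'a::euclidean_space set"
  assumes "compact S" "ANR S"
  shows "homology_finite (top_of_set S) {}"
proof -
  have "ENR S" using assms by (simp add: ENR_ANR compact_imp_closed closed_imp_locally_compact)
  then obtain V where V: "open V" "S retract_of V" by (auto simp: ENR_def)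
  have SV: "S \<subseteq> V" using V(2) by (rule retract_of_imp_subset)
  define \<B> where "\<B> = {ball x e | x e. ball x e \<subseteq> V}"
  have "S \<subseteq> \<Union>\<B>"
  proof
    fix x assume "x \<in> S"
    then obtain e where "e > 0" "ball x e \<subseteq> V" using SV V(1) open_contains_ball by blast
    then have "x \<in> ball x e" "ball x e \<in> \<B>" unfolding \<B>_def by auto
    then show "x \<in> \<Union>\<B>" by blast
  qed
  moreover have "open B" if "B \<in> \<B>" for B using that by (auto simp: \<B>_def)
  ultimately obtain \<F> where \<F>: "\<F> \<subseteq> \<B>" "finite \<F>" "S \<subseteq> \<Union>\<F>"
    using compactE[OF assms(1)] by metis
  obtain B and n :: nat where B: "\<F> = B ` {i. i < n}"
    using finite_imp_nat_seg_image_inj_on[OF \<F>(2)] by blast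
  let ?W = "\<Union>i<n. B i"
  have W: "\<Union>\<F> = ?W" by (auto simp: B)
  have ball: "open (B i) \<and> convex (B i) \<and> B i \<subseteq> V" if "i < n" for i
  proof -
    have "B i \<in> \<B>" using that \<F>(1) B by blast
    then show ?thesis by (auto simp: \<B>_def)
  qed
  have fin: "homology_finite (top_of_set ?W) {}"
    by (rule homology_finite_open_convex_Union) (simp add: ball)
  have "?W \<subseteq> V" using ball by (intro UN_least) simp
  \<comment> \<open>The retraction of \<open>V\<close> onto \<open>S\<close> restricts to the
    smaller set \<open>?W\<close>, which still contains \<open>S\<close>.\<close>
  have "S retract_of ?W"
    using V(2) \<F>(3) \<open>?W \<subseteq> V\<close> unfolding W by (rule retract_of_subset)
  then obtain r where r: "continuous_on ?W r" "r \<in> ?W \<rightarrow> S" "\<And>x. x \<in> S \<Longrightarrow> r x = x"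
    by (auto simp: retract_of_def retraction_def)
  have eq: "subtopology (top_of_set ?W) S = top_of_set S"
    using \<F>(3) by (simp add: W subtopology_subtopology Int_absorb1)
  have "homology_finite (subtopology (top_of_set ?W) S) {}"
  proof (rule homology_finite_retract[OF fin])
    show "continuous_map (top_of_set ?W) (subtopology (top_of_set ?W) S) r"
      unfolding eq using r(1,2) by simp
  qed (use r(3) in simp)
  then show ?thesis unfolding eq .
qed

section \<open>The collapse formula for compact ANRs and for polyhedra\<close>

theorem Lefschetz_number_collapse:
  fixes f :: "'a::euclidean_space \<Rightarrow> 'a" and X A :: "'a set"
  assumes X: "compact X" "ANR X" and A: "compact A" "ANR A" "A \<subseteq> X"
    and f: "continuous_map (top_of_set X) (top_of_set X) f" "f ` A \<subseteq> A"
  defines "Y \<equiv> collapse_topology (top_of_set X) A"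
  shows "Lefschetz_number f (top_of_set X) =
    Lefschetz_number f (top_of_set A) + Lefschetz_number (collapse_map A f) Y - 1"
proof -
  let ?X = "top_of_set X" and ?q = "collapse_proj A" and ?g = "collapse_map A f"
  have clA: "closedin ?X A" using A by (simp add: closed_subset compact_imp_closed)
  have subA: "subtopology ?X A = top_of_set A"
    using A(3) by (simp add: subtopology_subtopology Int_absorb1)
  have fX: "homology_finite ?X {}" by (rule homology_finite_compact_ANR[OF X])
  have fA: "homology_finite (subtopology ?X A) {}" unfolding subA by (rule homology_finite_compact_ANR[OF A(1,2)])
  have fim: "f ` (topspace ?X \<inter> A) \<subseteq> A" using f(2) by auto
  have q: "continuous_map ?X Y ?q" unfolding Y_def by (rule continuous_map_collapse_proj)
  have gq: "?g (?q x) = ?q (f x)" for x by (rule collapse_map_proj[OF f(2)])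
  have iso: "quotient_iso (rchain_map p ?q) (rel_rcycles p ?X A) (rel_rboundaries p ?X A)
      (rel_rcycles p Y {None}) (rel_rboundaries p Y {None})" for p
  proof (rule quotient_iso_hom_induced[OF q])
    show "?q \<in> topspace ?X \<inter> A \<rightarrow> {None}" by (simp add: collapse_proj_def)
    show "bij_betw (hom_induced (int p) ?X A Y {None} ?q) (carrier (relative_homology_group (int p) ?X A))
        (carrier (relative_homology_group (int p) Y {None}))"
      unfolding Y_def by (rule bij_hom_induced_collapse_ANR[OF X(2) A(2) clA])
  qed
  have g: "continuous_map Y Y ?g"
    unfolding continuous_map_def
  proof (intro conjI allI impI)
    have qf: "continuous_map ?X Y (?q \<circ> f)" by (rule continuous_map_compose[OF f(1) q])
    have topY: "topspace Y = insert None (?q ` X)"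
      by (simp add: Y_def topspace_collapse_topology)
    have fXX: "f x \<in> X" if "x \<in> X" for x using f(1) that by (auto simp: continuous_map_def)
    show "?g \<in> topspace Y \<rightarrow> topspace Y"
    proof (rule Pi_I)
      fix y assume "y \<in> topspace Y"
      then consider "y = None" | x where "x \<in> X" "y = ?q x" unfolding topY by blast
      then show "?g y \<in> topspace Y"
        by cases (use fXX in \<open>simp_all add: topY gq\<close>, simp add: collapse_map_def)
    qed
    \<comment> \<open>Openness in \<open>Y\<close> is tested by pulling back to \<open>X\<close>;
      this also covers empty \<open>A\<close>, where \<open>?q\<close> is not a quotient
      map.\<close>
    fix U assume U: "openin Y U"
    have "{x \<in> X. ?q x \<in> {y \<in> topspace Y. ?g y \<in> U}} = {x \<in> topspace ?X. (?q \<circ> f) x \<in> U}"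
      by (auto simp: topY gq)
    then have "openin ?X {x \<in> X. ?q x \<in> {y \<in> topspace Y. ?g y \<in> U}}"
      using openin_continuous_map_preimage[OF qf U] by simp
    moreover have "{y \<in> topspace Y. ?g y \<in> U} \<subseteq> insert None (?q ` X)" unfolding topY by blast
    ultimately show "openin Y {y \<in> topspace Y. ?g y \<in> U}"
      unfolding Y_def openin_collapse_topology topspace_euclidean_subtopology by (intro conjI)
  qed
  have gim: "?g ` (topspace Y \<inter> {None}) \<subseteq> {None}" by (auto simp: collapse_map_def)
  have "topspace (subtopology Y {None}) = {None}" by (simp add: Y_def topspace_collapse_topology)
  note point = homology_finite_point[OF this] Lefschetz_number_point[OF this continuous_map_subtopologies[OF g gim]]
  \<comment> \<open>\<open>Y\<close> is not given inside a Euclidean space, so its finiteness is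
    reached through the pair: from \<open>(X, A)\<close> to \<open>(Y, None)\<close> by the
    isomorphism, then to \<open>Y\<close> by adding the point.\<close>
  have fXA: "homology_finite ?X A" by (rule homology_finite_relative[OF fX fA])
  then have "homology_finite Y {None}" using homology_finite_iso[OF iso] by blast
  then have fY: "homology_finite Y {}" by (rule homology_finite_absolute[OF point(1)])
  have "rel_Lefschetz_number f ?X A = rel_Lefschetz_number ?g Y {None}"
    by (rule rel_Lefschetz_number_iso[OF iso f(1) fim g gim gq homology_finiteD[OF fXA]])
  then show ?thesis
    using Lefschetz_number_pair[OF f(1) fim fX fA] Lefschetz_number_pair[OF g gim fY point(1)] point(2)
    by (simp add: subA)
qed

theorem theorem4p1:
  fixes f :: "'a::euclidean_space \<Rightarrow> 'a" and \<K> \<L> :: "'a set set" and X A :: "'a set"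
  assumes "simplicial_complex \<K>" and "X = \<Union>\<K>"
    and "simplicial_complex \<L>" and "\<L> \<subseteq> \<K>" and "A = \<Union>\<L>"
    and "continuous_map (top_of_set X) (top_of_set X) f"
    and "open_map (top_of_set X) (top_of_set X) f"
    and "f ` A = A" and "f ` (X - A) \<subseteq> X - A"
  shows "Lefschetz_number f (top_of_set X) =
           Lefschetz_number (restrict f A) (top_of_set A)
           + Lefschetz_number (collapse_map A f) (collapse_topology (top_of_set X) A) - 1"
proof -
  \<comment> \<open>A polyhedron is a finite union of simplices, which are compact and convex; a
    finite union of closed convex sets is an ANR.\<close>
  have polyhedron: "compact (\<Union>\<C>) \<and> ANR (\<Union>\<C>)" if "simplicial_complex \<C>" for \<C> :: "'a set set"
  proof -
    have "compact C \<and> convex C" if "C \<in> \<C>" for C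
      using that \<open>simplicial_complex \<C>\<close> unfolding simplicial_complex_def
      by (meson compact_simplex convex_simplex)
    then show ?thesis
      using that by (auto simp: simplicial_complex_def intro!: compact_Union ANR_finite_Union_convex_closed compact_imp_closed)
  qed
  have X: "compact X" "ANR X" and A: "compact A" "ANR A" "A \<subseteq> X"
    using polyhedron[OF assms(1)] polyhedron[OF assms(3)] assms(2,4,5) by auto
  have "continuous_on A f" "f \<in> A \<rightarrow> A"
    using assms(6,8) A(3) by (auto intro: continuous_on_subset)
  then have "continuous_map (top_of_set A) (top_of_set A) f" by simp
  then have "Lefschetz_number f (top_of_set A) = Lefschetz_number (restrict f A) (top_of_set A)"
    by (intro Lefschetz_number_cong homology_finite_compact_ANR A(1,2)) simp
  then show ?thesis
    using Lefschetz_number_collapse[OF X A assms(6)] assms(8) by simp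
qed

end
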